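(* Assume the structural hypotheses on $f$, $G$ and $h$ listed in the context, and let $\tau\in\mathbb R$. Consider the problem $$u_{tt}-\Delta u_t+\Delta^2u+\lambda u+f(u)=G(t,u^t)+h(x,t)\ \text{ in }\Omega,\ t>\tau,\qquad u=\Delta u=0\ \text{ on }\partial\Omega,$$ $$u(x,\tau+\theta)=\phi_0(x,\theta),\quad u_t(x,\tau+\theta)=\phi_1(x,\theta),\qquad x\in\Omega,\ \theta\in[-r,0],$$ with $(\phi_0,\phi_1)\in\mathcal H_c$. Then the weak solution of this problem is unique. Moreover, let $u$ and $v$ be two weak solutions corresponding to initial histories $(\phi_{0,1},\phi_{1,1})\in\mathcal H_c$ and $(\phi_{0,2},\phi_{1,2})\in\mathcal H_c$, respectively. Then, for every $T>\tau$, there exists a constant $C_2=C_2(T,R)>0$ such that $$\|u^t-v^t\|_{C_V}^2+\|(u_t)^t-(v_t)^t\|_{C_H}^2\le C_2\left(\|\phi_{0,1}-\phi_{0,2}\|_{C_V}^2+\|\phi_{1,1}-\phi_{1,2}\|_{C_H}^2\right),\qquad t\in[\tau,T],$$ where $R$ is the radius used in the local Lipschitz condition on $f$ and depends on the bounds of the two initial histories, and $C_2$ is independent of $u-v$.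
   Context: **Setting.** $\Omega\subset\mathbb R^N$ ($N\ge1$) is a bounded domain with smooth boundary, $\lambda>0$, $r>0$. $H=L^2(\Omega)$ with norm $\|\cdot\|$ and inner product $(\cdot,\cdot)$; $V=H^2(\Omega)\cap H_0^1(\Omega)$, with the norm $\|\Delta\cdot\|$ (equivalent to the $H^2$ norm); $V'$ is the dual of $V$. For a Banach space $X$, $C_X=C([-r,0];X)$ with the sup norm. For a function $u$ of time, the history is $u^t(\theta)=u(t+\theta)$, $\theta\in[-r,0]$, while $u_t$ is the time derivative; $(u_t)^t(\theta)=u_t(t+\theta)$. The compatible history space is $$\mathcal H_c=\{(\phi_0,\phi_1)\in C_V\times C_H:\ \phi_0\in C^1([-r,0];H),\ \partial_\theta\phi_0=\phi_1\text{ in }C_H\},$$ with the norm of $\mathcal H=C_V\times C_H$. **Hypotheses on $f$.** $f\in C^1(\mathbb R,\mathbb R)$, $f(0)=0$, $F(s)=\int_0^sf(\xi)\,d\xi$. There are $C_f>0$ with $F(s)\ge-C_f-\frac\lambda4s^2$ for all $s\in\mathbb R$, and $\mu_0,\delta_0,C_0>0$, with $\delta_0$ sufficiently small (below a threshold depending only on $\Omega,\lambda,\mu_0$), such that $f(s)s\ge\mu_0F(s)-\delta_0s^2-C_0$ for all $s\in\mathbb R$. Growth: there are $C>0$ and $\rho\ge 1$ with $|f(s)|\le C(1+|s|^\rho)$, where $1\le\rho\le\frac N{N-4}$ if $N>4$, and $\rho\geq 1$ is any finite exponent if $1\le N\le4$. Local Lipschitz: for every $R>0$ there is $L_R>0$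 with $\|f(u)-f(v)\|\le L_R\|u-v\|_V$ whenever $\|u\|_V+\|v\|_V\le R$. **Hypotheses on $G:\mathbb R\times C_H\to H$.** (G1) $t\mapsto G(t,\xi)$ is measurable for every $\xi\in C_H$. (G2) $G(t,0)=0$ for all $t$. (G3) There is $L_G>0$ with $\|G(t,\xi)-G(t,\eta)\|\le L_G\|\xi-\eta\|_{C_H}$ for all $t\in\mathbb R$, $\xi,\eta\in C_H$. (G4) There are $m_0>0$, $C_1>0$ such that for every $m\in[0,m_0]$, all $\tau\le t$ and all $u,v\in C([\tau-r,t];H)$, $\int_\tau^te^{ms}\|G(s,u^s)-G(s,v^s)\|^2ds\le C_1\int_{\tau-r}^te^{ms}\|u(s)-v(s)\|^2ds$. **Hypothesis on $h$.** $h\in L^2_{\rm loc}(\mathbb R;H)$. **Weak solution.** $u$ is a weak solution on $[\tau-r,T]$ with initial history $(\phi_0,\phi_1)\in\mathcal H_c$ if $u(t)=\phi_0(t-\tau)$ and $u_t(t)=\phi_1(t-\tau)$ for $t\in[\tau-r,\tau]$; $u\in L^\infty(\tau,T;V)$, $u_t\in L^\infty(\tau,T;H)\cap L^2(\tau,T;H_0^1(\Omega))$, $u_{tt}\in L^2(\tau,T;V')$; and for every $\varphi\in V$ and a.e. $t\in(\tau,T)$, $$(u_{tt}(t),\varphi)+(\nabla u_t(t),\nabla\varphi)+(\Delta u(t),\Delta\varphi)+\lambda(u(t),\varphi)+(f(u(t)),\varphi)=(G(t,u^t),\varphi)+(h(t),\varphi),$$ where the first term is the $V'$–$V$ duality pairing.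 A weak solution exists on $[\tau-r,T]$ for every $T>\tau$ and satisfies $u\in C([\tau-r,T];V)$, $u_t\in C([\tau-r,T];H)$. *)

theory Defs
  imports "HOL-Analysis.Analysis"
begin

section \<open>The Hilbert space of square-integrable functions\<close>

text \<open>
  The type \<open>'a L2\<close> is the space of square-integrable real functions on all of \<open>'a\<close>, modulo
  equality almost everywhere (every Lebesgue class has a Borel representative, so \<^term>\<open>lborel\<close>
  loses nothing). For a set \<open>\<Omega>\<close>, \<open>L\<^sup>2(\<Omega>)\<close> is the subspace \<open>H \<Omega>\<close> below of the classes vanishing
  a.e. outside \<open>\<Omega>\<close>, i.e. functions on \<open>\<Omega>\<close> are extended by zero.
\<close>

definition sq_int :: "('a::euclidean_space \<Rightarrow> real) \<Rightarrow> bool" where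
  "sq_int f \<longleftrightarrow> f \<in> borel_measurable lborel \<and> integrable lborel (\<lambda>x. (f x)\<^sup>2)"

definition sq_eq :: "('a::euclidean_space \<Rightarrow> real) \<Rightarrow> ('a \<Rightarrow> real) \<Rightarrow> bool" where
  "sq_eq f g \<longleftrightarrow> sq_int f \<and> sq_int g \<and> (AE x in lborel. f x = g x)"

lemma sq_int_zero [simp]: "sq_int (\<lambda>x. 0)"
  by (simp add: sq_int_def)

lemma sq_int_mult:
  assumes "sq_int f" "sq_int g"
  shows "integrable lborel (\<lambda>x. f x * g x)"
proof (rule Bochner_Integration.integrable_bound)
  show "integrable lborel (\<lambda>x. (f x)\<^sup>2 + (g x)\<^sup>2)"
    using assms by (simp add: sq_int_def)
  show "(\<lambda>x. f x * g x) \<in> borel_measurable lborel"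
    using assms unfolding sq_int_def by (intro borel_measurable_times) auto
  have "\<bar>a * b\<bar> \<le> a\<^sup>2 + b\<^sup>2" for a b :: real
  proof -
    have "0 \<le> (\<bar>a\<bar> - \<bar>b\<bar>)\<^sup>2" "0 \<le> \<bar>a\<bar> * \<bar>b\<bar>" by auto
    then show ?thesis
      unfolding power2_diff abs_mult power2_abs by linarith
  qed
  then show "AE x in lborel. norm (f x * g x) \<le> norm ((f x)\<^sup>2 + (g x)\<^sup>2)"
    by simp
qed

lemma sq_int_add:
  assumes "sq_int f" "sq_int g"
  shows "sq_int (\<lambda>x. f x + g x)"
proof -
  have "integrable lborel (\<lambda>x. (f x)\<^sup>2 + (g x)\<^sup>2 + 2 * (f x * g x))"
    using assms sq_int_mult[OF assms] by (simp add: sq_int_def)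
  moreover have "(\<lambda>x. f x + g x) \<in> borel_measurable lborel"
    using assms unfolding sq_int_def by (intro borel_measurable_add) auto
  ultimately show ?thesis
    by (simp add: sq_int_def power2_sum mult.assoc)
qed

lemma sq_int_scale: "sq_int f \<Longrightarrow> sq_int (\<lambda>x. c * f x)"
  unfolding sq_int_def power_mult_distrib by (intro conjI borel_measurable_times) auto

lemma sq_int_uminus: "sq_int f \<Longrightarrow> sq_int (\<lambda>x. - f x)"
  by (simp add: sq_int_def)

lemma sq_int_diff: "sq_int f \<Longrightarrow> sq_int g \<Longrightarrow> sq_int (\<lambda>x. f x - g x)"
  using sq_int_add[OF _ sq_int_uminus] by fastforce

quotient_type (overloaded) 'a L2 = "'a::euclidean_space \<Rightarrow> real" / partial: sq_eq
proof (rule part_equivpI)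
  show "\<exists>f :: 'a \<Rightarrow> real. sq_eq f f"
    by (rule exI[of _ "\<lambda>_. 0"]) (simp add: sq_eq_def)
  show "symp (sq_eq :: ('a \<Rightarrow> real) \<Rightarrow> _)"
    by (auto simp: symp_def sq_eq_def)
  show "transp (sq_eq :: ('a \<Rightarrow> real) \<Rightarrow> _)"
    unfolding transp_def sq_eq_def by auto
qed

text \<open>A chosen representative of a class, and the class of a function (junk value \<open>0\<close> if the
  function is not square-integrable).\<close>

definition ofL2 :: "'a::euclidean_space L2 \<Rightarrow> 'a \<Rightarrow> real" where
  "ofL2 = rep_L2"

definition toL2 :: "('a::euclidean_space \<Rightarrow> real) \<Rightarrow> 'a L2" where
  "toL2 f = (if sq_int f then abs_L2 f else abs_L2 (\<lambda>_. 0))"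

instantiation L2 :: (euclidean_space) real_inner
begin

lift_definition zero_L2 :: "'a L2" is "\<lambda>_. 0"
  by (simp add: sq_eq_def)

lift_definition plus_L2 :: "'a L2 \<Rightarrow> 'a L2 \<Rightarrow> 'a L2" is "\<lambda>f g x. f x + g x"
  by (auto simp: sq_eq_def sq_int_add)

lift_definition uminus_L2 :: "'a L2 \<Rightarrow> 'a L2" is "\<lambda>f x. - f x"
  by (auto simp: sq_eq_def sq_int_uminus)

lift_definition minus_L2 :: "'a L2 \<Rightarrow> 'a L2 \<Rightarrow> 'a L2" is "\<lambda>f g x. f x - g x"
  by (auto simp: sq_eq_def sq_int_diff)

lift_definition scaleR_L2 :: "real \<Rightarrow> 'a L2 \<Rightarrow> 'a L2" is "\<lambda>c f x. c * f x"
  by (auto simp: sq_eq_def sq_int_scale)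

lift_definition inner_L2 :: "'a L2 \<Rightarrow> 'a L2 \<Rightarrow> real" is "\<lambda>f g. LINT x|lborel. f x * g x"
  by (rule integral_cong_AE)
    (auto simp: sq_eq_def dest: sq_int_mult[THEN borel_measurable_integrable])

definition norm_L2 :: "'a L2 \<Rightarrow> real" where
  "norm_L2 u = sqrt (u \<bullet> u)"

definition dist_L2 :: "'a L2 \<Rightarrow> 'a L2 \<Rightarrow> real" where
  "dist_L2 u v = norm (u - v)"

definition sgn_L2 :: "'a L2 \<Rightarrow> 'a L2" where
  "sgn_L2 u = scaleR (inverse (norm u)) u"

definition uniformity_L2 :: "('a L2 \<times> 'a L2) filter" where
  "uniformity_L2 = (INF e\<in>{0<..}. principal {(u, v). dist u v < e})"

definition open_L2 :: "'a L2 set \<Rightarrow> bool" where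
  "open_L2 U \<longleftrightarrow> (\<forall>u\<in>U. eventually (\<lambda>(u', v). u' = u \<longrightarrow> v \<in> U) uniformity)"

instance
proof
  fix u v w :: "'a L2" and a b :: real and U :: "'a L2 set"
  show "u + v + w = u + (v + w)"
    by transfer (auto simp: sq_eq_def sq_int_add add.assoc)
  show "u + v = v + u"
    by transfer (auto simp: sq_eq_def sq_int_add add.commute)
  show "0 + u = u"
    by transfer (auto simp: sq_eq_def)
  show "- u + u = 0"
    by transfer (auto simp: sq_eq_def)
  show "u - v = u + - v"
    by transfer (auto simp: sq_eq_def sq_int_diff)
  show "a *\<^sub>R (u + v) = a *\<^sub>R u + a *\<^sub>R v"
    by transfer (auto simp: sq_eq_def sq_int_add sq_int_scale distrib_left)
  show "(a + b) *\<^sub>R u = a *\<^sub>R u + b *\<^sub>R u"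
    by transfer (auto simp: sq_eq_def sq_int_add sq_int_scale distrib_right)
  show "a *\<^sub>R b *\<^sub>R u = (a * b) *\<^sub>R u"
    by transfer (auto simp: sq_eq_def sq_int_scale mult.assoc)
  show "1 *\<^sub>R u = u"
    by transfer (auto simp: sq_eq_def)
  show "dist u v = norm (u - v)" by (simp add: dist_L2_def)
  show "sgn u = scaleR (inverse (norm u)) u" by (simp add: sgn_L2_def)
  show "(uniformity :: ('a L2 \<times> 'a L2) filter) = (INF e\<in>{0<..}. principal {(u, v). dist u v < e})"
    by (simp add: uniformity_L2_def)
  show "open U \<longleftrightarrow> (\<forall>u\<in>U. \<forall>\<^sub>F (u', v) in uniformity. u' = u \<longrightarrow> v \<in> U)"
    by (simp add: open_L2_def)
  show "u \<bullet> v = v \<bullet> u"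
    by transfer (simp add: mult.commute)
  show "(u + v) \<bullet> w = u \<bullet> w + v \<bullet> w"
    by transfer (simp add: sq_eq_def distrib_right sq_int_mult)
  show "a *\<^sub>R u \<bullet> v = a * (u \<bullet> v)"
    by transfer (simp add: mult.assoc)
  show "0 \<le> u \<bullet> u"
    by transfer simp
  show "u \<bullet> u = 0 \<longleftrightarrow> u = 0"
  proof transfer
    fix f :: "'a \<Rightarrow> real"
    assume "sq_eq f f"
    then have "sq_int f" by (simp add: sq_eq_def)
    then show "((LINT x|lborel. f x * f x) = 0) = sq_eq f (\<lambda>_. 0)"
      using integral_nonneg_eq_0_iff_AE[OF sq_int_mult[of f f]] by (auto simp: sq_eq_def)
  qed
  show "norm u = sqrt (u \<bullet> u)" by (simp add: norm_L2_def)
qed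

end

definition H :: "'a::euclidean_space set \<Rightarrow> 'a L2 set" where
  "H \<Omega> = {u. AE x in lborel. x \<notin> \<Omega> \<longrightarrow> ofL2 u x = 0}"

section \<open>Smooth functions, test functions and smooth domains\<close>

definition pd :: "'a::euclidean_space \<Rightarrow> ('a \<Rightarrow> real) \<Rightarrow> 'a \<Rightarrow> real" where
  "pd i f x = frechet_derivative f (at x) i"

primrec Ck_on :: "nat \<Rightarrow> 'a::euclidean_space set \<Rightarrow> ('a \<Rightarrow> real) \<Rightarrow> bool" where
  "Ck_on 0 U f \<longleftrightarrow> continuous_on U f"
| "Ck_on (Suc k) U f \<longleftrightarrow> (\<forall>x\<in>U. f differentiable (at x)) \<and> (\<forall>i\<in>Basis. Ck_on k U (pd i f))"

definition smooth_on :: "'a::euclidean_space set \<Rightarrow> ('a \<Rightarrow> real) \<Rightarrow> bool" where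
  "smooth_on U f \<longleftrightarrow> (\<forall>k. Ck_on k U f)"

definition test_functions :: "'a::euclidean_space set \<Rightarrow> ('a \<Rightarrow> real) set" where
  "test_functions \<Omega> = {\<psi>. smooth_on UNIV \<psi> \<and> compact (closure {x. \<psi> x \<noteq> 0}) \<and>
                         closure {x. \<psi> x \<noteq> 0} \<subseteq> \<Omega>}"

text \<open>Near each boundary point, \<open>\<Omega>\<close> is the sublevel set of a smooth function
  with non-vanishing differential (so \<open>\<Omega>\<close> lies locally on one side of its boundary).\<close>

definition smooth_bounded_domain :: "'a::euclidean_space set \<Rightarrow> bool" where
  "smooth_bounded_domain \<Omega> \<longleftrightarrow> open \<Omega> \<and> connected \<Omega> \<and> \<Omega> \<noteq> {} \<and> bounded \<Omega> \<and>
     (\<forall>p\<in>frontier \<Omega>. \<exists>U \<sigma>. open U \<and> p \<in> U \<and> smooth_on U \<sigma> \<and>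
        frechet_derivative \<sigma> (at p) \<noteq> (\<lambda>_. 0) \<and> \<Omega> \<inter> U = {x\<in>U. \<sigma> x < 0})"

section \<open>Sobolev spaces\<close>

definition weak_pd :: "'a::euclidean_space set \<Rightarrow> 'a \<Rightarrow> 'a L2 \<Rightarrow> 'a L2 \<Rightarrow> bool" where
  "weak_pd \<Omega> i u g \<longleftrightarrow> g \<in> H \<Omega> \<and>
     (\<forall>\<psi>\<in>test_functions \<Omega>. u \<bullet> toL2 (pd i \<psi>) = - (g \<bullet> toL2 \<psi>))"

definition H1 :: "'a::euclidean_space set \<Rightarrow> 'a L2 set" where
  "H1 \<Omega> = {u \<in> H \<Omega>. \<forall>i\<in>Basis. \<exists>g. weak_pd \<Omega> i u g}"

definition wpd :: "'a::euclidean_space set \<Rightarrow> 'a \<Rightarrow> 'a L2 \<Rightarrow> 'a L2" where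
  "wpd \<Omega> i u = (THE g. weak_pd \<Omega> i u g)"

definition grad_inner :: "'a::euclidean_space set \<Rightarrow> 'a L2 \<Rightarrow> 'a L2 \<Rightarrow> real" where
  "grad_inner \<Omega> u v = (\<Sum>i\<in>Basis. wpd \<Omega> i u \<bullet> wpd \<Omega> i v)"

definition normH1 :: "'a::euclidean_space set \<Rightarrow> 'a L2 \<Rightarrow> real" where
  "normH1 \<Omega> u = sqrt ((norm u)\<^sup>2 + grad_inner \<Omega> u u)"

definition H10 :: "'a::euclidean_space set \<Rightarrow> 'a L2 set" where
  "H10 \<Omega> = {u \<in> H1 \<Omega>. \<forall>e>0. \<exists>\<psi>\<in>test_functions \<Omega>. normH1 \<Omega> (u - toL2 \<psi>) < e}"

definition H2 :: "'a::euclidean_space set \<Rightarrow> 'a L2 set" where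
  "H2 \<Omega> = {u \<in> H1 \<Omega>. \<forall>i\<in>Basis. wpd \<Omega> i u \<in> H1 \<Omega>}"

definition laplacian :: "'a::euclidean_space set \<Rightarrow> 'a L2 \<Rightarrow> 'a L2" where
  "laplacian \<Omega> u = (\<Sum>i\<in>Basis. wpd \<Omega> i (wpd \<Omega> i u))"

definition V :: "'a::euclidean_space set \<Rightarrow> 'a L2 set" where
  "V \<Omega> = H2 \<Omega> \<inter> H10 \<Omega>"

definition normV :: "'a::euclidean_space set \<Rightarrow> 'a L2 \<Rightarrow> real" where
  "normV \<Omega> u = norm (laplacian \<Omega> u)"

text \<open>The dual of \<open>V\<close>; a functional is a function on the whole type whose values off \<open>V\<close> are
  irrelevant.\<close>

definition Vdual :: "'a::euclidean_space set \<Rightarrow> ('a L2 \<Rightarrow> real) set" where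
  "Vdual \<Omega> = {l. (\<forall>\<phi>\<in>V \<Omega>. \<forall>\<eta>\<in>V \<Omega>. l (\<phi> + \<eta>) = l \<phi> + l \<eta>) \<and>
                 (\<forall>c. \<forall>\<phi>\<in>V \<Omega>. l (c *\<^sub>R \<phi>) = c * l \<phi>) \<and>
                 (\<exists>B. \<forall>\<phi>\<in>V \<Omega>. \<bar>l \<phi>\<bar> \<le> B * normV \<Omega> \<phi>)}"

definition normVdual :: "'a::euclidean_space set \<Rightarrow> ('a L2 \<Rightarrow> real) \<Rightarrow> real" where
  "normVdual \<Omega> l = (SUP \<phi>\<in>{\<phi>\<in>V \<Omega>. normV \<Omega> \<phi> \<le> 1}. \<bar>l \<phi>\<bar>)"

section \<open>Spaces of vector-valued functions of time\<close>

text \<open>In this section a normed space is given by a carrier \<open>X\<close> and a norm \<open>N\<close> on it, because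
  \<open>V\<close>, \<open>H\<^sub>0\<^sup>1\<close> and \<open>V'\<close> do not carry the norm of the ambient type.\<close>

definition cont_into :: "'b set \<Rightarrow> ('b \<Rightarrow> real) \<Rightarrow> real set \<Rightarrow> (real \<Rightarrow> 'b::minus) \<Rightarrow> bool" where
  "cont_into X N I u \<longleftrightarrow> (\<forall>t\<in>I. u t \<in> X) \<and>
     (\<forall>t\<in>I. ((\<lambda>s. N (u s - u t)) \<longlongrightarrow> 0) (at t within I))"

text \<open>Bochner measurability on \<open>I\<close>: almost everywhere the \<open>N\<close>-limit of simple functions.\<close>

definition strongly_measurable ::
    "'b set \<Rightarrow> ('b \<Rightarrow> real) \<Rightarrow> real set \<Rightarrow> (real \<Rightarrow> 'b::minus) \<Rightarrow> bool" where
  "strongly_measurable X N I u \<longleftrightarrow>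
     (\<exists>s :: nat \<Rightarrow> real \<Rightarrow> 'b.
        (\<forall>n. finite (range (s n)) \<and> range (s n) \<subseteq> X \<and> (\<forall>x. s n -` {x} \<in> sets lebesgue)) \<and>
        (AE t in lebesgue. t \<in> I \<longrightarrow> u t \<in> X \<and> (\<lambda>n. N (s n t - u t)) \<longlonglongrightarrow> 0))"

definition Linf_into :: "'b set \<Rightarrow> ('b \<Rightarrow> real) \<Rightarrow> real set \<Rightarrow> (real \<Rightarrow> 'b::minus) \<Rightarrow> bool" where
  "Linf_into X N I u \<longleftrightarrow> strongly_measurable X N I u \<and>
     (\<exists>B. AE t in lebesgue. t \<in> I \<longrightarrow> N (u t) \<le> B)"

definition L2_into :: "'b set \<Rightarrow> ('b \<Rightarrow> real) \<Rightarrow> real set \<Rightarrow> (real \<Rightarrow> 'b::minus) \<Rightarrow> bool" where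
  "L2_into X N I u \<longleftrightarrow> strongly_measurable X N I u \<and>
     (\<integral>\<^sup>+ t\<in>I. ennreal ((N (u t))\<^sup>2) \<partial>lebesgue) < \<infinity>"

definition L2loc_into :: "'b set \<Rightarrow> ('b \<Rightarrow> real) \<Rightarrow> (real \<Rightarrow> 'b::minus) \<Rightarrow> bool" where
  "L2loc_into X N u \<longleftrightarrow> (\<forall>a b. L2_into X N {a..b} u)"

text \<open>\<open>g'\<close> is the derivative of \<open>g\<close> in the sense of distributions on \<open>(a, b)\<close>.\<close>

definition distr_deriv :: "real \<Rightarrow> real \<Rightarrow> (real \<Rightarrow> real) \<Rightarrow> (real \<Rightarrow> real) \<Rightarrow> bool" where
  "distr_deriv a b g g' \<longleftrightarrow>
     (\<forall>\<psi>\<in>test_functions {a<..<b}.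
        (LINT t|lebesgue. g t * deriv \<psi> t) = - (LINT t|lebesgue. g' t * \<psi> t))"

text \<open>Histories are functions on the whole real line of which only the values on \<open>[-r, 0]\<close>
  matter; \<open>sup_norm r N\<close> is the norm of \<open>C([-r,0]; X)\<close> when \<open>N\<close> is the norm of \<open>X\<close>.\<close>

definition hist :: "(real \<Rightarrow> 'b) \<Rightarrow> real \<Rightarrow> real \<Rightarrow> 'b" where
  "hist u t = (\<lambda>\<theta>. u (t + \<theta>))"

definition sup_norm :: "real \<Rightarrow> ('b \<Rightarrow> real) \<Rightarrow> (real \<Rightarrow> 'b) \<Rightarrow> real" where
  "sup_norm r N \<xi> = (SUP \<theta>\<in>{-r..0}. N (\<xi> \<theta>))"

definition C_H :: "'a::euclidean_space set \<Rightarrow> real \<Rightarrow> (real \<Rightarrow> 'a L2) set" where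
  "C_H \<Omega> r = {\<xi>. cont_into (H \<Omega>) norm {-r..0} \<xi>}"

definition C_V :: "'a::euclidean_space set \<Rightarrow> real \<Rightarrow> (real \<Rightarrow> 'a L2) set" where
  "C_V \<Omega> r = {\<xi>. cont_into (V \<Omega>) (normV \<Omega>) {-r..0} \<xi>}"

definition compatible_histories ::
    "'a::euclidean_space set \<Rightarrow> real \<Rightarrow> ((real \<Rightarrow> 'a L2) \<times> (real \<Rightarrow> 'a L2)) set" where
  "compatible_histories \<Omega> r = {(\<phi>0, \<phi>1). \<phi>0 \<in> C_V \<Omega> r \<and> \<phi>1 \<in> C_H \<Omega> r \<and>
     (\<forall>\<theta>\<in>{-r..0}. (\<phi>0 has_vector_derivative \<phi>1 \<theta>) (at \<theta> within {-r..0}))}"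

section \<open>Structural hypotheses\<close>

definition primitive :: "(real \<Rightarrow> real) \<Rightarrow> real \<Rightarrow> real" where
  "primitive f s = (LBINT \<xi>=0..s. f \<xi>)"

text \<open>Composition of \<open>f\<close> with a class; it vanishes outside \<open>\<Omega>\<close> for \<open>u \<in> H \<Omega>\<close> since \<open>f 0 = 0\<close>.\<close>

definition compL2 :: "(real \<Rightarrow> real) \<Rightarrow> 'a::euclidean_space L2 \<Rightarrow> 'a L2" where
  "compL2 f u = toL2 (\<lambda>x. f (ofL2 u x))"

text \<open>In the local Lipschitz condition the bound on the \<open>L\<^sup>2\<close> norm of \<open>f(u) - f(v)\<close> includes that
  this difference is square-integrable; with \<open>v = 0\<close> it gives \<open>f(u) \<in> L\<^sup>2\<close> for \<open>u \<in> V\<close>, so that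
  \<^term>\<open>compL2 f u\<close> is not a junk value there.\<close>

definition f_hypotheses ::
    "'a::euclidean_space set \<Rightarrow> real \<Rightarrow> real \<Rightarrow> real \<Rightarrow> (real \<Rightarrow> real) \<Rightarrow> bool" where
  "f_hypotheses \<Omega> lam \<mu>0 \<delta>0 f \<longleftrightarrow>
     f C1_differentiable_on UNIV \<and> f 0 = 0 \<and>
     (\<exists>Cf>0. \<forall>s. primitive f s \<ge> - Cf - lam / 4 * s\<^sup>2) \<and>
     (\<exists>C0>0. \<forall>s. f s * s \<ge> \<mu>0 * primitive f s - \<delta>0 * s\<^sup>2 - C0) \<and>
     (\<exists>C>0. \<exists>\<rho>\<ge>1. (DIM('a) > 4 \<longrightarrow> \<rho> \<le> real DIM('a) / (real DIM('a) - 4)) \<and>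
        (\<forall>s. \<bar>f s\<bar> \<le> C * (1 + \<bar>s\<bar> powr \<rho>))) \<and>
     (\<forall>R>0. \<exists>L>0. \<forall>u\<in>V \<Omega>. \<forall>v\<in>V \<Omega>. normV \<Omega> u + normV \<Omega> v \<le> R \<longrightarrow>
        sq_int (\<lambda>x. f (ofL2 u x) - f (ofL2 v x)) \<and>
        norm (toL2 (\<lambda>x. f (ofL2 u x) - f (ofL2 v x))) \<le> L * normV \<Omega> (u - v))"

definition G_hypotheses ::
    "'a::euclidean_space set \<Rightarrow> real \<Rightarrow> (real \<Rightarrow> (real \<Rightarrow> 'a L2) \<Rightarrow> 'a L2) \<Rightarrow> bool" where
  "G_hypotheses \<Omega> r G \<longleftrightarrow>
     (\<forall>t. \<forall>\<xi>\<in>C_H \<Omega> r. G t \<xi> \<in> H \<Omega>) \<and>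
     (\<forall>\<xi>\<in>C_H \<Omega> r. (\<lambda>t. G t \<xi>) \<in> borel_measurable lebesgue) \<and>
     (\<forall>t. G t (\<lambda>_. 0) = 0) \<and>
     (\<exists>LG>0. \<forall>t. \<forall>\<xi>\<in>C_H \<Omega> r. \<forall>\<eta>\<in>C_H \<Omega> r.
        norm (G t \<xi> - G t \<eta>) \<le> LG * sup_norm r norm (\<lambda>\<theta>. \<xi> \<theta> - \<eta> \<theta>)) \<and>
     (\<exists>m0>0. \<exists>C1>0. \<forall>m\<in>{0..m0}. \<forall>a t. a \<le> t \<longrightarrow>
        (\<forall>u v. cont_into (H \<Omega>) norm {a - r..t} u \<longrightarrow> cont_into (H \<Omega>) norm {a - r..t} v \<longrightarrow>
           (LINT s:{a..t}|lebesgue. exp (m * s) * (norm (G s (hist u s) - G s (hist v s)))\<^sup>2)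
           \<le> C1 * (LINT s:{a - r..t}|lebesgue. exp (m * s) * (norm (u s - v s))\<^sup>2)))"

section \<open>Weak solutions\<close>

text \<open>
  \<open>u\<close> is a weak solution on \<open>[\<tau> - r, T]\<close> with time derivative \<open>ut\<close>. Both are taken to be the
  representatives that are continuous into \<open>V\<close> and \<open>H\<close>: this is the regularity every weak
  solution has, and it is what ties the solution on \<open>(\<tau>, T)\<close> to its history at \<open>t = \<tau>\<close> and
  gives the values \<open>u(t)\<close>, \<open>ut(t)\<close> a meaning for each single \<open>t\<close>. The second derivative \<open>utt\<close>
  has values in \<open>V'\<close>, and \<open>utt t \<phi>\<close> is the duality pairing, \<open>H\<close> being identified with its dual.
\<close>

definition weak_solution ::
    "'a::euclidean_space set \<Rightarrow> real \<Rightarrow> real \<Rightarrow> (real \<Rightarrow> real) \<Rightarrow>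
     (real \<Rightarrow> (real \<Rightarrow> 'a L2) \<Rightarrow> 'a L2) \<Rightarrow> (real \<Rightarrow> 'a L2) \<Rightarrow> real \<Rightarrow> real \<Rightarrow>
     (real \<Rightarrow> 'a L2) \<Rightarrow> (real \<Rightarrow> 'a L2) \<Rightarrow> (real \<Rightarrow> 'a L2) \<Rightarrow> (real \<Rightarrow> 'a L2) \<Rightarrow> bool" where
  "weak_solution \<Omega> lam r f G h \<tau> T \<phi>0 \<phi>1 u ut \<longleftrightarrow>
     (\<forall>t\<in>{\<tau> - r..\<tau>}. u t = \<phi>0 (t - \<tau>) \<and> ut t = \<phi>1 (t - \<tau>)) \<and>
     cont_into (V \<Omega>) (normV \<Omega>) {\<tau> - r..T} u \<and>
     cont_into (H \<Omega>) norm {\<tau> - r..T} ut \<and>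
     Linf_into (V \<Omega>) (normV \<Omega>) {\<tau><..<T} u \<and>
     Linf_into (H \<Omega>) norm {\<tau><..<T} ut \<and>
     L2_into (H10 \<Omega>) (normH1 \<Omega>) {\<tau><..<T} ut \<and>
     (\<forall>\<phi>\<in>H \<Omega>. distr_deriv \<tau> T (\<lambda>t. u t \<bullet> \<phi>) (\<lambda>t. ut t \<bullet> \<phi>)) \<and>
     (\<exists>utt. L2_into (Vdual \<Omega>) (normVdual \<Omega>) {\<tau><..<T} utt \<and>
        (\<forall>\<phi>\<in>V \<Omega>. distr_deriv \<tau> T (\<lambda>t. ut t \<bullet> \<phi>) (\<lambda>t. utt t \<phi>)) \<and>
        (\<forall>\<phi>\<in>V \<Omega>. AE t in lebesgue. t \<in> {\<tau><..<T} \<longrightarrow>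
           utt t \<phi> + grad_inner \<Omega> (ut t) \<phi> + laplacian \<Omega> (u t) \<bullet> laplacian \<Omega> \<phi>
             + lam * (u t \<bullet> \<phi>) + compL2 f (u t) \<bullet> \<phi>
           = G t (hist u t) \<bullet> \<phi> + h t \<bullet> \<phi>))"

end

theory Submission
  imports Defs "HOL-Computational_Algebra.Polynomial" "HOL-Real_Asymp.Real_Asymp"
begin

text \<open>
  The difference \<open>w\<close> of two solutions solves the linear damped plate equation with a right-hand side
  that is bounded in \<open>H\<close> by the history of \<open>\<parallel>\<Delta>w\<parallel>\<close>, so the theorem rests on the energy inequality for
  \<open>\<parallel>w\<^sub>t\<parallel>\<^sup>2 + \<parallel>\<Delta>w\<parallel>\<^sup>2\<close> and a Gronwall argument. The formal test function \<open>w\<^sub>t\<close> is not in \<open>V\<close>; it is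
  replaced by difference quotients of \<open>w\<close> in time, tested against the equation averaged in time.
  For the bound of the radius \<open>R\<close> by the initial histories the same inequality is applied to a single
  solution; there the term \<open>(f(u), u\<^sub>t)\<close> is the time derivative of the potential \<open>\<integral>F(u)\<close>, which is
  bounded below by the hypothesis on \<open>F\<close>.
\<close>

section \<open>The space of square-integrable functions\<close>

text \<open>The weak equation holds, for each fixed test function, outside a null set of times that
  depends on it, so a time-dependent function cannot simply be inserted. Integrated over [s, t] it
  holds on every interval, and the test function may be chosen after the interval; this is where
  difference quotients enter. The forcing is needed only through an upper bound on its pairing with
  a fixed function, so integrability in time is inherited from \<open>utt\<close>, and measurability
  of \<open>G\<close> along a moving history is never an issue. The nonlinearity is placed
  differently in the two applications. For a difference of solutions of known size, f(u) - f(v) is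
  Lipschitz in V and counts as forcing. For one solution no Lipschitz constant is at hand before the
  bound is known, so lam u + f(u) stays on the left as the derivative of a potential; a Lipschitz
  constant at a radius given by the data then controls its initial value. The potential is
  differentiable in time although u has a derivative only in H, because its Taylor remainder is a
  product of a V-distance and an H-distance.\<close>

lemma sq_int_measurable: "sq_int f \<Longrightarrow> f \<in> borel_measurable borel"
  by (simp add: sq_int_def)

lemma sq_int_ofL2 [simp]: "sq_int (ofL2 u)"
  using Quotient_rep_reflp[OF Quotient_L2] unfolding ofL2_def sq_eq_def by blast

lemma measurable_ofL2 [measurable]: "ofL2 u \<in> borel_measurable borel"
  by (simp add: sq_int_measurable)

lemma toL2_ofL2 [simp]: "toL2 (ofL2 u) = u"
  using Quotient_abs_rep[OF Quotient_L2] by (simp add: toL2_def) (simp add: ofL2_def)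

lemma toL2_eq_iff:
  assumes "sq_int f" "sq_int g"
  shows "toL2 f = toL2 g \<longleftrightarrow> (AE x in lborel. f x = g x)"
  using assms Quotient_rel[OF Quotient_L2, of f g] by (auto simp: toL2_def sq_eq_def)

lemma ofL2_toL2:
  assumes "sq_int f"
  shows "AE x in lborel. ofL2 (toL2 f) x = f x"
  using toL2_eq_iff[of "ofL2 (toL2 f)" f] assms by simp

lemma L2_eq_iff: "u = v \<longleftrightarrow> (AE x in lborel. ofL2 u x = ofL2 v x)"
  using toL2_eq_iff[of "ofL2 u" "ofL2 v"] by simp

lemma toL2_add: "sq_int f \<Longrightarrow> sq_int g \<Longrightarrow> toL2 f + toL2 g = toL2 (\<lambda>x. f x + g x)"
  by (simp add: toL2_def sq_int_add) (simp add: plus_L2.abs_eq sq_eq_def)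

lemma toL2_diff: "sq_int f \<Longrightarrow> sq_int g \<Longrightarrow> toL2 f - toL2 g = toL2 (\<lambda>x. f x - g x)"
  by (simp add: toL2_def sq_int_diff) (simp add: minus_L2.abs_eq sq_eq_def)

lemma toL2_scale: "sq_int f \<Longrightarrow> c *\<^sub>R toL2 f = toL2 (\<lambda>x. c * f x)"
  by (simp add: toL2_def sq_int_scale) (simp add: scaleR_L2.abs_eq sq_eq_def)

lemma toL2_zero: "toL2 (\<lambda>x. 0) = 0"
  by (simp add: toL2_def zero_L2_def)

lemma inner_toL2: "sq_int f \<Longrightarrow> sq_int g \<Longrightarrow> toL2 f \<bullet> toL2 g = (LINT x|lborel. f x * g x)"
  by (simp add: toL2_def) (simp add: inner_L2.abs_eq sq_eq_def)

lemma norm_toL2: "sq_int f \<Longrightarrow> (norm (toL2 f))\<^sup>2 = (LINT x|lborel. (f x)\<^sup>2)"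
  by (simp only: power2_norm_eq_inner inner_toL2) (simp add: power2_eq_square)

lemma norm_L2_eq: "(norm u)\<^sup>2 = (LINT x|lborel. (ofL2 u x)\<^sup>2)"
  using norm_toL2[of "ofL2 u"] by simp

lemma nn_integral_sq_int:
  "sq_int f \<Longrightarrow> (\<integral>\<^sup>+x. ennreal ((f x)\<^sup>2) \<partial>lborel) = ennreal ((norm (toL2 f))\<^sup>2)"
  by (simp add: norm_toL2 nn_integral_eq_integral sq_int_def)

lemma ofL2_add: "AE x in lborel. ofL2 (u + v) x = ofL2 u x + ofL2 v x"
  using toL2_add[of "ofL2 u" "ofL2 v"] ofL2_toL2[of "\<lambda>x. ofL2 u x + ofL2 v x"]
  by (simp add: sq_int_add)

lemma ofL2_scale: "AE x in lborel. ofL2 (c *\<^sub>R u) x = c * ofL2 u x"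
  using toL2_scale[of "ofL2 u" c] ofL2_toL2[of "\<lambda>x. c * ofL2 u x"]
  by (simp add: sq_int_scale)

lemma ofL2_zero: "AE x in lborel. ofL2 0 x = 0"
  using ofL2_toL2[of "\<lambda>x. 0"] by (simp add: toL2_zero)

lemma sq_int_cong_AE:
  assumes "sq_int f" "g \<in> borel_measurable borel" "AE x in lborel. f x = g x"
  shows "sq_int g"
proof -
  have "integrable lborel (\<lambda>x. (f x)\<^sup>2) \<longleftrightarrow> integrable lborel (\<lambda>x. (g x)\<^sup>2)"
    using assms by (intro integrable_cong_AE) (auto simp: sq_int_def)
  then show ?thesis using assms by (simp add: sq_int_def)
qed

lemma sq_int_bound:
  assumes "sq_int f" "g \<in> borel_measurable borel" "AE x in lborel. \<bar>g x\<bar> \<le> \<bar>f x\<bar>"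
  shows "sq_int g"
proof -
  have "integrable lborel (\<lambda>x. (g x)\<^sup>2)"
    by (rule Bochner_Integration.integrable_bound[of _ "\<lambda>x. (f x)\<^sup>2"])
      (use assms in \<open>auto simp: sq_int_def abs_le_square_iff\<close>)
  then show ?thesis using assms by (simp add: sq_int_def)
qed

lemma subspace_H: "subspace (H \<Omega>)"
  unfolding subspace_def
proof (intro conjI ballI allI)
  show "0 \<in> H \<Omega>"
    unfolding H_def using ofL2_zero by (auto elim: eventually_mono)
next
  fix u v :: "'a L2" assume "u \<in> H \<Omega>" "v \<in> H \<Omega>"
  then have "AE x in lborel. x \<notin> \<Omega> \<longrightarrow> ofL2 u x = 0" "AE x in lborel. x \<notin> \<Omega> \<longrightarrow> ofL2 v x = 0"
    by (auto simp: H_def)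
  with ofL2_add[of u v] have "AE x in lborel. x \<notin> \<Omega> \<longrightarrow> ofL2 (u + v) x = 0"
    by eventually_elim auto
  then show "u + v \<in> H \<Omega>" by (simp add: H_def)
next
  fix u :: "'a L2" and c assume "u \<in> H \<Omega>"
  then have "AE x in lborel. x \<notin> \<Omega> \<longrightarrow> ofL2 u x = 0"
    by (auto simp: H_def)
  with ofL2_scale[of c u] have "AE x in lborel. x \<notin> \<Omega> \<longrightarrow> ofL2 (c *\<^sub>R u) x = 0"
    by eventually_elim auto
  then show "c *\<^sub>R u \<in> H \<Omega>" by (simp add: H_def)
qed

lemma toL2_in_H:
  assumes "sq_int f" "\<And>x. x \<notin> \<Omega> \<Longrightarrow> f x = 0"
  shows "toL2 f \<in> H \<Omega>"
  using ofL2_toL2[OF assms(1)] assms(2) by (auto simp: H_def elim: eventually_mono)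

subsection \<open>Completeness\<close>

text \<open>The Riesz-Fischer argument. Geometrically small increments keep the norm of the sum of
  |f (k+1) - f k| below 2, so by monotone convergence the sum is finite almost everywhere. The
  representatives therefore converge almost everywhere, and Fatou's lemma turns the tail bound of
  the sequence into convergence in norm.\<close>

lemma L2_limit_of_rapid_Cauchy:
  fixes s :: "nat \<Rightarrow> 'a::euclidean_space L2"
  assumes rapid: "\<And>n. norm (s (Suc n) - s n) \<le> (1/2) ^ n"
  shows "\<exists>l. s \<longlonglongrightarrow> l"
proof -
  define f where "f n = ofL2 (s n)" for n
  have [measurable]: "f n \<in> borel_measurable borel" for n
    by (simp add: f_def)
  define g where "g n x = (\<Sum>k<n. \<bar>f (Suc k) x - f k x\<bar>)" for n x
  have [measurable]: "g n \<in> borel_measurable borel" for n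
    unfolding g_def by measurable
  have abs_sq: "sq_int (\<lambda>x. \<bar>f (Suc k) x - f k x\<bar>)" for k
    using sq_int_bound[OF sq_int_diff[OF sq_int_ofL2 sq_int_ofL2, of "s (Suc k)" "s k"],
        of "\<lambda>x. \<bar>f (Suc k) x - f k x\<bar>"]
    by (simp add: f_def)
  have norm_abs: "norm (toL2 (\<lambda>x. \<bar>f (Suc k) x - f k x\<bar>)) \<le> (1/2) ^ k" for k
  proof -
    have "(norm (toL2 (\<lambda>x. \<bar>f (Suc k) x - f k x\<bar>)))\<^sup>2 = (norm (s (Suc k) - s k))\<^sup>2"
      using norm_toL2[OF abs_sq] norm_toL2[OF sq_int_diff[OF sq_int_ofL2 sq_int_ofL2, of "s (Suc k)" "s k"]]
      by (simp add: f_def toL2_diff[symmetric])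
    then show ?thesis using rapid[of k] by simp
  qed
  have g_sq: "sq_int (g n) \<and> norm (toL2 (g n)) \<le> 2" for n
  proof -
    have "sq_int (g n) \<and> norm (toL2 (g n)) \<le> (\<Sum>k<n. (1/2) ^ k)"
    proof (induction n)
      case 0
      then show ?case by (simp add: g_def toL2_zero)
    next
      case (Suc n)
      have eq: "g (Suc n) = (\<lambda>x. g n x + \<bar>f (Suc n) x - f n x\<bar>)"
        by (simp add: g_def fun_eq_iff)
      show ?case
        using Suc norm_abs[of n] norm_triangle_ineq[of "toL2 (g n)"
              "toL2 (\<lambda>x. \<bar>f (Suc n) x - f n x\<bar>)"] sq_int_add[of "g n", OF _ abs_sq[of n]]
        by (simp add: eq toL2_add[of "g n", OF _ abs_sq])
    qed
    moreover have "(\<Sum>k<n. (1/2::real) ^ k) = 2 - 2 * (1/2) ^ n"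
      by (subst geometric_sum) auto
    then have "(\<Sum>k<n. (1/2::real) ^ k) \<le> 2"
      by (simp del: power_one_over)
    ultimately show ?thesis by linarith
  qed
  \<comment> \<open>\<open>G\<close> takes extended values, so monotone convergence applies before
    finiteness is known; its integral is at most 4, the square of the norm bound 2.\<close>
  define G where "G x = (SUP n. ennreal ((g n x)\<^sup>2))" for x
  have g_mono: "g n x \<le> g m x" if "n \<le> m" for n m x
    unfolding g_def using that by (intro sum_mono2) auto
  have g_nonneg: "0 \<le> g n x" for n x by (simp add: g_def sum_nonneg)
  have "(\<integral>\<^sup>+x. G x \<partial>lborel) = (SUP n. \<integral>\<^sup>+x. ennreal ((g n x)\<^sup>2) \<partial>lborel)"
    unfolding G_def
    by (rule nn_integral_monotone_convergence_SUP)
      (auto simp: incseq_def le_fun_def intro!: ennreal_leI power_mono g_mono g_nonneg)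
  also have "\<dots> \<le> ennreal 4"
  proof (rule SUP_least)
    fix n
    have "(norm (toL2 (g n)))\<^sup>2 \<le> 2\<^sup>2"
      using g_sq[of n] by (intro power_mono) auto
    then have "ennreal ((norm (toL2 (g n)))\<^sup>2) \<le> ennreal 4"
      by (intro ennreal_leI) simp
    then show "(\<integral>\<^sup>+x. ennreal ((g n x)\<^sup>2) \<partial>lborel) \<le> ennreal 4"
      using g_sq[of n] by (simp add: nn_integral_sq_int)
  qed
  finally have G_int: "(\<integral>\<^sup>+x. G x \<partial>lborel) \<le> ennreal 4" .
  have [measurable]: "G \<in> borel_measurable borel"
    unfolding G_def by measurable
  have "AE x in lborel. G x \<noteq> \<infinity>"
    by (rule nn_integral_PInf_AE) (use G_int in \<open>auto simp: top_unique\<close>)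
  then have conv: "AE x in lborel. convergent (\<lambda>n. f n x)"
  proof eventually_elim
    case (elim x)
    then obtain c where c: "G x = ennreal c" "0 \<le> c" by (cases "G x") auto
    have bnd: "g n x \<le> sqrt c" for n
    proof -
      have "ennreal ((g n x)\<^sup>2) \<le> ennreal c"
        unfolding c(1)[symmetric] G_def by (rule SUP_upper) simp
      then have "(g n x)\<^sup>2 \<le> c" using c(2) by (simp add: ennreal_le_iff)
      then show ?thesis by (simp add: real_le_rsqrt)
    qed
    have "summable (\<lambda>k. \<bar>f (Suc k) x - f k x\<bar>)"
      by (rule summableI_nonneg_bounded[of _ "sqrt c"]) (use bnd in \<open>auto simp: g_def\<close>)
    then have "summable (\<lambda>k. f (Suc k) x - f k x)"
      by (rule summable_rabs_cancel)
    then have "convergent (\<lambda>n. \<Sum>k<n. (f (Suc k) x - f k x))"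
      by (simp add: summable_iff_convergent)
    then have "convergent (\<lambda>n. f n x - f 0 x)"
      by (simp add: sum_lessThan_telescope[of "\<lambda>k. f k x"])
    then have "convergent (\<lambda>n. (f n x - f 0 x) + f 0 x)"
      by (intro convergent_add convergent_const)
    then show ?case by simp
  qed
  define l where "l x = lim (\<lambda>n. f n x)" for x
  have [measurable]: "l \<in> borel_measurable borel"
    unfolding l_def by (rule borel_measurable_lim_metric) simp
  have fl: "AE x in lborel. (\<lambda>n. f n x) \<longlonglongrightarrow> l x"
    using conv by eventually_elim (simp add: l_def convergent_LIMSEQ_iff)
  have tail: "norm (s m - s n) \<le> 2 * (1/2) ^ n" if "n \<le> m" for n m
  proof -
    have "norm (s m - s n) \<le> 2 * ((1/2) ^ n - (1/2) ^ m)"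
      using that
    proof (induction m rule: dec_induct)
      case (step m)
      have "norm (s (Suc m) - s n) \<le> norm (s (Suc m) - s m) + norm (s m - s n)"
        using norm_triangle_ineq[of "s (Suc m) - s m" "s m - s n"] by simp
      then show ?case using step rapid[of m] by simp
    qed simp
    also have "\<dots> \<le> 2 * (1/2) ^ n" by simp
    finally show ?thesis .
  qed
  have diff_int: "(\<integral>\<^sup>+x. ennreal ((l x - f n x)\<^sup>2) \<partial>lborel) \<le> ennreal ((2 * (1/2) ^ n)\<^sup>2)" for n
  proof -
    have "(\<integral>\<^sup>+x. ennreal ((l x - f n x)\<^sup>2) \<partial>lborel)
        = (\<integral>\<^sup>+x. liminf (\<lambda>m. ennreal ((f m x - f n x)\<^sup>2)) \<partial>lborel)"
    proof (rule nn_integral_cong_AE)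
      show "AE x in lborel. ennreal ((l x - f n x)\<^sup>2) = liminf (\<lambda>m. ennreal ((f m x - f n x)\<^sup>2))"
        using fl
      proof eventually_elim
        case (elim x)
        have "(\<lambda>m. ennreal ((f m x - f n x)\<^sup>2)) \<longlonglongrightarrow> ennreal ((l x - f n x)\<^sup>2)"
          using elim by (intro tendsto_intros)
        then show ?case using lim_imp_Liminf[of sequentially] by (metis sequentially_bot)
      qed
    qed
    also have "\<dots> \<le> liminf (\<lambda>m. \<integral>\<^sup>+x. ennreal ((f m x - f n x)\<^sup>2) \<partial>lborel)"
      by (rule nn_integral_liminf) simp
    also have "\<dots> \<le> ennreal ((2 * (1/2) ^ n)\<^sup>2)"
    proof (rule Liminf_le[OF sequentially_bot], rule eventually_sequentiallyI[of n])
      fix m assume "n \<le> m"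
      have "(\<integral>\<^sup>+x. ennreal ((f m x - f n x)\<^sup>2) \<partial>lborel) = ennreal ((norm (s m - s n))\<^sup>2)"
        using nn_integral_sq_int[OF sq_int_diff[OF sq_int_ofL2 sq_int_ofL2, of "s m" "s n"]]
        by (simp add: f_def toL2_diff[symmetric])
      also have "\<dots> \<le> ennreal ((2 * (1/2) ^ n)\<^sup>2)"
        using tail[OF \<open>n \<le> m\<close>] by (intro ennreal_leI power_mono) auto
      finally show "(\<integral>\<^sup>+x. ennreal ((f m x - f n x)\<^sup>2) \<partial>lborel) \<le> ennreal ((2 * (1/2) ^ n)\<^sup>2)" .
    qed
    finally show ?thesis .
  qed
  have lf_sq: "sq_int (\<lambda>x. l x - f n x)" for n
    unfolding sq_int_def using diff_int[of n]
    by (auto intro!: integrableI_nonneg simp: less_top[symmetric] top_unique)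
  have l_sq: "sq_int l"
    using sq_int_add[OF lf_sq[of 0] sq_int_ofL2[of "s 0"]] by (simp add: f_def)
  have "norm (s n - toL2 l) \<le> 2 * (1/2) ^ n" for n
  proof -
    have "toL2 (\<lambda>x. l x - f n x) = toL2 l - s n"
      using toL2_diff[OF l_sq sq_int_ofL2[of "s n"]] by (simp add: f_def)
    then have "ennreal ((norm (toL2 l - s n))\<^sup>2) \<le> ennreal ((2 * (1/2) ^ n)\<^sup>2)"
      using diff_int[of n] nn_integral_sq_int[OF lf_sq[of n]] by simp
    then have "(norm (toL2 l - s n))\<^sup>2 \<le> (2 * (1/2) ^ n)\<^sup>2"
      by (simp add: ennreal_le_iff)
    then show ?thesis
      by (subst norm_minus_commute) (rule power2_le_imp_le, auto)
  qed
  moreover have "(\<lambda>n. 2 * (1/2) ^ n :: real) \<longlonglongrightarrow> 0"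
    by (rule tendsto_mult_right_zero) (simp add: LIMSEQ_power_zero)
  ultimately have "(\<lambda>n. s n - toL2 l) \<longlonglongrightarrow> 0"
    using Lim_null_comparison[of "\<lambda>n. s n - toL2 l" "\<lambda>n. 2 * (1/2) ^ n"] by auto
  then show ?thesis using LIM_zero_iff by blast
qed

text \<open>Completeness opens the fundamental theorem of calculus and the integrals of
  \<open>L2\<close>-valued functions, which are stated for Banach spaces. A subsequence with
  geometric increments converges and carries the Cauchy sequence with it.\<close>

instance L2 :: (euclidean_space) banach
proof
  fix X :: "nat \<Rightarrow> 'a L2"
  assume X: "Cauchy X"
  have "\<exists>N. \<forall>m\<ge>N. \<forall>n\<ge>N. norm (X m - X n) < (1/2) ^ k" for k
    using X by (simp add: Cauchy_iff)
  then obtain N where N: "\<And>k m n. m \<ge> N k \<Longrightarrow> n \<ge> N k \<Longrightarrow> norm (X m - X n) < (1/2) ^ k"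
    by metis
  \<comment> \<open>The partial sums of \<open>N\<close> dominate every \<open>N k\<close>; the
    summand \<open>k\<close> makes the indices strictly increasing.\<close>
  define M where "M k = (\<Sum>j\<le>k. N j) + k" for k
  have M_ge: "N k \<le> M k" for k
    using member_le_sum[of k "{..k}" N] by (simp add: M_def)
  have M_mono: "strict_mono M"
    by (rule strict_monoI_Suc) (simp add: M_def)
  have "norm (X (M (Suc k)) - X (M k)) \<le> (1/2) ^ k" for k
  proof -
    have "M k \<le> M (Suc k)" using M_mono by (simp add: strict_mono_less_eq)
    then show ?thesis using N[of k "M (Suc k)" "M k"] M_ge[of k] by force
  qed
  then obtain l where "(X \<circ> M) \<longlonglongrightarrow> l"
    using L2_limit_of_rapid_Cauchy[of "X \<circ> M"] by auto
  then show "convergent X"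
    using X M_mono Cauchy_converges_subseq[of X M] unfolding convergent_def by blast
qed

section \<open>Test functions\<close>

lemma pd_add:
  assumes "f differentiable (at x)" "g differentiable (at x)"
  shows "pd i (\<lambda>x. f x + g x) x = pd i f x + pd i g x"
  using frechet_derivative_at[OF has_derivative_add[OF assms[THEN frechet_derivative_works[THEN iffD1]]]]
  by (simp add: pd_def fun_eq_iff)

lemma pd_mult:
  assumes "f differentiable (at x)" "g differentiable (at x)"
  shows "pd i (\<lambda>x. f x * g x) x = f x * pd i g x + pd i f x * g x"
  using frechet_derivative_at[OF has_derivative_mult[OF assms[THEN frechet_derivative_works[THEN iffD1]]]]
  by (simp add: pd_def fun_eq_iff)

lemma pd_const [simp]: "pd i (\<lambda>x. c) = (\<lambda>x. 0)"
  using frechet_derivative_at[OF has_derivative_const[of c "at x"]] by (simp add: pd_def fun_eq_iff)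

lemma Ck_on_const: "Ck_on k UNIV (\<lambda>x. c)"
  by (induction k arbitrary: c) simp_all

lemma Ck_on_SucD: "Ck_on (Suc k) UNIV f \<Longrightarrow> Ck_on k UNIV f"
proof (induction k arbitrary: f)
  case 0
  then show ?case
    by (auto intro!: continuous_at_imp_continuous_on differentiable_imp_continuous_within)
qed auto

lemma Ck_on_add: "Ck_on k UNIV f \<Longrightarrow> Ck_on k UNIV g \<Longrightarrow> Ck_on k UNIV (\<lambda>x. f x + g x)"
proof (induction k arbitrary: f g)
  case (Suc k)
  then have "pd i (\<lambda>x. f x + g x) = (\<lambda>x. pd i f x + pd i g x)" for i
    by (auto simp: fun_eq_iff intro: pd_add)
  with Suc show ?case by auto
qed (auto intro: continuous_intros)

text \<open>The product rule returns \<open>f\<close> and \<open>g\<close> themselves beside their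
  derivatives, so the induction also uses that both are regular of one order less.\<close>

lemma Ck_on_mult: "Ck_on k UNIV f \<Longrightarrow> Ck_on k UNIV g \<Longrightarrow> Ck_on k UNIV (\<lambda>x. f x * g x)"
proof (induction k arbitrary: f g)
  case (Suc k)
  have "pd i (\<lambda>x. f x * g x) = (\<lambda>x. f x * pd i g x + pd i f x * g x)" for i
    using Suc.prems by (auto simp: fun_eq_iff intro: pd_mult)
  moreover have "Ck_on k UNIV f" "Ck_on k UNIV g"
    using Suc.prems by (auto intro: Ck_on_SucD simp del: Ck_on.simps)
  ultimately show ?case using Suc by (auto intro!: Ck_on_add)
qed (auto intro: continuous_intros)

lemma Ck_on_prod:
  "finite A \<Longrightarrow> (\<And>j. j \<in> A \<Longrightarrow> Ck_on k UNIV (f j)) \<Longrightarrow> Ck_on k UNIV (\<lambda>x. \<Prod>j\<in>A. f j x)"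
  by (induction A rule: finite_induct) (auto intro: Ck_on_mult Ck_on_const)

lemma smooth_on_add: "smooth_on UNIV f \<Longrightarrow> smooth_on UNIV g \<Longrightarrow> smooth_on UNIV (\<lambda>x. f x + g x)"
  by (simp add: smooth_on_def Ck_on_add)

lemma smooth_on_mult: "smooth_on UNIV f \<Longrightarrow> smooth_on UNIV g \<Longrightarrow> smooth_on UNIV (\<lambda>x. f x * g x)"
  by (simp add: smooth_on_def Ck_on_mult)

lemma smooth_on_const: "smooth_on UNIV (\<lambda>x. c)"
  by (simp add: smooth_on_def Ck_on_const)

lemma smooth_on_pd: "smooth_on UNIV f \<Longrightarrow> i \<in> Basis \<Longrightarrow> smooth_on UNIV (pd i f)"
  unfolding smooth_on_def by (metis Ck_on.simps(2))

lemma smooth_on_differentiable: "smooth_on UNIV f \<Longrightarrow> f differentiable (at x)"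
  unfolding smooth_on_def by (metis Ck_on.simps(2) UNIV_I)

lemma smooth_on_continuous: "smooth_on UNIV f \<Longrightarrow> continuous_on UNIV f"
  unfolding smooth_on_def by (metis Ck_on.simps(1))

text \<open>A partial derivative of such a composite has the same form, with the next member of the
  chain \<open>D\<close> and a constant factor. Carrying the whole chain of derivatives, with
  \<open>n\<close> arbitrary, closes the induction.\<close>

lemma Ck_on_affine:
  fixes d :: "'a::euclidean_space"
  assumes "\<And>n y. (D n has_real_derivative D (Suc n) y) (at y)"
  shows "Ck_on k UNIV (\<lambda>x. D n (x \<bullet> d + c))"
proof (induction k arbitrary: n)
  case 0
  have "continuous_on UNIV (D n)"
    using assms by (meson DERIV_continuous_on has_field_derivative_at_within)
  then show ?case
    by (auto intro!: continuous_on_compose2[of UNIV "D n"] continuous_intros)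
next
  case (Suc k)
  have der: "((\<lambda>x. D n (x \<bullet> d + c)) has_derivative (\<lambda>h. D (Suc n) (x \<bullet> d + c) * (h \<bullet> d))) (at x)" for x
  proof -
    have 1: "((\<lambda>x. x \<bullet> d + c) has_derivative (\<lambda>h. h \<bullet> d)) (at x)"
      by (auto intro!: derivative_eq_intros)
    have 2: "(D n has_derivative (*) (D (Suc n) (x \<bullet> d + c))) (at (x \<bullet> d + c))"
      using assms by (simp add: has_field_derivative_def)
    show ?thesis using has_derivative_compose[OF 1 2] by simp
  qed
  have "pd i (\<lambda>x. D n (x \<bullet> d + c)) = (\<lambda>x. D (Suc n) (x \<bullet> d + c) * (i \<bullet> d))" for i
    using frechet_derivative_at[OF der] by (simp add: pd_def fun_eq_iff)
  then show ?case
    using Suc[of "Suc n"] der by (auto simp: differentiable_def intro!: Ck_on_mult Ck_on_const)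
qed

subsection \<open>Smooth approximations of the indicator of a box\<close>

text \<open>A family that contains the flat function exp(-c/y) (for \<open>p = 1\<close>) and is
  closed under differentiation, at 0 as well; it makes all derivatives of a smooth cutoff
  explicit.\<close>

definition flat_exp :: "real \<Rightarrow> real poly \<Rightarrow> real \<Rightarrow> real" where
  "flat_exp c p y = (if y > 0 then poly p (1 / y) * exp (- c / y) else 0)"

text \<open>With z = 1/y, the derivative of p(z) exp(-c z) in y is z^2 (c p(z) - p'(z)) exp(-c
  z).\<close>

definition flat_step :: "real \<Rightarrow> real poly \<Rightarrow> real poly" where
  "flat_step c p = [:0, 0, 1:] * (smult c p - pderiv p)"

lemma poly_times_exp_tendsto_0:
  fixes p :: "real poly"
  assumes "c > 0"
  shows "((\<lambda>z. poly p z * exp (- c * z)) \<longlongrightarrow> 0) at_top"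
proof -
  have "((\<lambda>z. z ^ i * exp (- c * z)) \<longlongrightarrow> 0) at_top" for i :: nat
    using assms by real_asymp
  then have "((\<lambda>z. \<Sum>i\<le>degree p. coeff p i * (z ^ i * exp (- c * z))) \<longlongrightarrow> (\<Sum>i\<le>degree p. coeff p i * 0)) at_top"
    by (intro tendsto_intros)
  then show ?thesis
    by (simp add: poly_altdef sum_distrib_right mult.assoc)
qed

lemma has_real_derivative_flat_exp:
  assumes c: "c > 0"
  shows "(flat_exp c p has_real_derivative flat_exp c (flat_step c p) y) (at y)"
proof -
  consider "y > 0" | "y < 0" | "y = 0" by linarith
  then show ?thesis
  proof cases
    case 1
    have "((\<lambda>y. poly p (1 / y) * exp (- c / y)) has_real_derivative flat_exp c (flat_step c p) y) (at y)"
      using 1 by (auto intro!: derivative_eq_intros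
          simp: flat_exp_def flat_step_def field_simps power2_eq_square)
    then show ?thesis
      by (rule has_field_derivative_transform_within_open[of _ _ _ "{0<..}"])
        (use 1 in \<open>auto simp: flat_exp_def\<close>)
  next
    case 2
    have "((\<lambda>y. 0) has_real_derivative flat_exp c (flat_step c p) y) (at y)"
      using 2 by (auto simp: flat_exp_def)
    then show ?thesis
      by (rule has_field_derivative_transform_within_open[of _ _ _ "{..<0}"])
        (use 2 in \<open>auto simp: flat_exp_def\<close>)
  next
    case 3
    \<comment> \<open>With z = 1/h the quotient is z p(z) exp(-c z), and the exponential wins over
      any polynomial as z grows; from the left the quotient is 0.\<close>
    have "((\<lambda>h. flat_exp c p h / h) \<longlongrightarrow> 0) (at_right 0)"
    proof -
      have "((\<lambda>h. poly (p * [:0, 1:]) (inverse h) * exp (- c * inverse h)) \<longlongrightarrow> 0) (at_right 0)"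
        by (rule filterlim_compose[OF poly_times_exp_tendsto_0[OF c] filterlim_inverse_at_top_right])
      then show ?thesis
        by (rule Lim_transform_eventually)
          (auto simp: flat_exp_def eventually_at_right_field field_simps intro!: exI[of _ 1])
    qed
    moreover have "((\<lambda>h. flat_exp c p h / h) \<longlongrightarrow> 0) (at_left 0)"
      by (rule Lim_transform_eventually[OF tendsto_const])
        (auto simp: flat_exp_def eventually_at_left_field intro!: exI[of _ "-1"])
    ultimately have "((\<lambda>h. flat_exp c p h / h) \<longlongrightarrow> 0) (at 0)"
      using filterlim_at_split by blast
    then show ?thesis
      using 3 by (simp add: DERIV_def flat_exp_def)
  qed
qed

text \<open>As \<open>c\<close> decreases to 0 these functions increase on the positive axis to 1
  and stay 0 elsewhere, so they approximate the indicator of the positive axis from below.\<close>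

definition smooth_step :: "real \<Rightarrow> real \<Rightarrow> real" where
  "smooth_step c = flat_exp c 1"

lemma smooth_step_eq: "smooth_step c y = (if y > 0 then exp (- c / y) else 0)"
  by (simp add: smooth_step_def flat_exp_def)

lemma smooth_step_bounds: "c > 0 \<Longrightarrow> 0 \<le> smooth_step c y \<and> smooth_step c y \<le> 1"
  by (simp add: smooth_step_eq)

lemma smooth_on_smooth_step_affine:
  fixes d :: "'a::euclidean_space"
  assumes "c > 0"
  shows "smooth_on UNIV (\<lambda>x. smooth_step c (x \<bullet> d + e))"
  unfolding smooth_on_def smooth_step_def
  using Ck_on_affine[of "\<lambda>n. flat_exp c ((flat_step c ^^ n) 1)" _ 0 d e]
    has_real_derivative_flat_exp[OF assms] by simp

lemma smooth_step_tendsto: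
  "(\<lambda>n. smooth_step (inverse (real (Suc n))) y) \<longlonglongrightarrow> indicator {0<..} y"
proof (cases "y > 0")
  case True
  have "(\<lambda>n. exp (- inverse (real (Suc n)) / y)) \<longlonglongrightarrow> exp (- 0 / y)"
    by (intro tendsto_intros LIMSEQ_inverse_real_of_nat) (use True in auto)
  with True show ?thesis by (simp add: smooth_step_eq)
qed (simp add: smooth_step_eq)

text \<open>One factor per face of the box. The upper face is written with direction
  \<open>- i\<close> so that both factors are a step composed with an affine functional, as
  \<open>smooth_on_smooth_step_affine\<close> expects.\<close>

definition box_bump :: "'a::euclidean_space \<Rightarrow> 'a \<Rightarrow> nat \<Rightarrow> 'a \<Rightarrow> real" where
  "box_bump a b n x = (\<Prod>i\<in>Basis. smooth_step (inverse (real (Suc n))) (x \<bullet> i + - (a \<bullet> i)) *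
     smooth_step (inverse (real (Suc n))) (x \<bullet> (- i) + b \<bullet> i))"

lemma smooth_on_box_bump: "smooth_on UNIV (box_bump a b n)"
proof -
  have "Ck_on k UNIV (\<lambda>x. smooth_step (inverse (real (Suc n))) (x \<bullet> d + e))" for k and d :: 'a and e
    using smooth_on_smooth_step_affine[of "inverse (real (Suc n))" d e] by (simp add: smooth_on_def)
  then show ?thesis
    unfolding box_bump_def smooth_on_def by (intro allI Ck_on_prod Ck_on_mult finite_Basis)
qed

lemma box_bump_bounds: "0 \<le> box_bump a b n x \<and> box_bump a b n x \<le> 1"
  unfolding box_bump_def
  by (auto intro!: prod_nonneg prod_le_1 mult_nonneg_nonneg mult_le_one
      simp: smooth_step_bounds[THEN conjunct1] smooth_step_bounds[THEN conjunct2])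

lemma box_bump_outside: "x \<notin> box a b \<Longrightarrow> box_bump a b n x = 0"
  unfolding box_bump_def by (force simp: mem_box smooth_step_eq intro: prod_zero)

lemma box_bump_tendsto: "(\<lambda>n. box_bump a b n x) \<longlonglongrightarrow> indicator (box a b) x"
proof -
  have "(\<lambda>n. box_bump a b n x) \<longlonglongrightarrow>
      (\<Prod>i\<in>Basis. indicator {0<..} (x \<bullet> i + - (a \<bullet> i)) * indicator {0<..} (x \<bullet> (- i) + b \<bullet> i))"
    unfolding box_bump_def by (intro tendsto_intros smooth_step_tendsto)
  also have "(\<Prod>i\<in>Basis. indicator {0<..} (x \<bullet> i + - (a \<bullet> i)) * indicator {0<..} (x \<bullet> (- i) + b \<bullet> i))
      = (indicator (box a b) x :: real)"
  proof (cases "x \<in> box a b")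
    case True
    then show ?thesis by (simp add: mem_box)
  next
    case False
    then show ?thesis by (force simp: mem_box intro: prod_zero)
  qed
  finally show ?thesis .
qed

section \<open>Algebra and integrability of test functions\<close>

lemma test_functionI:
  assumes "smooth_on UNIV \<psi>" "compact K" "K \<subseteq> \<Omega>" "\<And>x. x \<notin> K \<Longrightarrow> \<psi> x = 0"
  shows "\<psi> \<in> test_functions \<Omega>"
proof -
  have "closure {x. \<psi> x \<noteq> 0} \<subseteq> K"
    using assms(2,4) by (intro closure_minimal) (auto simp: compact_imp_closed)
  moreover from this have "compact (closure {x. \<psi> x \<noteq> 0})"
    by (meson assms(2) closed_closure compact_Int_closed inf.absorb_iff2 compact_closure bounded_subset compact_imp_bounded closure_subset subset_trans)
  ultimately show ?thesis using assms by (auto simp: test_functions_def)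
qed

lemma test_functionE:
  assumes "\<psi> \<in> test_functions \<Omega>"
  obtains K where "smooth_on UNIV \<psi>" "compact K" "K \<subseteq> \<Omega>" "\<And>x. x \<notin> K \<Longrightarrow> \<psi> x = 0"
  using assms closure_subset[of "{x. \<psi> x \<noteq> 0}"] unfolding test_functions_def by blast

lemma test_function_smooth: "\<psi> \<in> test_functions \<Omega> \<Longrightarrow> smooth_on UNIV \<psi>"
  by (simp add: test_functions_def)

lemma test_function_outside: "\<psi> \<in> test_functions \<Omega> \<Longrightarrow> x \<notin> \<Omega> \<Longrightarrow> \<psi> x = 0"
  by (erule test_functionE) auto

lemma test_function_add:
  assumes "\<psi> \<in> test_functions \<Omega>" "\<eta> \<in> test_functions \<Omega>"
  shows "(\<lambda>x. \<psi> x + \<eta> x) \<in> test_functions \<Omega>"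
proof -
  obtain K L where "compact K" "K \<subseteq> \<Omega>" "\<And>x. x \<notin> K \<Longrightarrow> \<psi> x = 0"
    "compact L" "L \<subseteq> \<Omega>" "\<And>x. x \<notin> L \<Longrightarrow> \<eta> x = 0"
    using assms by (auto elim!: test_functionE)
  then show ?thesis
    using assms by (intro test_functionI[of _ "K \<union> L"])
      (auto intro: smooth_on_add test_function_smooth)
qed

lemma test_function_mult:
  assumes "smooth_on UNIV \<eta>" "\<psi> \<in> test_functions \<Omega>"
  shows "(\<lambda>x. \<eta> x * \<psi> x) \<in> test_functions \<Omega>"
proof -
  obtain K where "compact K" "K \<subseteq> \<Omega>" "\<And>x. x \<notin> K \<Longrightarrow> \<psi> x = 0"
    using assms by (auto elim!: test_functionE)
  then show ?thesis
    using assms by (intro test_functionI[of _ K]) (auto intro: smooth_on_mult test_function_smooth)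
qed

lemma pd_outside:
  assumes "closed K" "\<And>x. x \<notin> K \<Longrightarrow> \<psi> x = 0" "x \<notin> K"
  shows "pd i \<psi> x = 0"
proof -
  have "((\<lambda>x. 0) has_derivative (\<lambda>h. 0)) (at x)" by simp
  then have "(\<psi> has_derivative (\<lambda>h. 0)) (at x)"
    by (rule has_derivative_transform_within_open[of _ _ _ _ "- K"]) (use assms in auto)
  then show ?thesis
    using frechet_derivative_at by (metis pd_def)
qed

lemma test_function_pd:
  assumes "\<psi> \<in> test_functions \<Omega>" "i \<in> Basis"
  shows "pd i \<psi> \<in> test_functions \<Omega>"
proof -
  obtain K where "compact K" "K \<subseteq> \<Omega>" "\<And>x. x \<notin> K \<Longrightarrow> \<psi> x = 0"
    using assms by (auto elim!: test_functionE)
  then show ?thesis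
    using assms by (intro test_functionI[of _ K])
      (auto intro: smooth_on_pd test_function_smooth pd_outside compact_imp_closed)
qed

lemma box_bump_test_function: "cbox a b \<subseteq> \<Omega> \<Longrightarrow> box_bump a b n \<in> test_functions \<Omega>"
  by (rule test_functionI[of _ "cbox a b"])
    (use box_subset_cbox in \<open>auto simp: smooth_on_box_bump intro!: box_bump_outside\<close>)

lemma test_function_integrable:
  assumes "\<psi> \<in> test_functions \<Omega>"
  shows "integrable lborel \<psi>"
proof -
  obtain K where K: "smooth_on UNIV \<psi>" "compact K" "\<And>x. x \<notin> K \<Longrightarrow> \<psi> x = 0"
    using assms by (auto elim!: test_functionE)
  have "set_integrable lborel K \<psi>"
    unfolding set_integrable_def
    using borel_integrable_compact[OF K(2), of \<psi>] smooth_on_continuous[OF K(1)]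
    by (simp add: continuous_on_subset indicator_scaleR_eq_if)
  moreover have "(\<lambda>x. indicator K x *\<^sub>R \<psi> x) = \<psi>"
    using K(3) by (auto simp: fun_eq_iff indicator_def)
  ultimately show ?thesis by (simp add: set_integrable_def)
qed

lemma test_function_bounded:
  assumes "\<psi> \<in> test_functions \<Omega>"
  obtains B where "\<And>x. \<bar>\<psi> x\<bar> \<le> B"
proof -
  obtain K where K: "smooth_on UNIV \<psi>" "compact K" "\<And>x. x \<notin> K \<Longrightarrow> \<psi> x = 0"
    using assms by (auto elim!: test_functionE)
  have "bounded (\<psi> ` K)"
    using K smooth_on_continuous by (blast intro: compact_imp_bounded compact_continuous_image continuous_on_subset)
  then obtain B where "\<And>x. x \<in> K \<Longrightarrow> norm (\<psi> x) \<le> B" by (auto simp: bounded_iff)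
  then have "\<bar>\<psi> x\<bar> \<le> max B 0" for x using K(3)[of x] by (cases "x \<in> K") force+
  then show ?thesis by (rule that)
qed

lemma sq_int_test_function [simp]:
  assumes "\<psi> \<in> test_functions \<Omega>"
  shows "sq_int \<psi>"
proof -
  have "integrable lborel (\<lambda>x. \<psi> x * \<psi> x)"
    using test_function_integrable[OF test_function_mult[OF test_function_smooth[OF assms] assms]] .
  then show ?thesis
    using test_function_integrable[OF assms] by (simp add: sq_int_def power2_eq_square)
qed

lemma sq_int_indicator_cbox: "sq_int (indicator (cbox a b))"
proof -
  have "(indicator (cbox a b) x :: real)\<^sup>2 = indicator (cbox a b) x" for x
    by (simp add: indicator_def)
  then show ?thesis
    using emeasure_bounded_finite[OF bounded_cbox, of a b]
    by (simp add: sq_int_def integrable_indicator_iff)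
qed

subsection \<open>Density\<close>

text \<open>The positive and the negative part of \<open>f\<close> are densities of two finite
  measures. These agree on boxes, an intersection-stable generator of the Borel sets, hence
  everywhere, and so their densities agree almost everywhere.\<close>

lemma AE_zero_if_box_integrals_zero:
  fixes f :: "'a::euclidean_space \<Rightarrow> real"
  assumes f: "integrable lborel f"
    and zero: "\<And>a b. (LINT x|lborel. f x * indicator (box a b) x) = 0"
  shows "AE x in lborel. f x = 0"
proof -
  have [measurable]: "f \<in> borel_measurable borel" using f by auto
  define p where "p x = ennreal (f x)" for x
  define q where "q x = ennreal (- f x)" for x
  have [measurable]: "p \<in> borel_measurable borel" "q \<in> borel_measurable borel"
    unfolding p_def q_def by measurable
  have fin: "(\<integral>\<^sup>+x. p x \<partial>lborel) \<noteq> \<infinity>" "(\<integral>\<^sup>+x. q x \<partial>lborel) \<noteq> \<infinity>"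
    using f unfolding real_integrable_def p_def q_def by auto
  have "density lborel p = density lborel q"
  proof (rule measure_eqI_generator_eq)
    let ?E = "range (\<lambda>(a, b). box a b::'a set)"
    let ?A = "\<lambda>n::nat. box (- (real n *\<^sub>R One)) (real n *\<^sub>R One) :: 'a set"
    show "Int_stable ?E" by (auto simp: Int_stable_def box_Int_box)
    show "?E \<subseteq> Pow UNIV" "sets (density lborel p) = sigma_sets UNIV ?E"
      "sets (density lborel q) = sigma_sets UNIV ?E"
      by (simp_all add: borel_eq_box)
    show "range ?A \<subseteq> ?E" "(\<Union>i. ?A i) = UNIV"
      unfolding UN_box_eq_UNIV by auto
    show "emeasure (density lborel p) (?A i) \<noteq> \<infinity>" for i
    proof -
      have "emeasure (density lborel p) (?A i) \<le> emeasure (density lborel p) (space (density lborel p))"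
        by (rule emeasure_space)
      also have "\<dots> = (\<integral>\<^sup>+x. p x \<partial>lborel)" by (simp add: emeasure_density)
      finally show ?thesis using fin by (auto simp: top_unique)
    qed
    fix X assume "X \<in> ?E"
    then obtain a b where X: "X = box a b" by auto
    have int: "integrable lborel (\<lambda>x. f x * indicator X x)"
      using integrable_real_mult_indicator[OF _ f, of X] X by simp
    have pe: "p x * indicator X x = ennreal (f x * indicator X x)"
      "q x * indicator X x = ennreal (- (f x * indicator X x))" for x
      by (simp_all add: p_def q_def indicator_def)
    have fin': "(\<integral>\<^sup>+x. p x * indicator X x \<partial>lborel) \<noteq> \<infinity>" "(\<integral>\<^sup>+x. q x * indicator X x \<partial>lborel) \<noteq> \<infinity>"
      using int unfolding real_integrable_def pe by auto
    have "enn2real (\<integral>\<^sup>+x. p x * indicator X x \<partial>lborel) - enn2real (\<integral>\<^sup>+x. q x * indicator X x \<partial>lborel) = 0"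
      using zero[of a b] real_lebesgue_integral_def[OF int] X pe by simp
    then have "(\<integral>\<^sup>+x. p x * indicator X x \<partial>lborel) = (\<integral>\<^sup>+x. q x * indicator X x \<partial>lborel)"
      using fin' by (metis eq_iff_diff_eq_0 ennreal_enn2real infinity_ennreal_def less_top)
    then show "emeasure (density lborel p) X = emeasure (density lborel q) X"
      using X by (simp add: emeasure_density)
  qed
  then have "AE x in lborel. p x = q x"
    using fin by (subst (asm) finite_density_unique) auto
  then show ?thesis
  proof eventually_elim
    case (elim x)
    then show ?case unfolding p_def q_def
      by (metis ennreal_eq_0_iff ennreal_inj linorder_linear neg_0_le_iff_le neg_le_0_iff_le order_antisym)
  qed
qed

text \<open>Countably many boxes with closure in the open set cover it (Lindelof), so the
  exceptional null sets can be united.\<close>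

lemma AE_zero_on_open:
  fixes \<Omega> :: "'a::euclidean_space set"
  assumes "open \<Omega>" and z: "\<And>a b. cbox a b \<subseteq> \<Omega> \<Longrightarrow> AE x in lborel. x \<in> box a b \<longrightarrow> P x"
  shows "AE x in lborel. x \<in> \<Omega> \<longrightarrow> P x"
proof -
  define \<F> where "\<F> = {box a b | a b. cbox a b \<subseteq> \<Omega>}"
  obtain \<F>' where F': "\<F>' \<subseteq> \<F>" "countable \<F>'" "\<Union>\<F>' = \<Union>\<F>"
    by (rule Lindelof[of \<F>]) (auto simp: \<F>_def)
  have "\<Union>\<F> = \<Omega>"
  proof
    show "\<Union>\<F> \<subseteq> \<Omega>" using box_subset_cbox by (fastforce simp: \<F>_def)
    show "\<Omega> \<subseteq> \<Union>\<F>"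
    proof
      fix x assume "x \<in> \<Omega>"
      then obtain a b where "x \<in> box a b" "cbox a b \<subseteq> \<Omega>"
        using \<open>open \<Omega>\<close> open_contains_cbox by metis
      then show "x \<in> \<Union>\<F>" by (auto simp: \<F>_def)
    qed
  qed
  moreover have "AE x in lborel. \<forall>S\<in>\<F>'. x \<in> S \<longrightarrow> P x"
    by (subst AE_ball_countable[OF F'(2)]) (use F'(1) z in \<open>auto simp: \<F>_def\<close>)
  ultimately show ?thesis
    by (elim eventually_mono) (use F'(3) in blast)
qed

text \<open>Bumps converge boundedly to the indicator of their box, so orthogonality to test
  functions makes the integrals over all boxes with closure in \<Omega> vanish. This is what makes
  weak derivatives unique and \<open>wpd\<close> well defined.\<close>

theorem test_functions_total:
  fixes \<Omega> :: "'a::euclidean_space set"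
  assumes "open \<Omega>" and g: "g \<in> H \<Omega>" and orth: "\<And>\<psi>. \<psi> \<in> test_functions \<Omega> \<Longrightarrow> g \<bullet> toL2 \<psi> = 0"
  shows "g = 0"
proof -
  define f where "f = ofL2 g"
  have [simp]: "sq_int f" by (simp add: f_def)
  have [measurable]: "f \<in> borel_measurable borel" by (simp add: sq_int_measurable)
  have zero: "(LINT x|lborel. f x * indicator (box a b) x) = 0" if "cbox a b \<subseteq> \<Omega>" for a b
  proof -
    have "(\<lambda>n. LINT x|lborel. f x * box_bump a b n x) \<longlonglongrightarrow> (LINT x|lborel. f x * indicator (box a b) x)"
    proof (rule integral_dominated_convergence[where w="\<lambda>x. \<bar>f x * indicator (cbox a b) x\<bar>"])
      show "integrable lborel (\<lambda>x. \<bar>f x * indicator (cbox a b) x\<bar>)"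
        using sq_int_mult[OF \<open>sq_int f\<close> sq_int_indicator_cbox] by simp
      show "AE x in lborel. (\<lambda>n. f x * box_bump a b n x) \<longlonglongrightarrow> f x * indicator (box a b) x"
        by (intro AE_I2 tendsto_intros box_bump_tendsto)
      show "(\<lambda>x. f x * box_bump a b n x) \<in> borel_measurable lborel" for n
        using sq_int_measurable[OF sq_int_test_function[OF box_bump_test_function[OF that, of n]]]
        by simp
      show "AE x in lborel. norm (f x * box_bump a b n x) \<le> \<bar>f x * indicator (cbox a b) x\<bar>" for n
      proof (intro AE_I2)
        fix x
        show "norm (f x * box_bump a b n x) \<le> \<bar>f x * indicator (cbox a b) x\<bar>"
        proof (cases "x \<in> box a b")
          case True
          with box_subset_cbox[of a b] show ?thesis using box_bump_bounds[of a b n x]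
            by (auto simp: abs_mult mult_left_le subset_iff)
        qed (simp add: box_bump_outside)
      qed
    qed simp
    moreover have "(LINT x|lborel. f x * box_bump a b n x) = 0" for n
      using orth[OF box_bump_test_function[OF that, of n]]
        inner_toL2[OF \<open>sq_int f\<close> sq_int_test_function[OF box_bump_test_function[OF that, of n]]]
      by (simp add: f_def)
    ultimately show ?thesis by (simp add: LIMSEQ_const_iff)
  qed
  have "AE x in lborel. x \<in> \<Omega> \<longrightarrow> f x = 0"
  proof (rule AE_zero_on_open[OF \<open>open \<Omega>\<close>])
    fix c d :: 'a assume cd: "cbox c d \<subseteq> \<Omega>"
    have int: "integrable lborel (\<lambda>x. f x * indicator (box c d) x)"
    proof (rule Bochner_Integration.integrable_bound)
      show "integrable lborel (\<lambda>x. f x * indicator (cbox c d) x)"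
        by (rule sq_int_mult[OF \<open>sq_int f\<close> sq_int_indicator_cbox])
      show "AE x in lborel. norm (f x * indicator (box c d) x) \<le> norm (f x * indicator (cbox c d) x)"
        using box_subset_cbox[of c d] by (auto simp: indicator_def)
    qed simp
    \<comment> \<open>Cut off to one box the function is integrable on the whole space, and its
      integral over any further box is an integral over the intersection, again a box.\<close>
    have "AE x in lborel. f x * indicator (box c d) x = 0"
    proof (rule AE_zero_if_box_integrals_zero[OF int])
      fix a b :: 'a
      obtain a' b' where ab: "box c d \<inter> box a b = box a' b'" by (auto simp: box_Int_box)
      have eq: "f x * indicator (box c d) x * indicator (box a b) x = f x * indicator (box a' b') x" for x
        by (simp add: ab[symmetric] indicator_inter_arith)
      show "(LINT x|lborel. f x * indicator (box c d) x * indicator (box a b) x) = 0"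
      \<comment> \<open>\<open>cbox a' b'\<close> is the closure of \<open>box a' b'\<close> only if
        the open box is nonempty; otherwise it could leave \<Omega>.\<close>
      proof (cases "box a' b' = {}")
        case False
        then have "cbox a' b' = closure (box a' b')" by (simp add: closure_box)
        also have "\<dots> \<subseteq> closure (box c d)" using ab by (intro closure_mono) auto
        also have "\<dots> \<subseteq> cbox c d" by (intro closure_minimal box_subset_cbox closed_cbox)
        finally have "cbox a' b' \<subseteq> \<Omega>" using cd by blast
        from zero[OF this] show ?thesis by (simp only: eq)
      qed (simp add: eq)
    qed
    then show "AE x in lborel. x \<in> box c d \<longrightarrow> f x = 0"
      by eventually_elim (auto simp: indicator_def split: if_splits)
  qed
  moreover have "AE x in lborel. x \<notin> \<Omega> \<longrightarrow> f x = 0"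
    using g by (simp add: H_def f_def)
  ultimately have "AE x in lborel. ofL2 g x = ofL2 0 x"
    using ofL2_zero by eventually_elim (auto simp: f_def)
  then show ?thesis by (simp add: L2_eq_iff)
qed

section \<open>Integration by parts and weak derivatives\<close>

lemma pd_has_real_derivative:
  fixes f :: "'a::euclidean_space \<Rightarrow> real"
  assumes "f differentiable (at (x + t *\<^sub>R i))"
  shows "((\<lambda>t. f (x + t *\<^sub>R i)) has_real_derivative pd i f (x + t *\<^sub>R i)) (at t)"
proof -
  have 1: "((\<lambda>t. x + t *\<^sub>R i) has_derivative (\<lambda>h. h *\<^sub>R i)) (at t)"
    by (auto intro!: derivative_eq_intros)
  have 2: "(f has_derivative frechet_derivative f (at (x + t *\<^sub>R i))) (at (x + t *\<^sub>R i))"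
    using assms by (simp add: frechet_derivative_works)
  then have "frechet_derivative f (at (x + t *\<^sub>R i)) (h *\<^sub>R i) = h * pd i f (x + t *\<^sub>R i)" for h
    using linear_scale[OF has_derivative_linear, of f "frechet_derivative f (at (x + t *\<^sub>R i))"]
    by (simp add: pd_def)
  moreover have "(\<lambda>h. h * pd i f (x + t *\<^sub>R i)) = (*) (pd i f (x + t *\<^sub>R i))"
    by (simp add: fun_eq_iff)
  ultimately show ?thesis
    using has_derivative_compose[OF 1 2] by (simp add: has_field_derivative_def)
qed

text \<open>By translation invariance of the measure every difference quotient of \<psi> has
  integral 0, and the quotients converge dominatedly to the partial derivative. This avoids
  splitting the space into coordinates.\<close>

lemma integral_pd_zero:
  fixes \<psi> :: "'a::euclidean_space \<Rightarrow> real"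
  assumes \<psi>: "\<psi> \<in> test_functions \<Omega>" and i: "i \<in> Basis"
  shows "(LINT x|lborel. pd i \<psi> x) = 0"
proof -
  obtain K where K: "compact K" "\<And>x. x \<notin> K \<Longrightarrow> \<psi> x = 0"
    using \<psi> by (auto elim!: test_functionE)
  obtain r where r: "\<And>x. x \<in> K \<Longrightarrow> norm x \<le> r"
    using compact_imp_bounded[OF K(1)] by (auto simp: bounded_iff)
  obtain B where B: "\<And>x. \<bar>pd i \<psi> x\<bar> \<le> B"
    using test_function_bounded[OF test_function_pd[OF \<psi> i]] by blast
  define h where "h n = inverse (real (Suc n))" for n
  have h: "0 < h n" "h n \<le> 1" for n by (auto simp: h_def field_simps)
  define q where "q n x = (\<psi> (x + h n *\<^sub>R i) - \<psi> x) / h n" for n x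
  have int: "integrable lborel \<psi>" by (rule test_function_integrable[OF \<psi>])
  then have [measurable]: "\<psi> \<in> borel_measurable borel" by auto
  have [measurable]: "q n \<in> borel_measurable borel" for n
    unfolding q_def by measurable
  have der: "((\<lambda>t. \<psi> (x + t *\<^sub>R i)) has_real_derivative pd i \<psi> (x + t *\<^sub>R i)) (at t)" for x t
    by (intro pd_has_real_derivative smooth_on_differentiable test_function_smooth[OF \<psi>])
  have "(\<lambda>n. LINT x|lborel. q n x) \<longlonglongrightarrow> (LINT x|lborel. pd i \<psi> x)"
  \<comment> \<open>The steps \<open>h n\<close> are at most 1, so all quotients vanish outside the
    ball of radius \<open>r + 1\<close>; inside, the mean value theorem bounds them by
    \<open>B\<close>.\<close>
  proof (rule integral_dominated_convergence[where w="\<lambda>x. B * indicator (cball 0 (r + 1)) x"])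
    show "integrable lborel (\<lambda>x::'a. B * indicator (cball 0 (r + 1)) x)"
      using emeasure_bounded_finite[OF bounded_cball, of "0::'a" "r + 1"]
      by (intro integrable_mult_right) (simp add: integrable_indicator_iff)
    show "pd i \<psi> \<in> borel_measurable lborel"
      using test_function_integrable[OF test_function_pd[OF \<psi> i]] by auto
    show "AE x in lborel. (\<lambda>n. q n x) \<longlonglongrightarrow> pd i \<psi> x"
    proof (rule AE_I2)
      fix x
      have "((\<lambda>s. (\<psi> (x + s *\<^sub>R i) - \<psi> x) / s) \<longlongrightarrow> pd i \<psi> x) (at 0)"
        using der[of x 0] by (simp add: DERIV_def)
      moreover have "filterlim h (at 0) sequentially"
        unfolding filterlim_at using LIMSEQ_inverse_real_of_nat h
        by (auto simp: h_def[abs_def])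
      ultimately show "(\<lambda>n. q n x) \<longlonglongrightarrow> pd i \<psi> x"
        unfolding q_def by (rule filterlim_compose)
    qed
    show "AE x in lborel. norm (q n x) \<le> B * indicator (cball 0 (r + 1)) x" for n
    proof (rule AE_I2)
      fix x
      show "norm (q n x) \<le> B * indicator (cball 0 (r + 1)) x"
      proof (cases "x \<in> cball 0 (r + 1)")
        case True
        obtain s where "\<psi> (x + h n *\<^sub>R i) - \<psi> (x + 0 *\<^sub>R i) = (h n - 0) * pd i \<psi> (x + s *\<^sub>R i)"
          using MVT2[of 0 "h n" "\<lambda>t. \<psi> (x + t *\<^sub>R i)", OF h(1) der] by blast
        then have "q n x = pd i \<psi> (x + s *\<^sub>R i)"
          using h(1)[of n] by (simp add: q_def)
        then show ?thesis using B True by simp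
      next
        case False
        have "norm (x + h n *\<^sub>R i) \<ge> norm x - norm (h n *\<^sub>R i)" by (rule norm_diff_ineq)
        moreover have "norm (h n *\<^sub>R i) \<le> 1" using h[of n] i by simp
        ultimately have "x + h n *\<^sub>R i \<notin> K" "x \<notin> K" using r False by fastforce+
        then show ?thesis using K(2) False by (simp add: q_def)
      qed
    qed
  qed simp
  moreover have "(LINT x|lborel. q n x) = 0" for n
  proof -
    have "distr lborel borel (\<lambda>x. h n *\<^sub>R i + x) = (lborel :: 'a measure)"
      by (rule lborel_distr_plus)
    then have "integrable lborel (\<lambda>x. \<psi> (h n *\<^sub>R i + x))"
      "(LINT x|lborel. \<psi> (h n *\<^sub>R i + x)) = (LINT x|lborel. \<psi> x)"
      using int integrable_distr_eq[of "\<lambda>x. h n *\<^sub>R i + x" lborel borel \<psi>]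
        integral_distr[of "\<lambda>x. h n *\<^sub>R i + x" lborel borel \<psi>] by simp_all
    then show ?thesis
      using int unfolding q_def by (simp add: add.commute)
  qed
  ultimately show ?thesis by (simp add: LIMSEQ_const_iff)
qed

lemma test_function_by_parts:
  assumes "smooth_on UNIV \<eta>" "\<psi> \<in> test_functions \<Omega>" "i \<in> Basis"
  shows "(LINT x|lborel. \<eta> x * pd i \<psi> x) = - (LINT x|lborel. pd i \<eta> x * \<psi> x)"
proof -
  have "pd i (\<lambda>x. \<eta> x * \<psi> x) = (\<lambda>x. \<eta> x * pd i \<psi> x + pd i \<eta> x * \<psi> x)"
    using assms by (auto simp: fun_eq_iff intro!: pd_mult smooth_on_differentiable test_function_smooth)
  moreover have "integrable lborel (\<lambda>x. \<eta> x * pd i \<psi> x)"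
    "integrable lborel (\<lambda>x. pd i \<eta> x * \<psi> x)"
    using assms
    by (auto intro: test_function_integrable test_function_mult test_function_pd smooth_on_pd)
  ultimately show ?thesis
    using integral_pd_zero[OF test_function_mult[OF assms(1,2)] assms(3)] by simp
qed

lemma test_function_in_H: "\<psi> \<in> test_functions \<Omega> \<Longrightarrow> toL2 \<psi> \<in> H \<Omega>"
  by (auto intro: toL2_in_H test_function_outside)

lemma weak_pd_test_function:
  assumes "\<psi> \<in> test_functions \<Omega>" "i \<in> Basis"
  shows "weak_pd \<Omega> i (toL2 \<psi>) (toL2 (pd i \<psi>))"
  unfolding weak_pd_def
proof (intro conjI ballI)
  fix \<eta> assume \<eta>: "\<eta> \<in> test_functions \<Omega>"
  show "toL2 \<psi> \<bullet> toL2 (pd i \<eta>) = - (toL2 (pd i \<psi>) \<bullet> toL2 \<eta>)"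
    using test_function_by_parts[OF test_function_smooth[OF assms(1)] \<eta> assms(2)]
      sq_int_test_function[OF assms(1)] sq_int_test_function[OF \<eta>]
      sq_int_test_function[OF test_function_pd[OF assms]]
      sq_int_test_function[OF test_function_pd[OF \<eta> assms(2)]]
    by (simp add: inner_toL2)
qed (use assms in \<open>auto intro: test_function_in_H test_function_pd\<close>)

lemma weak_pd_add: "weak_pd \<Omega> i u g \<Longrightarrow> weak_pd \<Omega> i v h \<Longrightarrow> weak_pd \<Omega> i (u + v) (g + h)"
  using subspace_add[OF subspace_H] by (auto simp: weak_pd_def inner_add_left)

lemma weak_pd_scale: "weak_pd \<Omega> i u g \<Longrightarrow> weak_pd \<Omega> i (c *\<^sub>R u) (c *\<^sub>R g)"
  using subspace_scale[OF subspace_H] by (auto simp: weak_pd_def)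

lemma weak_pd_zero: "weak_pd \<Omega> i 0 0"
  using subspace_0[OF subspace_H] by (auto simp: weak_pd_def)

lemma weak_pd_unique:
  assumes "open \<Omega>" "weak_pd \<Omega> i u g" "weak_pd \<Omega> i u h"
  shows "g = h"
proof -
  have "g - h = 0"
    by (rule test_functions_total[OF assms(1)])
      (use assms subspace_diff[OF subspace_H] in \<open>auto simp: weak_pd_def inner_diff_left\<close>)
  then show ?thesis by simp
qed

lemma wpd_eqI: "open \<Omega> \<Longrightarrow> weak_pd \<Omega> i u g \<Longrightarrow> wpd \<Omega> i u = g"
  unfolding wpd_def using weak_pd_unique by (blast intro: the_equality)

lemma weak_pd_wpd: "open \<Omega> \<Longrightarrow> u \<in> H1 \<Omega> \<Longrightarrow> i \<in> Basis \<Longrightarrow> weak_pd \<Omega> i u (wpd \<Omega> i u)"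
  unfolding H1_def using wpd_eqI by fastforce

lemma wpd_in_H: "open \<Omega> \<Longrightarrow> u \<in> H1 \<Omega> \<Longrightarrow> i \<in> Basis \<Longrightarrow> wpd \<Omega> i u \<in> H \<Omega>"
  using weak_pd_wpd by (auto simp: weak_pd_def)

lemma wpd_test_function:
  "open \<Omega> \<Longrightarrow> \<psi> \<in> test_functions \<Omega> \<Longrightarrow> i \<in> Basis \<Longrightarrow> wpd \<Omega> i (toL2 \<psi>) = toL2 (pd i \<psi>)"
  by (intro wpd_eqI weak_pd_test_function)

lemma test_function_in_H1: "\<psi> \<in> test_functions \<Omega> \<Longrightarrow> toL2 \<psi> \<in> H1 \<Omega>"
  unfolding H1_def using weak_pd_test_function test_function_in_H by blast

lemma wpd_add:
  "open \<Omega> \<Longrightarrow> u \<in> H1 \<Omega> \<Longrightarrow> v \<in> H1 \<Omega> \<Longrightarrow> i \<in> Basis \<Longrightarrow> wpd \<Omega> i (u + v) = wpd \<Omega> i u + wpd \<Omega> i v"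
  by (intro wpd_eqI weak_pd_add weak_pd_wpd)

lemma wpd_scale:
  "open \<Omega> \<Longrightarrow> u \<in> H1 \<Omega> \<Longrightarrow> i \<in> Basis \<Longrightarrow> wpd \<Omega> i (c *\<^sub>R u) = c *\<^sub>R wpd \<Omega> i u"
  by (intro wpd_eqI weak_pd_scale weak_pd_wpd)

lemma subspace_H1: "subspace (H1 \<Omega>)"
  unfolding subspace_def
proof (intro conjI ballI allI)
  show "0 \<in> H1 \<Omega>"
    using weak_pd_zero subspace_0[OF subspace_H] by (auto simp: H1_def)
  show "u + v \<in> H1 \<Omega>" if "u \<in> H1 \<Omega>" "v \<in> H1 \<Omega>" for u v
    using that subspace_add[OF subspace_H] weak_pd_add unfolding H1_def by blast
  show "c *\<^sub>R u \<in> H1 \<Omega>" if "u \<in> H1 \<Omega>" for c u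
    using that subspace_scale[OF subspace_H] weak_pd_scale unfolding H1_def by blast
qed

lemma wpd_diff:
  assumes "open \<Omega>" "u \<in> H1 \<Omega>" "v \<in> H1 \<Omega>" "i \<in> Basis"
  shows "wpd \<Omega> i (u - v) = wpd \<Omega> i u - wpd \<Omega> i v"
  using wpd_add[OF assms(1,2) subspace_scale[OF subspace_H1 assms(3), of "-1"] assms(4)]
    wpd_scale[OF assms(1,3,4), of "-1"] by simp

section \<open>The \<open>H1\<close> norm and the closure \<open>H10\<close> of the test
  functions\<close>

lemma normH1_sq: "(normH1 \<Omega> u)\<^sup>2 = (norm u)\<^sup>2 + (\<Sum>i\<in>Basis. (norm (wpd \<Omega> i u))\<^sup>2)"
  by (simp add: normH1_def grad_inner_def dot_square_norm sum_nonneg)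

lemma normH1_nonneg: "0 \<le> normH1 \<Omega> u"
  by (simp add: normH1_def grad_inner_def sum_nonneg)

lemma norm_le_normH1: "norm u \<le> normH1 \<Omega> u"
  by (rule power2_le_imp_le) (simp_all add: normH1_sq normH1_nonneg sum_nonneg)

lemma norm_wpd_le_normH1:
  assumes "i \<in> Basis"
  shows "norm (wpd \<Omega> i u) \<le> normH1 \<Omega> u"
proof (rule power2_le_imp_le)
  have "(norm (wpd \<Omega> i u))\<^sup>2 \<le> (\<Sum>i\<in>Basis. (norm (wpd \<Omega> i u))\<^sup>2)"
    using assms by (intro member_le_sum) auto
  then show "(norm (wpd \<Omega> i u))\<^sup>2 \<le> (normH1 \<Omega> u)\<^sup>2"
    unfolding normH1_sq by (smt (verit) zero_le_power2)
qed (simp add: normH1_nonneg)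

text \<open>\<open>normH1\<close> is not the norm of a type. Splitting it into L2 convergence of the
  functions and of each partial derivative lets the usual limit rules prove closure properties,
  Green's identity and the Poincare inequality.\<close>

lemma H10_iff_approximable:
  assumes "open \<Omega>"
  shows "u \<in> H10 \<Omega> \<longleftrightarrow> u \<in> H1 \<Omega> \<and> (\<exists>\<psi>. (\<forall>n. \<psi> n \<in> test_functions \<Omega>) \<and> (\<lambda>n. toL2 (\<psi> n)) \<longlonglongrightarrow> u \<and>
    (\<forall>i\<in>Basis. (\<lambda>n. toL2 (pd i (\<psi> n))) \<longlonglongrightarrow> wpd \<Omega> i u))"
    (is "_ \<longleftrightarrow> ?rhs")
proof
  assume u: "u \<in> H10 \<Omega>"
  then have u1: "u \<in> H1 \<Omega>" by (simp add: H10_def)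
  have "\<exists>\<psi>\<in>test_functions \<Omega>. normH1 \<Omega> (u - toL2 \<psi>) < inverse (real (Suc n))" for n
    using u by (simp add: H10_def)
  then obtain \<psi> where \<psi>: "\<And>n. \<psi> n \<in> test_functions \<Omega>"
    "\<And>n. normH1 \<Omega> (u - toL2 (\<psi> n)) < inverse (real (Suc n))"
    by metis
  have "norm (toL2 (\<psi> n) - u) \<le> inverse (real (Suc n))" for n
    using norm_le_normH1[of "u - toL2 (\<psi> n)" \<Omega>] \<psi>(2)[of n] by (simp add: norm_minus_commute)
  then have "(\<lambda>n. toL2 (\<psi> n) - u) \<longlonglongrightarrow> 0"
    by (intro Lim_null_comparison[OF _ LIMSEQ_inverse_real_of_nat]) auto
  moreover have "(\<lambda>n. toL2 (pd i (\<psi> n)) - wpd \<Omega> i u) \<longlonglongrightarrow> 0" if "i \<in> Basis" for i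
  proof -
    have "norm (toL2 (pd i (\<psi> n)) - wpd \<Omega> i u) \<le> inverse (real (Suc n))" for n
      using norm_wpd_le_normH1[OF that, of \<Omega> "u - toL2 (\<psi> n)"] \<psi>(2)[of n]
        wpd_diff[OF assms u1 test_function_in_H1[OF \<psi>(1)] that]
        wpd_test_function[OF assms \<psi>(1) that]
      by (simp add: norm_minus_commute)
    then show ?thesis
      by (intro Lim_null_comparison[OF _ LIMSEQ_inverse_real_of_nat]) auto
  qed
  ultimately show ?rhs using u1 \<psi>(1) by (auto simp: LIM_zero_iff)
next
  assume ?rhs
  then obtain \<psi> where u1: "u \<in> H1 \<Omega>" and \<psi>: "\<And>n. \<psi> n \<in> test_functions \<Omega>"
    and lim: "(\<lambda>n. toL2 (\<psi> n)) \<longlonglongrightarrow> u"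
      "\<And>i. i \<in> Basis \<Longrightarrow> (\<lambda>n. toL2 (pd i (\<psi> n))) \<longlonglongrightarrow> wpd \<Omega> i u"
    by auto
  have "(\<lambda>n. (norm (u - toL2 (\<psi> n)))\<^sup>2 + (\<Sum>i\<in>Basis. (norm (wpd \<Omega> i u - toL2 (pd i (\<psi> n))))\<^sup>2))
      \<longlonglongrightarrow> (norm (u - u))\<^sup>2 + (\<Sum>i\<in>(Basis::'a set). (norm (wpd \<Omega> i u - wpd \<Omega> i u))\<^sup>2)"
    by (intro tendsto_intros lim)
  moreover have "(normH1 \<Omega> (u - toL2 (\<psi> n)))\<^sup>2
      = (norm (u - toL2 (\<psi> n)))\<^sup>2 + (\<Sum>i\<in>Basis. (norm (wpd \<Omega> i u - toL2 (pd i (\<psi> n))))\<^sup>2)" for n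
    using wpd_diff[OF assms u1 test_function_in_H1[OF \<psi>]] wpd_test_function[OF assms \<psi>]
    by (simp add: normH1_sq)
  ultimately have lim0: "(\<lambda>n. (normH1 \<Omega> (u - toL2 (\<psi> n)))\<^sup>2) \<longlonglongrightarrow> 0" by simp
  show "u \<in> H10 \<Omega>"
    unfolding H10_def
  proof (intro CollectI conjI allI impI u1)
    fix e :: real assume "e > 0"
    then have "eventually (\<lambda>n. (normH1 \<Omega> (u - toL2 (\<psi> n)))\<^sup>2 < e\<^sup>2) sequentially"
      using order_tendstoD(2)[OF lim0, of "e\<^sup>2"] by simp
    then obtain n where "(normH1 \<Omega> (u - toL2 (\<psi> n)))\<^sup>2 < e\<^sup>2"
      by (auto simp: eventually_sequentially)
    then have "normH1 \<Omega> (u - toL2 (\<psi> n)) < e"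
      by (rule power2_less_imp_less) (use \<open>e > 0\<close> in simp)
    then show "\<exists>\<psi>\<in>test_functions \<Omega>. normH1 \<Omega> (u - toL2 \<psi>) < e"
      using \<psi>[of n] by (rule bexI)
  qed
qed

lemma subspace_H10:
  assumes "open \<Omega>"
  shows "subspace (H10 \<Omega>)"
  unfolding subspace_def
proof (intro conjI ballI allI)
  show "0 \<in> H10 \<Omega>"
    unfolding H10_iff_approximable[OF assms]
    by (intro conjI exI[of _ "\<lambda>n x. 0"])
      (auto simp: subspace_0[OF subspace_H1] toL2_zero wpd_eqI[OF assms weak_pd_zero]
        intro!: test_functionI[of _ "{}"] smooth_on_const)
next
  fix u v assume "u \<in> H10 \<Omega>" "v \<in> H10 \<Omega>"
  then obtain \<psi> \<eta> where H1: "u \<in> H1 \<Omega>" "v \<in> H1 \<Omega>"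
    and t: "\<And>n. \<psi> n \<in> test_functions \<Omega>" "\<And>n. \<eta> n \<in> test_functions \<Omega>"
    and lim: "(\<lambda>n. toL2 (\<psi> n)) \<longlonglongrightarrow> u" "(\<lambda>n. toL2 (\<eta> n)) \<longlonglongrightarrow> v"
      "\<And>i. i \<in> Basis \<Longrightarrow> (\<lambda>n. toL2 (pd i (\<psi> n))) \<longlonglongrightarrow> wpd \<Omega> i u"
      "\<And>i. i \<in> Basis \<Longrightarrow> (\<lambda>n. toL2 (pd i (\<eta> n))) \<longlonglongrightarrow> wpd \<Omega> i v"
    unfolding H10_iff_approximable[OF assms] by metis
  have pd: "pd i (\<lambda>x. \<psi> n x + \<eta> n x) = (\<lambda>x. pd i (\<psi> n) x + pd i (\<eta> n) x)" for i n
    using t by (auto simp: fun_eq_iff intro!: pd_add smooth_on_differentiable test_function_smooth)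
  have eq: "toL2 (pd i (\<lambda>x. \<psi> n x + \<eta> n x)) = toL2 (pd i (\<psi> n)) + toL2 (pd i (\<eta> n))"
    if "i \<in> Basis" for i n
    unfolding pd using t that by (intro toL2_add[symmetric] sq_int_test_function test_function_pd)
  have eq': "toL2 (\<lambda>x. \<psi> n x + \<eta> n x) = toL2 (\<psi> n) + toL2 (\<eta> n)" for n
    using t by (intro toL2_add[symmetric] sq_int_test_function)
  show "u + v \<in> H10 \<Omega>"
    unfolding H10_iff_approximable[OF assms]
    by (intro conjI exI[of _ "\<lambda>n x. \<psi> n x + \<eta> n x"])
      (auto simp: eq eq' wpd_add[OF assms H1] subspace_add[OF subspace_H1 H1]
        intro!: tendsto_intros lim t test_function_add)
next
  fix u c assume "u \<in> H10 \<Omega>"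
  then obtain \<psi> where H1: "u \<in> H1 \<Omega>" and t: "\<And>n. \<psi> n \<in> test_functions \<Omega>"
    and lim: "(\<lambda>n. toL2 (\<psi> n)) \<longlonglongrightarrow> u"
      "\<And>i. i \<in> Basis \<Longrightarrow> (\<lambda>n. toL2 (pd i (\<psi> n))) \<longlonglongrightarrow> wpd \<Omega> i u"
    unfolding H10_iff_approximable[OF assms] by metis
  have "pd i (\<lambda>x. c * \<psi> n x) = (\<lambda>x. c * pd i (\<psi> n) x)" for i n
  proof
    fix x
    show "pd i (\<lambda>x. c * \<psi> n x) x = c * pd i (\<psi> n) x"
      using pd_mult[of "\<lambda>x. c" x "\<psi> n" i] smooth_on_differentiable[OF test_function_smooth[OF t]]
      by simp
  qed
  then have eq: "toL2 (pd i (\<lambda>x. c * \<psi> n x)) = c *\<^sub>R toL2 (pd i (\<psi> n))" if "i \<in> Basis" for i n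
    using that by (simp add: toL2_scale sq_int_test_function[OF test_function_pd[OF t]])
  have eq': "toL2 (\<lambda>x. c * \<psi> n x) = c *\<^sub>R toL2 (\<psi> n)" for n
    by (simp add: toL2_scale sq_int_test_function[OF t])
  show "c *\<^sub>R u \<in> H10 \<Omega>"
    unfolding H10_iff_approximable[OF assms]
    by (intro conjI exI[of _ "\<lambda>n x. c * \<psi> n x"])
      (auto simp: eq eq' wpd_scale[OF assms H1] subspace_scale[OF subspace_H1 H1]
        intro!: tendsto_intros lim t test_function_mult smooth_on_const)
qed

section \<open>The space \<open>V\<close>, its Laplacian and Green's identity\<close>

lemma subspace_H2:
  assumes "open \<Omega>"
  shows "subspace (H2 \<Omega>)"
  unfolding subspace_def H2_def
  using subspace_0[OF subspace_H1, of \<Omega>] subspace_add[OF subspace_H1, of _ \<Omega>] subspace_scale[OF subspace_H1, of _ \<Omega>]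
  by (auto simp: wpd_eqI[OF assms weak_pd_zero] wpd_add[OF assms] wpd_scale[OF assms])

lemma subspace_V: "open \<Omega> \<Longrightarrow> subspace (V \<Omega>)"
  unfolding V_def by (intro subspace_inter subspace_H2 subspace_H10)

lemma V_subset_H: "V \<Omega> \<subseteq> H \<Omega>"
  by (auto simp: V_def H2_def H1_def)

lemma V_subset_H10: "V \<Omega> \<subseteq> H10 \<Omega>"
  by (auto simp: V_def)

lemma laplacian_add:
  assumes "open \<Omega>" "u \<in> V \<Omega>" "v \<in> V \<Omega>"
  shows "laplacian \<Omega> (u + v) = laplacian \<Omega> u + laplacian \<Omega> v"
  using assms by (simp add: laplacian_def V_def H2_def wpd_add sum.distrib)

lemma laplacian_scale:
  assumes "open \<Omega>" "u \<in> V \<Omega>"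
  shows "laplacian \<Omega> (c *\<^sub>R u) = c *\<^sub>R laplacian \<Omega> u"
  using assms by (simp add: laplacian_def V_def H2_def wpd_scale scaleR_sum_right)

lemma laplacian_diff:
  assumes "open \<Omega>" "u \<in> V \<Omega>" "v \<in> V \<Omega>"
  shows "laplacian \<Omega> (u - v) = laplacian \<Omega> u - laplacian \<Omega> v"
  using laplacian_add[OF assms(1,2) subspace_scale[OF subspace_V[OF assms(1)] assms(3), of "-1"]]
    laplacian_scale[OF assms(1,3), of "-1"] by simp

text \<open>The boundary condition sits in the approximation of \<open>v\<close> by test functions:
  each of them may be inserted into the definition of the weak derivative of
  \<open>wpd \<Omega> i u\<close>, and both sides pass to the limit.\<close>

lemma Green_identity:
  assumes "open \<Omega>" "u \<in> V \<Omega>" "v \<in> H10 \<Omega>"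
  shows "grad_inner \<Omega> v u = - (v \<bullet> laplacian \<Omega> u)"
proof -
  obtain \<psi> where \<psi>: "\<And>n. \<psi> n \<in> test_functions \<Omega>" "(\<lambda>n. toL2 (\<psi> n)) \<longlonglongrightarrow> v"
    "\<And>i. i \<in> Basis \<Longrightarrow> (\<lambda>n. toL2 (pd i (\<psi> n))) \<longlonglongrightarrow> wpd \<Omega> i v"
    using assms(3) unfolding H10_iff_approximable[OF assms(1)] by metis
  have "wpd \<Omega> i v \<bullet> wpd \<Omega> i u = - (v \<bullet> wpd \<Omega> i (wpd \<Omega> i u))" if i: "i \<in> Basis" for i
  proof (rule LIMSEQ_unique)
    show "(\<lambda>n. toL2 (pd i (\<psi> n)) \<bullet> wpd \<Omega> i u) \<longlonglongrightarrow> wpd \<Omega> i v \<bullet> wpd \<Omega> i u"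
      by (intro tendsto_intros \<psi> i)
    have "weak_pd \<Omega> i (wpd \<Omega> i u) (wpd \<Omega> i (wpd \<Omega> i u))"
      using assms i by (intro weak_pd_wpd) (auto simp: V_def H2_def)
    then have "toL2 (pd i (\<psi> n)) \<bullet> wpd \<Omega> i u = - (toL2 (\<psi> n) \<bullet> wpd \<Omega> i (wpd \<Omega> i u))" for n
      using \<psi>(1)[of n] unfolding weak_pd_def by (metis inner_commute)
    then show "(\<lambda>n. toL2 (pd i (\<psi> n)) \<bullet> wpd \<Omega> i u) \<longlonglongrightarrow> - (v \<bullet> wpd \<Omega> i (wpd \<Omega> i u))"
      by (simp, intro tendsto_intros \<psi>)
  qed
  then show ?thesis
    by (simp add: grad_inner_def laplacian_def inner_sum_right sum_negf)
qed

subsection \<open>The Poincare inequality\<close>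

lemma smooth_on_coordinate:
  assumes "i \<in> Basis"
  shows "smooth_on UNIV (\<lambda>x. x \<bullet> i)" "pd i (\<lambda>x. x \<bullet> i) = (\<lambda>x. 1)"
proof -
  have der: "((\<lambda>x. x \<bullet> i) has_derivative (\<lambda>h. h \<bullet> i)) (at x)" for x
    by (auto intro!: derivative_eq_intros)
  have pd: "pd j (\<lambda>x. x \<bullet> i) = (\<lambda>x. j \<bullet> i)" for j
    using frechet_derivative_at[OF der] by (simp add: pd_def fun_eq_iff)
  then show "pd i (\<lambda>x. x \<bullet> i) = (\<lambda>x. 1)"
    using assms by (simp add: inner_same_Basis)
  have "Ck_on k UNIV (\<lambda>x. x \<bullet> i)" for k
    by (cases k) (use der pd in \<open>auto simp: Ck_on_const differentiable_def intro!: continuous_intros\<close>)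
  then show "smooth_on UNIV (\<lambda>x. x \<bullet> i)" by (simp add: smooth_on_def)
qed

text \<open>Since the i-th coordinate has i-th derivative 1, integration by parts gives |\<psi>|^2 =
  -2 (x_i \<psi>, d_i \<psi>); Cauchy-Schwarz and |x_i| <= B on \<Omega> finish.\<close>

lemma Poincare_test_function:
  assumes \<psi>: "\<psi> \<in> test_functions \<Omega>" and i: "i \<in> Basis" and B: "\<And>x. x \<in> \<Omega> \<Longrightarrow> norm x \<le> B"
  shows "norm (toL2 \<psi>) \<le> 2 * B * norm (toL2 (pd i \<psi>))"
proof -
  note sm = smooth_on_coordinate[OF i] test_function_smooth[OF \<psi>]
  have x\<psi>: "(\<lambda>x. x \<bullet> i * \<psi> x) \<in> test_functions \<Omega>"
    by (rule test_function_mult[OF sm(1) \<psi>])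
  note sq = sq_int_test_function[OF \<psi>] sq_int_test_function[OF x\<psi>]
    sq_int_test_function[OF test_function_pd[OF \<psi> i]]
  have "pd i (\<lambda>x. x \<bullet> i * \<psi> x) = (\<lambda>x. x \<bullet> i * pd i \<psi> x + \<psi> x)"
    using sm smooth_on_differentiable[OF sm(1)] smooth_on_differentiable[OF sm(3)]
    by (simp add: fun_eq_iff pd_mult)
  then have "(LINT x|lborel. (x \<bullet> i * \<psi> x) * pd i \<psi> x)
      = - (LINT x|lborel. (x \<bullet> i * \<psi> x) * pd i \<psi> x + \<psi> x * \<psi> x)"
    using test_function_by_parts[OF test_function_smooth[OF x\<psi>] \<psi> i]
    by (simp add: algebra_simps)
  also have "\<dots> = - (LINT x|lborel. (x \<bullet> i * \<psi> x) * pd i \<psi> x) - (LINT x|lborel. \<psi> x * \<psi> x)"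
    using sq_int_mult[OF sq(2,3)] sq_int_mult[OF sq(1,1)] by simp
  finally have "(norm (toL2 \<psi>))\<^sup>2 = - 2 * (toL2 (\<lambda>x. x \<bullet> i * \<psi> x) \<bullet> toL2 (pd i \<psi>))"
    using sq by (simp add: power2_norm_eq_inner inner_toL2)
  also have "\<dots> \<le> 2 * (norm (toL2 (\<lambda>x. x \<bullet> i * \<psi> x)) * norm (toL2 (pd i \<psi>)))"
    using Cauchy_Schwarz_ineq2[of "toL2 (\<lambda>x. x \<bullet> i * \<psi> x)" "toL2 (pd i \<psi>)"] by linarith
  also have "\<dots> \<le> 2 * (B * norm (toL2 \<psi>) * norm (toL2 (pd i \<psi>)))"
  proof (cases "\<Omega> = {}")
    case True
    then have "\<psi> = (\<lambda>x. 0)" using test_function_outside[OF \<psi>] by auto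
    then show ?thesis by (simp add: toL2_zero)
  next
    case False
    then have "B \<ge> 0" using B norm_ge_zero by (meson all_not_in_conv order_trans)
    have "(norm (toL2 (\<lambda>x. x \<bullet> i * \<psi> x)))\<^sup>2 = (LINT x|lborel. (x \<bullet> i * \<psi> x)\<^sup>2)"
      by (rule norm_toL2[OF sq(2)])
    also have "\<dots> \<le> (LINT x|lborel. B\<^sup>2 * (\<psi> x)\<^sup>2)"
    proof (rule integral_mono)
      fix x
      show "(x \<bullet> i * \<psi> x)\<^sup>2 \<le> B\<^sup>2 * (\<psi> x)\<^sup>2"
      proof (cases "x \<in> \<Omega>")
        case True
        have "\<bar>x \<bullet> i\<bar> \<le> B" using B[OF True] Basis_le_norm[OF i, of x] by linarith
        then have "(x \<bullet> i)\<^sup>2 \<le> B\<^sup>2" using \<open>B \<ge> 0\<close> by (simp add: abs_le_square_iff[symmetric])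
        then show ?thesis by (simp add: power_mult_distrib mult_right_mono)
      qed (simp add: test_function_outside[OF \<psi>])
    qed (use sq in \<open>simp_all add: sq_int_def\<close>)
    also have "\<dots> = (B * norm (toL2 \<psi>))\<^sup>2"
      using sq(1) by (simp add: norm_toL2 power_mult_distrib)
    finally have "norm (toL2 (\<lambda>x. x \<bullet> i * \<psi> x)) \<le> B * norm (toL2 \<psi>)"
      by (rule power2_le_imp_le) (use \<open>B \<ge> 0\<close> in simp)
    then show ?thesis by (intro mult_left_mono mult_right_mono) auto
  qed
  finally have "norm (toL2 \<psi>) * norm (toL2 \<psi>) \<le> (2 * B * norm (toL2 (pd i \<psi>))) * norm (toL2 \<psi>)"
    by (simp add: power2_eq_square mult_ac)
  then show ?thesis
  proof (cases "toL2 \<psi> = 0")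
    case True
    \<comment> \<open>The sign of \<open>B\<close> is unknown when \<Omega> is empty, so the
      right-hand side is shown to be 0. \<Omega> need not be open here, hence the weak derivative
      over the whole space.\<close>
    then have "0 = wpd UNIV i (toL2 \<psi>)" by (simp add: wpd_eqI[OF open_UNIV weak_pd_zero])
    also have "\<dots> = toL2 (pd i \<psi>)"
      using \<psi> i by (intro wpd_test_function) (auto simp: test_functions_def)
    finally show ?thesis using True by simp
  qed simp
qed

text \<open>The estimate for test functions extends to \<open>H10\<close> by density and gives |u|
  <= 2B |d_i u|. By Green's identity |d_i u|^2 <= -(u, Laplacian u) <= |u| times
  \<open>normV \<Omega> u\<close>, and one factor |u| cancels.\<close>

theorem Poincare_inequality:
  assumes "open \<Omega>" "bounded \<Omega>"
  obtains C where "C > 0" "\<And>u. u \<in> V \<Omega> \<Longrightarrow> norm u \<le> C * normV \<Omega> u"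
proof -
  obtain B where B: "B > 0" "\<And>x. x \<in> \<Omega> \<Longrightarrow> norm x \<le> B"
    using assms(2) by (auto simp: bounded_pos)
  obtain i :: 'a where i: "i \<in> Basis" using SOME_Basis by blast
  have H10: "norm u \<le> 2 * B * norm (wpd \<Omega> i u)" if u: "u \<in> H10 \<Omega>" for u
  proof -
    obtain \<psi> where \<psi>: "\<And>n. \<psi> n \<in> test_functions \<Omega>" "(\<lambda>n. toL2 (\<psi> n)) \<longlonglongrightarrow> u"
      "\<And>i. i \<in> Basis \<Longrightarrow> (\<lambda>n. toL2 (pd i (\<psi> n))) \<longlonglongrightarrow> wpd \<Omega> i u"
      using u unfolding H10_iff_approximable[OF assms(1)] by metis
    show ?thesis
    proof (rule LIMSEQ_le)
      show "(\<lambda>n. norm (toL2 (\<psi> n))) \<longlonglongrightarrow> norm u" by (intro tendsto_intros \<psi>)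
      show "(\<lambda>n. 2 * B * norm (toL2 (pd i (\<psi> n)))) \<longlonglongrightarrow> 2 * B * norm (wpd \<Omega> i u)"
        by (intro tendsto_intros \<psi> i)
      show "\<exists>N. \<forall>n\<ge>N. norm (toL2 (\<psi> n)) \<le> 2 * B * norm (toL2 (pd i (\<psi> n)))"
        using Poincare_test_function[OF \<psi>(1) i B(2)] by blast
    qed
  qed
  have "norm u \<le> (2 * B)\<^sup>2 * normV \<Omega> u" if u: "u \<in> V \<Omega>" for u
  proof (cases "u = 0")
    case False
    have "(norm (wpd \<Omega> i u))\<^sup>2 \<le> grad_inner \<Omega> u u"
      unfolding grad_inner_def dot_square_norm using i by (intro member_le_sum) auto
    also have "\<dots> = - (u \<bullet> laplacian \<Omega> u)"
      using Green_identity[OF assms(1) u] u V_subset_H10 by blast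
    also have "\<dots> \<le> norm u * normV \<Omega> u"
      unfolding normV_def using Cauchy_Schwarz_ineq2[of u "laplacian \<Omega> u"] by linarith
    finally have le: "(norm (wpd \<Omega> i u))\<^sup>2 \<le> norm u * normV \<Omega> u" .
    have "(norm u)\<^sup>2 \<le> (2 * B * norm (wpd \<Omega> i u))\<^sup>2"
      using H10[of u] u V_subset_H10 by (intro power_mono) auto
    also have "\<dots> \<le> (2 * B)\<^sup>2 * (norm u * normV \<Omega> u)"
      unfolding power_mult_distrib[of "2 * B"] by (intro mult_left_mono le) auto
    finally have "norm u * norm u \<le> norm u * ((2 * B)\<^sup>2 * normV \<Omega> u)"
      by (simp add: power2_eq_square mult_ac)
    then show ?thesis by (rule mult_left_le_imp_le) (use False in simp)
  qed (simp add: normV_def)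
  moreover have "0 < (2 * B)\<^sup>2" using B(1) by (intro zero_less_power) linarith
  ultimately show ?thesis using that by blast
qed

section \<open>Weak derivatives in time\<close>

lemma smooth_step_has_real_derivative:
  assumes "c > 0"
  shows "(smooth_step c has_real_derivative flat_exp c (flat_step c 1) y) (at y)"
    and "0 \<le> flat_exp c (flat_step c 1) y"
    and "continuous_on S (flat_exp c (flat_step c 1))"
proof -
  show "(smooth_step c has_real_derivative flat_exp c (flat_step c 1) y) (at y)"
    unfolding smooth_step_def by (rule has_real_derivative_flat_exp[OF assms])
  show "0 \<le> flat_exp c (flat_step c 1) y"
    using assms by (simp add: flat_exp_def flat_step_def)
  show "continuous_on S (flat_exp c (flat_step c 1))"
    using has_real_derivative_flat_exp[OF assms]
    by (meson DERIV_continuous_on has_field_derivative_at_within)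
qed

text \<open>The derivatives of the bumps tend to the difference of the Dirac masses at s and t.
  Their total variation is at most 2, so uniform approximation reduces \<open>g\<close> to a
  polynomial, for which integration by parts moves the derivative away from the bump.\<close>

lemma integral_times_deriv_box_bump_tendsto:
  fixes g :: "real \<Rightarrow> real"
  assumes st: "s < t" and g: "continuous_on {s..t} g"
  shows "(\<lambda>n. integral {s..t} (\<lambda>x. g x * deriv (box_bump s t n) x)) \<longlonglongrightarrow> g s - g t"
    and "continuous_on A (deriv (box_bump s t n))"
proof -
  define c where "c n = inverse (real (Suc n))" for n
  have c: "c n > 0" for n by (simp add: c_def)
  define e where "e n = smooth_step (c n)" for n
  define e' where "e' n = flat_exp (c n) (flat_step (c n) 1)" for n
  have e_der: "(e n has_real_derivative e' n y) (at y)" and e'_nonneg: "0 \<le> e' n y"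
    and e'_cont: "continuous_on S (e' n)" for n y S
    using smooth_step_has_real_derivative[OF c] by (simp_all add: e_def e'_def)
  have e_cont: "continuous_on S (e n)" for n S
    using e_der by (meson DERIV_continuous_on has_field_derivative_at_within)
  have e_bounds: "0 \<le> e n y" "e n y \<le> 1" for n y
    using smooth_step_bounds[OF c] by (auto simp: e_def)
  have e_0: "e n y = 0" if "y \<le> 0" for n y
    using that by (simp add: e_def smooth_step_eq)
  define \<psi> where "\<psi> n = box_bump s t n" for n
  have \<psi>: "\<psi> n x = e n (x - s) * e n (t - x)" for n x
    by (simp add: \<psi>_def box_bump_def e_def c_def Basis_real_def)
  define \<psi>' where "\<psi>' n x = e' n (x - s) * e n (t - x) - e n (x - s) * e' n (t - x)" for n x
  have left: "((\<lambda>x. e n (x - s)) has_real_derivative e' n (x - s)) (at x within A)" for n x A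
  proof -
    have "((\<lambda>x. x - s) has_real_derivative 1) (at x within A)"
      by (auto intro!: derivative_eq_intros)
    from DERIV_chain2[OF e_der this] show ?thesis by simp
  qed
  have right: "((\<lambda>x. e n (t - x)) has_real_derivative - e' n (t - x)) (at x within A)" for n x A
  proof -
    have "((\<lambda>x. t - x) has_real_derivative -1) (at x within A)"
      by (auto intro!: derivative_eq_intros)
    from DERIV_chain2[OF e_der this] show ?thesis by simp
  qed
  have \<psi>_der: "(\<psi> n has_real_derivative \<psi>' n x) (at x)" for n x
    using DERIV_mult[OF left[of n x UNIV] right[of n x UNIV]] unfolding \<psi>[abs_def] \<psi>'_def
    by (simp add: mult.commute)
  have \<psi>_cont: "continuous_on S (\<psi> n)" for n S
    by (rule DERIV_continuous_on[OF has_field_derivative_at_within[OF \<psi>_der]])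
  have deriv: "deriv (\<psi> n) = \<psi>' n" for n using \<psi>_der by (auto intro: DERIV_imp_deriv)
  have \<psi>'_cont: "continuous_on S (\<psi>' n)" for n S
    unfolding \<psi>'_def
    by (intro continuous_intros continuous_on_compose2[OF e_cont[where S=UNIV]]
        continuous_on_compose2[OF e'_cont[where S=UNIV]]) auto
  show "continuous_on A (deriv (box_bump s t n))"
    using \<psi>'_cont deriv[of n] by (simp add: \<psi>_def)
  \<comment> \<open>Each of the two edges of the bump contributes \<open>e n (t - s)\<close>, which
    is at most 1; this is the uniform bound on the variation.\<close>
  have int_e': "((\<lambda>x. e' n (x - s) + e' n (t - x)) has_integral 2 * e n (t - s)) {s..t}" for n
  proof -
    have "((\<lambda>x. e n (x - s) - e n (t - x)) has_vector_derivative e' n (x - s) + e' n (t - x)) (at x within {s..t})" for x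
      using DERIV_diff[OF left[of n x "{s..t}"] right[of n x "{s..t}"]]
      by (simp add: has_real_derivative_iff_has_vector_derivative)
    from fundamental_theorem_of_calculus[OF _ this] st show ?thesis
      by (simp add: e_0)
  qed
  have \<psi>'_le: "\<bar>\<psi>' n x\<bar> \<le> e' n (x - s) + e' n (t - x)" for n x
  proof -
    have "\<bar>\<psi>' n x\<bar> \<le> \<bar>e' n (x - s) * e n (t - x)\<bar> + \<bar>e n (x - s) * e' n (t - x)\<bar>"
      unfolding \<psi>'_def by (rule abs_triangle_ineq4)
    also have "\<dots> \<le> e' n (x - s) + e' n (t - x)"
      using e_bounds e'_nonneg by (intro add_mono) (auto simp: abs_mult mult_left_le mult_right_le_one_le mult_left_le_one_le)
    finally show ?thesis .
  qed
  have small: "\<bar>integral {s..t} (\<lambda>x. k x * \<psi>' n x)\<bar> \<le> 2 * \<delta>"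
    if k: "continuous_on {s..t} k" "\<And>x. x \<in> {s..t} \<Longrightarrow> \<bar>k x\<bar> \<le> \<delta>" for k \<delta> n
  proof -
    have "\<delta> \<ge> 0" using k(2)[of s] st by auto
    have "norm (integral {s..t} (\<lambda>x. k x * \<psi>' n x)) \<le> integral {s..t} (\<lambda>x. \<delta> * (e' n (x - s) + e' n (t - x)))"
    proof (rule integral_norm_bound_integral)
      show "(\<lambda>x. k x * \<psi>' n x) integrable_on {s..t}"
        by (intro integrable_continuous_real continuous_intros k \<psi>'_cont)
      show "(\<lambda>x. \<delta> * (e' n (x - s) + e' n (t - x))) integrable_on {s..t}"
        using int_e'[of n] by (intro integrable_on_mult_right) blast
      show "norm (k x * \<psi>' n x) \<le> \<delta> * (e' n (x - s) + e' n (t - x))" if "x \<in> {s..t}" for x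
        using k(2)[OF that] \<psi>'_le[of n x] \<open>\<delta> \<ge> 0\<close> by (simp add: abs_mult mult_mono)
    qed
    also have "\<dots> = \<delta> * (2 * e n (t - s))"
      using int_e'[of n] by (simp add: integral_unique)
    also have "\<dots> \<le> \<delta> * (2 * 1)"
      using e_bounds \<open>\<delta> \<ge> 0\<close> by (intro mult_left_mono) auto
    finally show ?thesis by simp
  qed
  have poly: "(\<lambda>n. integral {s..t} (\<lambda>x. p x * \<psi>' n x)) \<longlonglongrightarrow> p s - p t"
    if p: "\<And>x. (p has_real_derivative p' x) (at x)" "continuous_on {s..t} p'" for p p'
  proof -
    have p_cont: "continuous_on S p" for S
      using p(1) by (meson DERIV_continuous_on has_field_derivative_at_within)
    have "integral {s..t} (\<lambda>x. p x * \<psi>' n x) = - integral {s..t} (\<lambda>x. p' x * \<psi> n x)" for n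
    proof -
      have "((\<lambda>x. p' x * \<psi> n x + p x * \<psi>' n x) has_integral (p t * \<psi> n t - p s * \<psi> n s)) {s..t}"
      proof (rule fundamental_theorem_of_calculus)
        fix x assume "x \<in> {s..t}"
        have "((\<lambda>x. p x * \<psi> n x) has_real_derivative p' x * \<psi> n x + p x * \<psi>' n x) (at x)"
          using DERIV_mult[OF p(1) \<psi>_der, of n x] by (simp add: mult.commute add.commute)
        then show "((\<lambda>x. p x * \<psi> n x) has_vector_derivative p' x * \<psi> n x + p x * \<psi>' n x) (at x within {s..t})"
          by (simp add: has_real_derivative_iff_has_vector_derivative has_vector_derivative_at_within)
      qed (use st in auto)
      moreover have "(\<lambda>x. p' x * \<psi> n x) integrable_on {s..t}" "(\<lambda>x. p x * \<psi>' n x) integrable_on {s..t}"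
        by (intro integrable_continuous_real continuous_intros p p_cont \<psi>_cont \<psi>'_cont)+
      ultimately have "integral {s..t} (\<lambda>x. p' x * \<psi> n x) + integral {s..t} (\<lambda>x. p x * \<psi>' n x) = 0"
        by (simp add: integral_add[symmetric] integral_unique \<psi> e_0)
      then show ?thesis by simp
    qed
    moreover have "(\<lambda>n. integral {s..t} (\<lambda>x. p' x * \<psi> n x)) \<longlonglongrightarrow> integral {s..t} (\<lambda>x. p' x * indicator {s<..<t} x)"
    proof (rule dominated_convergence(2))
      show "(\<lambda>x. p' x * \<psi> n x) integrable_on {s..t}" for n
        by (intro integrable_continuous_real continuous_intros p \<psi>_cont)
      show "(\<lambda>x. \<bar>p' x\<bar>) integrable_on {s..t}"
        by (intro integrable_continuous_real continuous_intros p)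
      show "norm (p' x * \<psi> n x) \<le> \<bar>p' x\<bar>" for n x
        using box_bump_bounds[of s t n x] by (simp add: abs_mult \<psi>_def mult_left_le)
      show "(\<lambda>n. p' x * \<psi> n x) \<longlonglongrightarrow> p' x * indicator {s<..<t} x" for x
        using box_bump_tendsto[of s t x] unfolding \<psi>_def by (intro tendsto_intros) (simp add: box_real)
    qed
    moreover have "integral {s..t} (\<lambda>x. p' x * indicator {s<..<t} x) = integral {s..t} p'"
      by (rule integral_spike[of "{s, t}"]) (auto simp: indicator_def)
    moreover have "integral {s..t} p' = p t - p s"
    proof (rule integral_unique, rule fundamental_theorem_of_calculus)
      show "(p has_vector_derivative p' x) (at x within {s..t})" for x
        using p(1)[of x] by (simp add: has_real_derivative_iff_has_vector_derivative has_vector_derivative_at_within)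
    qed (use st in auto)
    ultimately show ?thesis
      using tendsto_minus[of "\<lambda>n. integral {s..t} (\<lambda>x. p' x * \<psi> n x)" "p t - p s"] by simp
  qed
  have "(\<lambda>n. integral {s..t} (\<lambda>x. g x * \<psi>' n x)) \<longlonglongrightarrow> g s - g t"
  proof (rule LIMSEQ_I)
    fix r :: real assume r: "r > 0"
    \<comment> \<open>Of the five shares of \<open>r\<close>, two pay for the integral of g - p, one
      for the convergence with p, and one for each end point.\<close>
    obtain p where p: "real_polynomial_function p" "\<And>x. x \<in> {s..t} \<Longrightarrow> \<bar>g x - p x\<bar> < r / 5"
      using Stone_Weierstrass_real_polynomial_function[of "{s..t}" g "r / 5"] g r by auto
    obtain p' where p': "real_polynomial_function p'" "\<And>x. (p has_real_derivative p' x) (at x)"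
      using has_real_derivative_polynomial_function[OF p(1)] by blast
    have conts: "continuous_on S p" "continuous_on S p'" for S
      using p(1) p'(1) continuous_on_polymonial_function real_polynomial_function_eq by blast+
    obtain N where N: "\<And>n. n \<ge> N \<Longrightarrow> \<bar>integral {s..t} (\<lambda>x. p x * \<psi>' n x) - (p s - p t)\<bar> < r / 5"
      using LIMSEQ_D[OF poly[OF p'(2) conts(2)], of "r / 5"] r by auto
    have "norm (integral {s..t} (\<lambda>x. g x * \<psi>' n x) - (g s - g t)) < r" if "n \<ge> N" for n
    proof -
      have "integral {s..t} (\<lambda>x. (g x - p x) * \<psi>' n x)
          = integral {s..t} (\<lambda>x. g x * \<psi>' n x) - integral {s..t} (\<lambda>x. p x * \<psi>' n x)"
        by (simp add: left_diff_distrib, intro integral_diff integrable_continuous_real continuous_intros g conts \<psi>'_cont)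
      moreover have "\<bar>integral {s..t} (\<lambda>x. (g x - p x) * \<psi>' n x)\<bar> \<le> 2 * (r / 5)"
      proof (rule small)
        show "\<bar>g x - p x\<bar> \<le> r / 5" if "x \<in> {s..t}" for x
          using p(2)[OF that] by simp
      qed (intro continuous_intros g conts)
      moreover have "\<bar>g s - p s\<bar> < r / 5" "\<bar>g t - p t\<bar> < r / 5"
        using p(2) st by simp_all
      ultimately show ?thesis
        using N[OF that] unfolding real_norm_def by linarith
    qed
    then show "\<exists>N. \<forall>n\<ge>N. norm (integral {s..t} (\<lambda>x. g x * \<psi>' n x) - (g s - g t)) < r"
      by blast
  qed
  then show "(\<lambda>n. integral {s..t} (\<lambda>x. g x * deriv (box_bump s t n) x)) \<longlonglongrightarrow> g s - g t"
    using deriv by (simp add: \<psi>_def)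
qed

text \<open>Bumps on [s, t] serve as test functions: one side of the distributional identity tends
  to g s - g t, the other by dominated convergence to minus the integral of g'. The strict
  inequalities keep the supports compact inside (a, b).\<close>

lemma distr_deriv_open_interval:
  assumes "distr_deriv a b g g'" and st: "a < s" "s < t" "t < b"
    and g: "continuous_on {s..t} g" and g': "g' absolutely_integrable_on {s..t}"
  shows "(g' has_integral (g t - g s)) {s..t}"
proof -
  define \<psi> where "\<psi> n = box_bump s t n" for n
  have \<psi>: "\<psi> n \<in> test_functions {a<..<b}" for n
    unfolding \<psi>_def using st by (intro box_bump_test_function) auto
  have out: "\<psi> n x = 0" if "x \<notin> {s..t}" for n x
    unfolding \<psi>_def using that by (intro box_bump_outside) (auto simp: box_real)
  have der_out: "deriv (\<psi> n) x = 0" if "x \<notin> {s..t}" for n x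
  proof -
    have "(\<psi> n has_real_derivative 0) (at x)"
      by (rule has_field_derivative_transform_within_open[of "\<lambda>x. 0" 0 x "- {s..t}"])
        (use that out in auto)
    then show ?thesis by (rule DERIV_imp_deriv)
  qed
  have b_meas: "\<psi> n \<in> borel_measurable (lebesgue_on {s..t})" for n
    unfolding \<psi>_def
    by (intro continuous_imp_measurable_on_sets_lebesgue
        continuous_on_subset[OF smooth_on_continuous[OF smooth_on_box_bump]]) auto
  have int: "(\<lambda>x. \<psi> n x * g' x) absolutely_integrable_on {s..t}" for n
  proof (rule absolutely_integrable_bounded_measurable_product_real[OF b_meas _ _ g'])
    show "bounded (\<psi> n ` {s..t})"
      using box_bump_bounds[of s t n] by (intro boundedI[of _ 1]) (auto simp: \<psi>_def)
  qed simp
  have "integral {s..t} (\<lambda>x. g x * deriv (\<psi> n) x) = - integral {s..t} (\<lambda>x. \<psi> n x * g' x)" for n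
  proof -
    have "(\<lambda>x. g x * deriv (\<psi> n) x) absolutely_integrable_on {s..t}"
      unfolding \<psi>_def
      by (intro absolutely_integrable_continuous_real continuous_intros g
          integral_times_deriv_box_bump_tendsto(2)[OF st(2) g])
    then have "integral {s..t} (\<lambda>x. g x * deriv (\<psi> n) x) = (LINT x:{s..t}|lebesgue. g x * deriv (\<psi> n) x)"
      by (simp add: set_lebesgue_integral_eq_integral)
    also have "\<dots> = (LINT x|lebesgue. g x * deriv (\<psi> n) x)"
      unfolding set_lebesgue_integral_def
      by (rule Bochner_Integration.integral_cong) (use der_out in \<open>auto simp: indicator_def\<close>)
    also have "\<dots> = - (LINT x|lebesgue. g' x * \<psi> n x)"
      using assms(1) \<psi> by (simp add: distr_deriv_def)
    also have "(LINT x|lebesgue. g' x * \<psi> n x) = (LINT x:{s..t}|lebesgue. \<psi> n x * g' x)"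
      unfolding set_lebesgue_integral_def
      by (rule Bochner_Integration.integral_cong) (use out in \<open>auto simp: indicator_def\<close>)
    also have "\<dots> = integral {s..t} (\<lambda>x. \<psi> n x * g' x)"
      using int by (simp add: set_lebesgue_integral_eq_integral)
    finally show ?thesis .
  qed
  moreover have "(\<lambda>n. integral {s..t} (\<lambda>x. \<psi> n x * g' x)) \<longlonglongrightarrow> integral {s..t} (\<lambda>x. indicator {s<..<t} x * g' x)"
  proof (rule dominated_convergence(2))
    show "(\<lambda>x. \<psi> n x * g' x) integrable_on {s..t}" for n
      using int by (simp add: absolutely_integrable_on_def)
    show "(\<lambda>x. \<bar>g' x\<bar>) integrable_on {s..t}"
      using g' by (simp add: absolutely_integrable_on_def)
    show "norm (\<psi> n x * g' x) \<le> \<bar>g' x\<bar>" for n x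
      using box_bump_bounds[of s t n x] by (simp add: abs_mult \<psi>_def mult_left_le_one_le)
    show "(\<lambda>n. \<psi> n x * g' x) \<longlonglongrightarrow> indicator {s<..<t} x * g' x" for x
      using box_bump_tendsto[of s t x] unfolding \<psi>_def by (intro tendsto_intros) (simp add: box_real)
  qed
  moreover have "integral {s..t} (\<lambda>x. indicator {s<..<t} x * g' x) = integral {s..t} g'"
    by (rule integral_spike[of "{s, t}"]) (auto simp: indicator_def)
  ultimately have "(\<lambda>n. integral {s..t} (\<lambda>x. g x * deriv (\<psi> n) x)) \<longlonglongrightarrow> - integral {s..t} g'"
    by (simp add: tendsto_minus)
  then have "g s - g t = - integral {s..t} g'"
    using integral_times_deriv_box_bump_tendsto(1)[OF st(2) g] LIMSEQ_unique
    unfolding \<psi>_def by blast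
  then show ?thesis
    using g' by (simp add: absolutely_integrable_on_def has_integral_iff)
qed

text \<open>The du Bois-Reymond argument: by the interior case \<open>g\<close> minus the indefinite
  integral of \<open>g'\<close> is constant on the open interval, hence by continuity on the closed
  one, which brings in the end points.\<close>

theorem distr_deriv_has_integral:
  assumes D: "distr_deriv a b g g'" and ab: "a < b"
    and g: "continuous_on {a..b} g" and g': "g' absolutely_integrable_on {a..b}"
    and st: "a \<le> s" "s \<le> t" "t \<le> b"
  shows "(g' has_integral (g t - g s)) {s..t}"
proof -
  have int: "g' integrable_on {a..b}" using g' by (simp add: absolutely_integrable_on_def)
  have int': "g' integrable_on {c..d}" if "a \<le> c" "d \<le> b" for c d
    using integrable_on_subinterval[OF int, of c d] that by auto
  define \<Phi> where "\<Phi> x = g x - integral {a..x} g'" for x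
  have cont: "continuous_on {a..b} \<Phi>"
    unfolding \<Phi>_def by (intro continuous_intros g indefinite_integral_continuous_1 int)
  have comb: "integral {a..y} g' - integral {a..x} g' = integral {x..y} g'" if "a \<le> x" "x \<le> y" "y \<le> b" for x y
    using Henstock_Kurzweil_Integration.integral_combine[of a x y g'] that int'[of a y] by simp
  define m where "m = (a + b) / 2"
  have m: "a < m" "m < b" using ab by (auto simp: m_def)
  have le: "\<Phi> x = \<Phi> y" if "a < x" "x < y" "y < b" for x y
  proof -
    have "(g' has_integral (g y - g x)) {x..y}"
      by (rule distr_deriv_open_interval[OF D that])
        (use that in \<open>auto intro: continuous_on_subset[OF g] absolutely_integrable_on_subinterval[OF g']\<close>)
    then show ?thesis using comb[of x y] that by (simp add: \<Phi>_def integral_unique)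
  qed
  have eq: "\<Phi> x = \<Phi> m" if "x \<in> {a<..<b}" for x
  proof (cases x m rule: linorder_cases)
    case less
    then show ?thesis using le[of x m] that m by simp
  next
    case greater
    then show ?thesis using le[of m x] that m by simp
  qed simp
  have eq': "\<Phi> x = \<Phi> m" if "x \<in> {a..b}" for x
  proof -
    have "x \<in> closure {a<..<b}" using that ab by simp
    then show ?thesis
      using continuous_constant_on_closure[of "{a<..<b}" \<Phi> "\<Phi> m" x] cont ab eq by simp
  qed
  have "g t - g s = integral {s..t} g'"
    using eq'[of s] eq'[of t] comb[of s t] st by (simp add: \<Phi>_def)
  then show ?thesis using int'[of s t] st by (simp add: has_integral_iff)
qed

text \<open>The scalar identities become a norm estimate by testing with the first-order remainder
  itself. It is admissible because \<open>w\<close> and \<open>w'\<close> take values in the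
  subspace \<open>S\<close> from which the test vectors come.\<close>

lemma weak_derivative_has_vector_derivative:
  fixes w w' :: "real \<Rightarrow> 'a::real_inner"
  assumes ab: "a < b" and S: "subspace S" "\<And>t. t \<in> {a..b} \<Longrightarrow> w t \<in> S" "\<And>t. t \<in> {a..b} \<Longrightarrow> w' t \<in> S"
    and cont: "continuous_on {a..b} w" "continuous_on {a..b} w'"
    and D: "\<And>\<phi>. \<phi> \<in> S \<Longrightarrow> distr_deriv a b (\<lambda>t. w t \<bullet> \<phi>) (\<lambda>t. w' t \<bullet> \<phi>)"
    and t: "t \<in> {a..b}"
  shows "(w has_vector_derivative w' t) (at t within {a..b})"
proof -
  have int: "((\<lambda>x. w' x \<bullet> \<phi>) has_integral (w y - w x) \<bullet> \<phi>) {x..y}"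
    if "\<phi> \<in> S" "a \<le> x" "x \<le> y" "y \<le> b" for \<phi> x y
  proof -
    have "((\<lambda>x. w' x \<bullet> \<phi>) has_integral (w y \<bullet> \<phi> - w x \<bullet> \<phi>)) {x..y}"
      by (rule distr_deriv_has_integral[OF D[OF that(1)] ab _ _ that(2-4)])
        (intro continuous_intros absolutely_integrable_continuous_real cont)+
    then show ?thesis by (simp add: inner_diff_left)
  qed
  have bound: "norm (w y - w x - (y - x) *\<^sub>R w' t) \<le> e * (y - x)"
    if xy: "a \<le> x" "x \<le> y" "y \<le> b" and e: "\<And>z. z \<in> {x..y} \<Longrightarrow> norm (w' z - w' t) \<le> e" for x y e
  proof -
    \<comment> \<open>|z|^2 is the integral of (w' - w' t, z) over [x, y]; one factor |z| then
      cancels.\<close>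
    define z where "z = w y - w x - (y - x) *\<^sub>R w' t"
    have z: "z \<in> S"
      unfolding z_def using S xy t by (intro subspace_diff subspace_scale) auto
    have "((\<lambda>r. w' r \<bullet> z - w' t \<bullet> z) has_integral ((w y - w x) \<bullet> z - (y - x) * (w' t \<bullet> z))) {x..y}"
      using int[OF z xy] has_integral_const_real[of "w' t \<bullet> z" x y] xy(2)
      by (intro has_integral_diff) auto
    moreover have "(w y - w x) \<bullet> z - (y - x) * (w' t \<bullet> z) = (norm z)\<^sup>2"
      by (simp add: z_def power2_norm_eq_inner inner_diff_left)
    ultimately have "((\<lambda>r. (w' r - w' t) \<bullet> z) has_integral (norm z)\<^sup>2) {x..y}"
      by (simp add: inner_diff_left)
    moreover have "((\<lambda>r. e * norm z) has_integral (y - x) * (e * norm z)) {x..y}"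
      using has_integral_const_real[of "e * norm z" x y] xy(2) by simp
    ultimately have "(norm z)\<^sup>2 \<le> (y - x) * (e * norm z)"
    proof (rule has_integral_le)
      fix r assume "r \<in> {x..y}"
      have "(w' r - w' t) \<bullet> z \<le> norm (w' r - w' t) * norm z" by (rule norm_cauchy_schwarz)
      also have "\<dots> \<le> e * norm z" using e[OF \<open>r \<in> {x..y}\<close>] by (intro mult_right_mono) auto
      finally show "(w' r - w' t) \<bullet> z \<le> e * norm z" .
    qed
    then have "norm z * norm z \<le> norm z * (e * (y - x))"
      by (simp add: power2_eq_square mult_ac)
    moreover have "0 \<le> e * (y - x)"
      using e[of x] xy by (intro mult_nonneg_nonneg) (auto intro: order_trans[OF norm_ge_zero])
    ultimately have "norm z \<le> e * (y - x)"
      by (cases "norm z = 0") (auto dest!: mult_left_le_imp_le simp: less_le)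
    then show ?thesis by (simp add: z_def)
  qed
  show ?thesis
    unfolding has_vector_derivative_def has_derivative_within_alt
  proof (intro conjI allI impI)
    show "bounded_linear (\<lambda>h. h *\<^sub>R w' t)" by (rule bounded_linear_scaleR_left)
    fix e :: real assume "e > 0"
    then obtain d where d: "d > 0" "\<And>z. z \<in> {a..b} \<Longrightarrow> dist z t < d \<Longrightarrow> dist (w' z) (w' t) < e"
      using cont(2) t unfolding continuous_on_iff by metis
    have "norm (w y - w t - (y - t) *\<^sub>R w' t) \<le> e * norm (y - t)" if y: "y \<in> {a..b}" "norm (y - t) < d" for y
    proof (cases "t \<le> y")
      case True
      have "norm (w y - w t - (y - t) *\<^sub>R w' t) \<le> e * (y - t)"
      proof (rule bound)
        show "norm (w' z - w' t) \<le> e" if "z \<in> {t..y}" for z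
          using d(2)[of z] that y t by (auto simp: dist_norm less_imp_le)
      qed (use y t True in auto)
      then show ?thesis using True by simp
    next
      case False
      have "norm (w t - w y - (t - y) *\<^sub>R w' t) \<le> e * (t - y)"
      proof (rule bound)
        show "norm (w' z - w' t) \<le> e" if "z \<in> {y..t}" for z
          using d(2)[of z] that y t by (auto simp: dist_norm less_imp_le)
      qed (use y t False in auto)
      moreover have "w t - w y - (t - y) *\<^sub>R w' t = - (w y - w t - (y - t) *\<^sub>R w' t)"
        by (simp add: scaleR_diff_left)
      ultimately show ?thesis using False by (simp only: norm_minus_cancel) simp
    qed
    then show "\<exists>d>0. \<forall>y\<in>{a..b}. norm (y - t) < d \<longrightarrow> norm (w y - w t - (y - t) *\<^sub>R w' t) \<le> e * norm (y - t)"
      using d(1) by blast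
  qed
qed

section \<open>The energy inequality\<close>

lemma has_vector_derivative_quotient_tendsto:
  fixes f :: "real \<Rightarrow> 'a::real_normed_vector"
  assumes "(f has_vector_derivative f') (at t within S)"
  shows "((\<lambda>y. (1 / (y - t)) *\<^sub>R (f y - f t)) \<longlongrightarrow> f') (at t within S)"
proof -
  have "((\<lambda>y. norm (f y - f t - (y - t) *\<^sub>R f') / norm (y - t)) \<longlongrightarrow> 0) (at t within S)"
    using assms by (simp add: has_vector_derivative_def has_derivative_iff_norm)
  moreover have "norm (f y - f t - (y - t) *\<^sub>R f') / norm (y - t) = norm ((1 / (y - t)) *\<^sub>R (f y - f t) - f')"
    if "y \<noteq> t" for y
  proof -
    have "(1 / (y - t)) *\<^sub>R (f y - f t) - f' = (1 / (y - t)) *\<^sub>R (f y - f t - (y - t) *\<^sub>R f')"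
      using that by (simp add: scaleR_diff_right)
    then show ?thesis by (simp only: norm_scaleR) (simp add: abs_divide)
  qed
  ultimately have "((\<lambda>y. norm ((1 / (y - t)) *\<^sub>R (f y - f t) - f')) \<longlongrightarrow> 0) (at t within S)"
    using Lim_transform_eventually by (smt (verit) eventually_at_filter eventuallyI)
  then show ?thesis by (simp add: tendsto_norm_zero_iff LIM_zero_iff)
qed

lemma forward_quotient_tendsto:
  fixes f :: "real \<Rightarrow> 'a::real_normed_vector"
  assumes "(f has_vector_derivative f') (at t within {a..b})" "a \<le> t" "t < b"
    and "\<And>n::nat. 0 < e n" "\<And>n. t + e n \<le> b" "e \<longlonglongrightarrow> 0"
  shows "(\<lambda>n. (1 / e n) *\<^sub>R (f (t + e n) - f t)) \<longlonglongrightarrow> f'"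
proof -
  have "((\<lambda>y. (1 / (y - t)) *\<^sub>R (f y - f t)) \<longlongrightarrow> f') (at t within {a..b})"
    by (rule has_vector_derivative_quotient_tendsto[OF assms(1)])
  moreover have "filterlim (\<lambda>n. t + e n) (at t within {a..b}) sequentially"
    unfolding filterlim_at
  proof
    show "\<forall>\<^sub>F n in sequentially. t + e n \<in> {a..b} \<and> t + e n \<noteq> t"
      using assms(2,4,5) by (intro always_eventually) (auto simp: less_imp_le add_increasing2 less_imp_neq[symmetric])
    show "(\<lambda>n. t + e n) \<longlonglongrightarrow> t"
      using tendsto_add[OF tendsto_const assms(6), of t] by simp
  qed
  ultimately have "(\<lambda>n. (1 / (t + e n - t)) *\<^sub>R (f (t + e n) - f t)) \<longlonglongrightarrow> f'"
    by (rule filterlim_compose)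
  then show ?thesis by simp
qed

lemma forward_quotient_bound:
  fixes f :: "real \<Rightarrow> 'a::banach"
  assumes "\<And>x. x \<in> {a..b} \<Longrightarrow> (f has_vector_derivative f' x) (at x within {a..b})"
    and "\<And>x. x \<in> {a..b} \<Longrightarrow> norm (f' x) \<le> M" and "a \<le> t" "0 < e" "t + e \<le> b"
  shows "norm ((1 / e) *\<^sub>R (f (t + e) - f t)) \<le> M"
proof -
  have "(f' has_integral (f (t + e) - f t)) {t..t + e}"
    using assms(3-5)
    by (intro fundamental_theorem_of_calculus has_vector_derivative_within_subset[OF assms(1)]) auto
  moreover have "0 \<le> M" using assms(2)[of t] assms(3-5) by (auto intro: order_trans[OF norm_ge_zero])
  ultimately have "norm (f (t + e) - f t) \<le> M * measure lborel {t..t + e}"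
    using assms(2-5) by (intro has_integral_bound_real) auto
  then show ?thesis using assms(4) by (simp only: norm_scaleR) (simp add: field_simps)
qed

lemma has_vector_derivative_shift_diff:
  fixes f :: "real \<Rightarrow> 'a::real_normed_vector"
  assumes "\<And>x. x \<in> {a..b} \<Longrightarrow> (f has_vector_derivative f' x) (at x within {a..b})"
    and "0 \<le> e" "c + e \<le> b" "x \<in> {a..c}"
  shows "((\<lambda>t. f (t + e) - f t) has_vector_derivative f' (x + e) - f' x) (at x within {a..c})"
proof (rule has_vector_derivative_diff)
  show "(f has_vector_derivative f' x) (at x within {a..c})"
    using assms by (intro has_vector_derivative_within_subset[OF assms(1)]) auto
  have "((\<lambda>t. t + e) has_vector_derivative 1) (at x within {a..c})"
    by (auto intro!: derivative_eq_intros)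
  moreover have "(f has_vector_derivative f' (x + e)) (at (x + e) within (\<lambda>t. t + e) ` {a..c})"
    using assms by (intro has_vector_derivative_within_subset[OF assms(1)]) auto
  ultimately have "((f \<circ> (\<lambda>t. t + e)) has_vector_derivative 1 *\<^sub>R f' (x + e)) (at x within {a..c})"
    by (rule vector_diff_chain_within)
  then show "((\<lambda>t. f (t + e)) has_vector_derivative f' (x + e)) (at x within {a..c})"
    by (simp add: o_def)
qed

text \<open>The last assumption is the plate equation integrated over \<open>[s, t]\<close>: \<open>(w t - w s) \<bullet> L \<phi>\<close> comes from
  the viscous term, and the increment of \<open>\<eta>\<close> together with \<open>\<parallel>\<phi>\<parallel>\<^sup>2\<close> bounds the forcing by Young's
  inequality. Tested over \<open>[t, t + e]\<close> with the difference quotient \<open>P t\<close> of \<open>w\<close>, it bounds the derivative of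
  \<open>\<parallel>P\<parallel>\<^sup>2 + \<parallel>A\<parallel>\<^sup>2\<close>, where \<open>A\<close> averages \<open>L w\<close> over \<open>[t, t + e]\<close>; the viscous term has a favourable sign.\<close>

locale integrated_plate_equation =
  fixes S :: "'a::{real_inner, banach} set" and L :: "'a \<Rightarrow> 'a" and a b :: real
    and w w' k :: "real \<Rightarrow> 'a" and \<eta> :: "real \<Rightarrow> real"
  assumes S: "subspace S" and w: "\<And>t. t \<in> {a..b} \<Longrightarrow> w t \<in> S"
    and L_diff: "\<And>\<phi> \<psi>. \<phi> \<in> S \<Longrightarrow> \<psi> \<in> S \<Longrightarrow> L (\<phi> - \<psi>) = L \<phi> - L \<psi>"
    and L_scale: "\<And>\<phi> c. \<phi> \<in> S \<Longrightarrow> L (c *\<^sub>R \<phi>) = c *\<^sub>R L \<phi>"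
    and L_neg: "\<And>\<phi>. \<phi> \<in> S \<Longrightarrow> \<phi> \<bullet> L \<phi> \<le> 0"
    and der: "\<And>t. t \<in> {a..b} \<Longrightarrow> (w has_vector_derivative w' t) (at t within {a..b})"
    and cont: "continuous_on {a..b} w'" "continuous_on {a..b} (\<lambda>t. L (w t))" "continuous_on {a..b} k"
      "continuous_on {a..b} \<eta>"
    and ineq: "\<And>\<phi> s t. \<phi> \<in> S \<Longrightarrow> a \<le> s \<Longrightarrow> s \<le> t \<Longrightarrow> t \<le> b \<Longrightarrow>
      (w' t - w' s) \<bullet> \<phi> - (w t - w s) \<bullet> L \<phi> + integral {s..t} (\<lambda>\<sigma>. L (w \<sigma>) \<bullet> L \<phi> + k \<sigma> \<bullet> \<phi>)
        \<le> (t - s) / 2 * (norm \<phi>)\<^sup>2 + (\<eta> t - \<eta> s) / 2"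
begin

lemma averaged_energy_inequality:
  assumes e: "0 < e" "a \<le> c" "c + e \<le> b"
    and P_def: "P = (\<lambda>t. (1 / e) *\<^sub>R (w (t + e) - w t))"
    and A_def: "A = (\<lambda>t. (1 / e) *\<^sub>R (integral {a..t + e} (\<lambda>\<sigma>. L (w \<sigma>)) - integral {a..t} (\<lambda>\<sigma>. L (w \<sigma>))))"
    and K_def: "K = (\<lambda>t. (1 / e) *\<^sub>R (integral {a..t + e} k - integral {a..t} k))"
  shows "(norm (P c))\<^sup>2 + (norm (A c))\<^sup>2 - ((norm (P a))\<^sup>2 + (norm (A a))\<^sup>2)
    \<le> integral {a..c} (\<lambda>t. (norm (P t))\<^sup>2 - 2 * (K t \<bullet> P t)) +
      ((1 / e) * (integral {a..c + e} \<eta> - integral {a..c} \<eta>) - (1 / e) * (integral {a..a + e} \<eta>))"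
proof -
  note int_der = integral_has_vector_derivative
  have P_der: "(P has_vector_derivative (1 / e) *\<^sub>R (w' (t + e) - w' t)) (at t within {a..c})" if "t \<in> {a..c}" for t
    unfolding P_def using e that
    by (intro bounded_linear.has_vector_derivative[OF bounded_linear_scaleR_right]
        has_vector_derivative_shift_diff[OF der]) auto
  have A_der: "(A has_vector_derivative (1 / e) *\<^sub>R (L (w (t + e)) - L (w t))) (at t within {a..c})"
    if "t \<in> {a..c}" for t
    unfolding A_def using e that
    by (intro bounded_linear.has_vector_derivative[OF bounded_linear_scaleR_right]
        has_vector_derivative_shift_diff[OF int_der[OF cont(2)]]) auto
  have P_cont: "continuous_on {a..c} P"
    by (rule continuous_on_vector_derivative[OF P_der])
  have K_cont: "continuous_on {a..c} K"
  proof -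
    have "((\<lambda>t. integral {a..t + e} k - integral {a..t} k) has_vector_derivative k (t + e) - k t) (at t within {a..c})"
      if "t \<in> {a..c}" for t
      using e that by (intro has_vector_derivative_shift_diff[OF int_der[OF cont(3)]]) auto
    then show ?thesis
      unfolding K_def by (intro continuous_on_scaleR continuous_on_const continuous_on_vector_derivative)
  qed
  have P_in: "P t \<in> S" if "t \<in> {a..c}" for t
    unfolding P_def using e that by (intro subspace_scale[OF S] subspace_diff[OF S] w) auto
  have LP: "(1 / e) *\<^sub>R (L (w (t + e)) - L (w t)) = L (P t)" if "t \<in> {a..c}" for t
    unfolding P_def using e that by (simp add: L_scale L_diff w subspace_diff[OF S])
  \<comment> \<open>The derivative of \<open>A\<close> is \<open>L (P t)\<close>, so
    \<open>E'\<close> consists of exactly the two terms that the equation over [t, t + e], tested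
    with \<open>P t\<close>, controls.\<close>
  define E where "E t = (norm (P t))\<^sup>2 + (norm (A t))\<^sup>2" for t
  define E' where "E' t = 2 * (P t \<bullet> ((1 / e) *\<^sub>R (w' (t + e) - w' t)) + A t \<bullet> L (P t))" for t
  define D where "D t = (norm (P t))\<^sup>2 - 2 * (K t \<bullet> P t) + (1 / e) * (\<eta> (t + e) - \<eta> t)" for t
  have E_der: "(E has_vector_derivative E' t) (at t within {a..c})" if "t \<in> {a..c}" for t
  proof -
    have "((\<lambda>t. P t \<bullet> P t + A t \<bullet> A t) has_vector_derivative E' t) (at t within {a..c})"
      unfolding E'_def LP[OF that, symmetric]
      using bounded_bilinear.has_vector_derivative[OF bounded_bilinear_inner P_der P_der, OF that that]
        bounded_bilinear.has_vector_derivative[OF bounded_bilinear_inner A_der A_der, OF that that]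
      by (auto dest: has_vector_derivative_add simp: inner_commute algebra_simps)
    then show ?thesis unfolding E_def power2_norm_eq_inner .
  qed
  have E'_le: "E' t \<le> D t" if t: "t \<in> {a..c}" for t
  proof -
    define \<phi> where "\<phi> = P t"
    have t': "a \<le> t" "t \<le> t + e" "t + e \<le> b" using t e by auto
    have sub: "continuous_on {x..y} f" if "continuous_on {a..b} f" "a \<le> x" "y \<le> b" for f :: "real \<Rightarrow> 'a" and x y
      using that by (auto intro: continuous_on_subset)
    have comb: "integral {t..t + e} f = integral {a..t + e} f - integral {a..t} f"
      if "continuous_on {a..b} f" for f :: "real \<Rightarrow> 'a"
      using Henstock_Kurzweil_Integration.integral_combine[of a t "t + e" f]
        integrable_continuous_real[OF sub[OF that order_refl t'(3)]] t' by (simp add: algebra_simps)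
    have int: "integral {t..t + e} (\<lambda>\<sigma>. f \<sigma> \<bullet> y) = integral {t..t + e} f \<bullet> y"
      if "continuous_on {a..b} f" for f :: "real \<Rightarrow> 'a" and y
      using integral_linear[OF integrable_continuous_real[OF sub[OF that t'(1,3)]] bounded_linear_inner_left[of y]]
      by (simp add: o_def)
    have "integral {t..t + e} (\<lambda>\<sigma>. L (w \<sigma>) \<bullet> L \<phi> + k \<sigma> \<bullet> \<phi>)
        = integral {t..t + e} (\<lambda>\<sigma>. L (w \<sigma>)) \<bullet> L \<phi> + integral {t..t + e} k \<bullet> \<phi>"
      using t' unfolding int[OF cont(2), symmetric] int[OF cont(3), symmetric]
      by (intro integral_add integrable_continuous_real continuous_intros sub[OF cont(2)] sub[OF cont(3)]) auto
    also have "\<dots> = e * (A t \<bullet> L \<phi>) + e * (K t \<bullet> \<phi>)"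
      using e by (simp add: A_def K_def comb[OF cont(2)] comb[OF cont(3)])
    finally have I: "integral {t..t + e} (\<lambda>\<sigma>. L (w \<sigma>) \<bullet> L \<phi> + k \<sigma> \<bullet> \<phi>) = e * (A t \<bullet> L \<phi>) + e * (K t \<bullet> \<phi>)" .
    have "w (t + e) - w t = e *\<^sub>R \<phi>" using e by (simp add: \<phi>_def P_def)
    then have "(w' (t + e) - w' t) \<bullet> \<phi> - e * (\<phi> \<bullet> L \<phi>) + (e * (A t \<bullet> L \<phi>) + e * (K t \<bullet> \<phi>))
        \<le> e / 2 * (norm \<phi>)\<^sup>2 + (\<eta> (t + e) - \<eta> t) / 2"
      using ineq[OF P_in[OF t] t'] unfolding \<phi>_def[symmetric] I by simp
    moreover have "e * (\<phi> \<bullet> L \<phi>) \<le> 0"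
      using L_neg[OF P_in[OF t]] e by (simp add: \<phi>_def mult_nonneg_nonpos)
    ultimately have "(w' (t + e) - w' t) \<bullet> \<phi> + e * (A t \<bullet> L \<phi>)
        \<le> e / 2 * (norm \<phi>)\<^sup>2 - e * (K t \<bullet> \<phi>) + (\<eta> (t + e) - \<eta> t) / 2" by linarith
    then have "(2 / e) * ((w' (t + e) - w' t) \<bullet> \<phi> + e * (A t \<bullet> L \<phi>))
        \<le> (2 / e) * (e / 2 * (norm \<phi>)\<^sup>2 - e * (K t \<bullet> \<phi>) + (\<eta> (t + e) - \<eta> t) / 2)"
      using e by (intro mult_left_mono) auto
    then show ?thesis
      using e by (simp add: E'_def D_def \<phi>_def[symmetric] inner_commute[of \<phi>] algebra_simps add_divide_distrib diff_divide_distrib)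
  qed
  define N where "N t = integral {a..t} \<eta>" for t
  have N_der: "((\<lambda>t. N (t + e) - N t) has_vector_derivative \<eta> (t + e) - \<eta> t) (at t within {a..c})"
    if "t \<in> {a..c}" for t
    unfolding N_def using e that
    by (intro has_vector_derivative_shift_diff[OF int_der[OF cont(4)]]) auto
  have N_int: "((\<lambda>t. (1 / e) * (\<eta> (t + e) - \<eta> t)) has_integral
      (1 / e) * ((N (c + e) - N c) - (N (a + e) - N a))) {a..c}"
    by (intro has_integral_mult_right fundamental_theorem_of_calculus N_der e(2))
  have PK_int: "(\<lambda>t. (norm (P t))\<^sup>2 - 2 * (K t \<bullet> P t)) integrable_on {a..c}"
    by (intro integrable_continuous_real continuous_intros P_cont K_cont)
  have "(D has_integral (integral {a..c} (\<lambda>t. (norm (P t))\<^sup>2 - 2 * (K t \<bullet> P t)) +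
      (1 / e) * ((N (c + e) - N c) - (N (a + e) - N a)))) {a..c}"
    unfolding D_def by (intro has_integral_add integrable_integral PK_int N_int)
  moreover have "(E' has_integral (E c - E a)) {a..c}"
    by (intro fundamental_theorem_of_calculus E_der e(2))
  ultimately have "E c - E a \<le> integral {a..c} (\<lambda>t. (norm (P t))\<^sup>2 - 2 * (K t \<bullet> P t)) +
      (1 / e) * ((N (c + e) - N c) - (N (a + e) - N a))"
    using E'_le by (meson has_integral_le)
  then show ?thesis
    by (simp add: E_def N_def right_diff_distrib)
qed

text \<open>The averaged inequality in the limit e -> 0. Forward quotients at c need room to the
  right, so the limit is taken for c < b and the end point is reached by continuity. The integrands
  are dominated because difference quotients inherit the bounds of \<open>w'\<close> and
  \<open>k\<close>.\<close>

theorem energy_inequality: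
  assumes ab: "a \<le> b"
  shows "(norm (w' b))\<^sup>2 + (norm (L (w b)))\<^sup>2 - ((norm (w' a))\<^sup>2 + (norm (L (w a)))\<^sup>2)
    \<le> integral {a..b} (\<lambda>t. (norm (w' t))\<^sup>2 - 2 * (k t \<bullet> w' t)) + (\<eta> b - \<eta> a)"
proof (cases "a = b")
  case False
  then have ab: "a < b" using ab by simp
  note int_der = integral_has_vector_derivative
  have bounded: "\<exists>M. \<forall>t\<in>{a..b}. norm (f t) \<le> M" if "continuous_on {a..b} f" for f :: "real \<Rightarrow> 'a"
    using compact_imp_bounded[OF compact_continuous_image[OF that compact_Icc]] by (auto simp: bounded_iff)
  obtain Mw where Mw: "\<And>t. t \<in> {a..b} \<Longrightarrow> norm (w' t) \<le> Mw" using bounded[OF cont(1)] by blast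
  obtain Mk where Mk: "\<And>t. t \<in> {a..b} \<Longrightarrow> norm (k t) \<le> Mk" using bounded[OF cont(3)] by blast
  define Q where "Q c = (norm (w' c))\<^sup>2 + (norm (L (w c)))\<^sup>2 - ((norm (w' a))\<^sup>2 + (norm (L (w a)))\<^sup>2)
    - (integral {a..c} (\<lambda>t. (norm (w' t))\<^sup>2 - 2 * (k t \<bullet> w' t)) + (\<eta> c - \<eta> a))" for c
  have Q: "Q c \<le> 0" if c: "c \<in> {a<..<b}" for c
  proof -
    define e where "e n = (b - c) * inverse (real (Suc n))" for n
    have e: "0 < e n" "c + e n \<le> b" for n
    proof -
      show "0 < e n" using c by (simp add: e_def)
      have "e n \<le> (b - c) * 1"
        unfolding e_def using c by (intro mult_left_mono) (auto simp: field_simps)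
      then show "c + e n \<le> b" by simp
    qed
    have e_lim: "e \<longlonglongrightarrow> 0"
      unfolding e_def by (intro tendsto_mult_right_zero LIMSEQ_inverse_real_of_nat)
    define P where "P n t = (1 / e n) *\<^sub>R (w (t + e n) - w t)" for n t
    define A where "A n t = (1 / e n) *\<^sub>R (integral {a..t + e n} (\<lambda>\<sigma>. L (w \<sigma>)) - integral {a..t} (\<lambda>\<sigma>. L (w \<sigma>)))" for n t
    define K where "K n t = (1 / e n) *\<^sub>R (integral {a..t + e n} k - integral {a..t} k)" for n t
    have lims: "(\<lambda>n. P n t) \<longlonglongrightarrow> w' t" "(\<lambda>n. A n t) \<longlonglongrightarrow> L (w t)" "(\<lambda>n. K n t) \<longlonglongrightarrow> k t"
      "(\<lambda>n. (1 / e n) *\<^sub>R (integral {a..t + e n} \<eta> - integral {a..t} \<eta>)) \<longlonglongrightarrow> \<eta> t" if t: "t \<in> {a..c}" for t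
    proof -
      have t': "t \<in> {a..b}" "a \<le> t" "t < b" "t + e n \<le> b" for n
        using t c e(2)[of n] by auto
      show "(\<lambda>n. P n t) \<longlonglongrightarrow> w' t"
        unfolding P_def by (rule forward_quotient_tendsto[OF der[OF t'(1)] t'(2,3) e(1) t'(4) e_lim])
      show "(\<lambda>n. A n t) \<longlonglongrightarrow> L (w t)"
        unfolding A_def by (rule forward_quotient_tendsto[OF int_der[OF cont(2) t'(1)] t'(2,3) e(1) t'(4) e_lim])
      show "(\<lambda>n. K n t) \<longlonglongrightarrow> k t"
        unfolding K_def by (rule forward_quotient_tendsto[OF int_der[OF cont(3) t'(1)] t'(2,3) e(1) t'(4) e_lim])
      show "(\<lambda>n. (1 / e n) *\<^sub>R (integral {a..t + e n} \<eta> - integral {a..t} \<eta>)) \<longlonglongrightarrow> \<eta> t"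
        by (rule forward_quotient_tendsto[OF int_der[OF cont(4) t'(1)] t'(2,3) e(1) t'(4) e_lim])
    qed
    have bounds: "norm (P n t) \<le> Mw" "norm (K n t) \<le> Mk" if t: "t \<in> {a..c}" for n t
    proof -
      have t': "a \<le> t" "t + e n \<le> b" using t e(2)[of n] by auto
      show "norm (P n t) \<le> Mw"
        unfolding P_def by (rule forward_quotient_bound[OF der Mw t'(1) e(1) t'(2)])
      show "norm (K n t) \<le> Mk"
        unfolding K_def by (rule forward_quotient_bound[OF int_der[OF cont(3)] Mk t'(1) e(1) t'(2)])
    qed
    have conts: "continuous_on {a..c} (P n)" "continuous_on {a..c} (K n)" for n
    proof -
      have der: "((\<lambda>t. w (t + e n) - w t) has_vector_derivative w' (t + e n) - w' t) (at t within {a..c})"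
        "((\<lambda>t. integral {a..t + e n} k - integral {a..t} k) has_vector_derivative k (t + e n) - k t) (at t within {a..c})"
        if "t \<in> {a..c}" for t
        using e[of n] that by (auto intro!: has_vector_derivative_shift_diff[OF der]
            has_vector_derivative_shift_diff[OF int_der[OF cont(3)]])
      show "continuous_on {a..c} (P n)" "continuous_on {a..c} (K n)"
        unfolding P_def K_def
        by (intro continuous_on_scaleR continuous_on_const continuous_on_vector_derivative[OF der(1)]
            continuous_on_vector_derivative[OF der(2)], assumption)+
    qed
    have int_lim: "(\<lambda>n. integral {a..c} (\<lambda>t. (norm (P n t))\<^sup>2 - 2 * (K n t \<bullet> P n t)))
        \<longlonglongrightarrow> integral {a..c} (\<lambda>t. (norm (w' t))\<^sup>2 - 2 * (k t \<bullet> w' t))"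
    proof (rule dominated_convergence(2))
      show "(\<lambda>t. (norm (P n t))\<^sup>2 - 2 * (K n t \<bullet> P n t)) integrable_on {a..c}" for n
        by (intro integrable_continuous_real continuous_intros conts)
      show "(\<lambda>t. Mw\<^sup>2 + 2 * (Mk * Mw)) integrable_on {a..c}"
        by (intro integrable_continuous_real continuous_intros)
      show "(\<lambda>n. (norm (P n t))\<^sup>2 - 2 * (K n t \<bullet> P n t)) \<longlonglongrightarrow> (norm (w' t))\<^sup>2 - 2 * (k t \<bullet> w' t)"
        if "t \<in> {a..c}" for t
        by (intro tendsto_intros lims that)
      show "norm ((norm (P n t))\<^sup>2 - 2 * (K n t \<bullet> P n t)) \<le> Mw\<^sup>2 + 2 * (Mk * Mw)" if t: "t \<in> {a..c}" for n t
      proof -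
        have "(norm (P n t))\<^sup>2 \<le> Mw\<^sup>2"
          using bounds(1)[OF t] by (intro power_mono) auto
        moreover have "\<bar>K n t \<bullet> P n t\<bar> \<le> norm (K n t) * norm (P n t)" by (rule Cauchy_Schwarz_ineq2)
        moreover have "norm (K n t) * norm (P n t) \<le> Mk * Mw"
          using bounds[OF t, of n] order_trans[OF norm_ge_zero bounds(2)[OF t, of n]] by (intro mult_mono) auto
        moreover have "0 \<le> (norm (P n t))\<^sup>2" by simp
        ultimately show ?thesis unfolding real_norm_def by linarith
      qed
    qed
    have ca: "c \<in> {a..c}" "a \<in> {a..c}" using c by auto
    have "(norm (w' c))\<^sup>2 + (norm (L (w c)))\<^sup>2 - ((norm (w' a))\<^sup>2 + (norm (L (w a)))\<^sup>2)
      \<le> integral {a..c} (\<lambda>t. (norm (w' t))\<^sup>2 - 2 * (k t \<bullet> w' t)) + (\<eta> c - \<eta> a)"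
    proof (rule LIMSEQ_le)
      show "(\<lambda>n. (norm (P n c))\<^sup>2 + (norm (A n c))\<^sup>2 - ((norm (P n a))\<^sup>2 + (norm (A n a))\<^sup>2)) \<longlonglongrightarrow>
        (norm (w' c))\<^sup>2 + (norm (L (w c)))\<^sup>2 - ((norm (w' a))\<^sup>2 + (norm (L (w a)))\<^sup>2)"
        by (intro tendsto_intros lims ca)
      show "(\<lambda>n. integral {a..c} (\<lambda>t. (norm (P n t))\<^sup>2 - 2 * (K n t \<bullet> P n t)) +
        ((1 / e n) * (integral {a..c + e n} \<eta> - integral {a..c} \<eta>) - (1 / e n) * (integral {a..a + e n} \<eta>)))
        \<longlonglongrightarrow> integral {a..c} (\<lambda>t. (norm (w' t))\<^sup>2 - 2 * (k t \<bullet> w' t)) + (\<eta> c - \<eta> a)"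
        using lims(4)[OF ca(1)] lims(4)[OF ca(2)] by (intro tendsto_intros int_lim) auto
      show "\<exists>N. \<forall>n\<ge>N. (norm (P n c))\<^sup>2 + (norm (A n c))\<^sup>2 - ((norm (P n a))\<^sup>2 + (norm (A n a))\<^sup>2)
        \<le> integral {a..c} (\<lambda>t. (norm (P n t))\<^sup>2 - 2 * (K n t \<bullet> P n t)) +
        ((1 / e n) * (integral {a..c + e n} \<eta> - integral {a..c} \<eta>) - (1 / e n) * (integral {a..a + e n} \<eta>))"
        using c e
        by (intro exI[of _ 0] allI impI averaged_energy_inequality)
          (auto simp: P_def A_def K_def fun_eq_iff)
    qed
    then show ?thesis by (simp add: Q_def)
  qed
  have "continuous_on {a..b} Q"
    unfolding Q_def
    by (intro continuous_intros cont indefinite_integral_continuous_1 integrable_continuous_real)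
  then have "Q b \<le> 0"
    using continuous_le_on_closure[of "{a<..<b}" Q b 0] ab Q by simp
  then show ?thesis by (simp add: Q_def)
qed simp

end

section \<open>The nonlinearity and its potential\<close>

lemma normV_nonneg: "0 \<le> normV \<Omega> u"
  by (simp add: normV_def)

lemma normV_scale: "open \<Omega> \<Longrightarrow> u \<in> V \<Omega> \<Longrightarrow> normV \<Omega> (c *\<^sub>R u) = \<bar>c\<bar> * normV \<Omega> u"
  by (simp add: normV_def laplacian_scale)

lemma normV_zero: "open \<Omega> \<Longrightarrow> normV \<Omega> 0 = 0"
  using normV_scale[of \<Omega> 0 0] subspace_0[OF subspace_V, of \<Omega>] by simp

lemma normV_triangle:
  "open \<Omega> \<Longrightarrow> u \<in> V \<Omega> \<Longrightarrow> v \<in> V \<Omega> \<Longrightarrow> normV \<Omega> (u + v) \<le> normV \<Omega> u + normV \<Omega> v"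
  by (simp add: normV_def laplacian_add norm_triangle_ineq)

lemma f_hypotheses_continuous:
  assumes "f_hypotheses \<Omega> lam \<mu>0 \<delta>0 f"
  shows "continuous_on S f" "f \<in> borel_measurable borel" "f 0 = 0"
proof -
  have "continuous_on UNIV f"
    using assms by (auto simp: f_hypotheses_def intro: C1_differentiable_imp_continuous_on)
  then show "continuous_on S f" "f \<in> borel_measurable borel"
    by (auto intro: continuous_on_subset borel_measurable_continuous_onI)
  show "f 0 = 0" using assms by (simp add: f_hypotheses_def)
qed

lemma sq_int_compL2:
  assumes f: "f_hypotheses \<Omega> lam \<mu>0 \<delta>0 f" and "open \<Omega>" "u \<in> V \<Omega>"
  shows "sq_int (\<lambda>x. f (ofL2 u x))"
proof -
  have [measurable]: "f \<in> borel_measurable borel" by (rule f_hypotheses_continuous[OF f])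
  \<comment> \<open>The Lipschitz condition is available for positive radii, while
    \<open>normV \<Omega> u\<close> may be 0.\<close>
  have "normV \<Omega> u + 1 > 0" using normV_nonneg[of \<Omega> u] by linarith
  then have "\<exists>L>0. \<forall>u'\<in>V \<Omega>. \<forall>v\<in>V \<Omega>. normV \<Omega> u' + normV \<Omega> v \<le> normV \<Omega> u + 1 \<longrightarrow>
      sq_int (\<lambda>x. f (ofL2 u' x) - f (ofL2 v x)) \<and>
      norm (toL2 (\<lambda>x. f (ofL2 u' x) - f (ofL2 v x))) \<le> L * normV \<Omega> (u' - v)"
    using f unfolding f_hypotheses_def by blast
  then have 1: "sq_int (\<lambda>x. f (ofL2 u x) - f (ofL2 0 x))"
    using assms(3) subspace_0[OF subspace_V[OF assms(2)]] normV_zero[OF assms(2)] by auto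
  have 2: "AE x in lborel. f (ofL2 u x) - f (ofL2 0 x) = f (ofL2 u x)"
    using ofL2_zero f_hypotheses_continuous(3)[OF f] by (auto elim: eventually_mono)
  show ?thesis by (rule sq_int_cong_AE[OF 1 _ 2]) simp
qed

text \<open>A predicate that names the constant: the final constants must be fixed by a radius
  before any solution is given, so one \<open>L\<close> has to be passed through several
  lemmas.\<close>

definition compL2_Lip :: "'a::euclidean_space set \<Rightarrow> (real \<Rightarrow> real) \<Rightarrow> real \<Rightarrow> real \<Rightarrow> bool" where
  "compL2_Lip \<Omega> f R L \<longleftrightarrow> L > 0 \<and> (\<forall>u\<in>V \<Omega>. \<forall>v\<in>V \<Omega>. normV \<Omega> u + normV \<Omega> v \<le> R \<longrightarrow>
     norm (compL2 f u - compL2 f v) \<le> L * normV \<Omega> (u - v))"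

lemma compL2_Lip_pos: "compL2_Lip \<Omega> f R L \<Longrightarrow> L > 0"
  by (simp add: compL2_Lip_def)

lemma compL2_LipD:
  "compL2_Lip \<Omega> f R L \<Longrightarrow> u \<in> V \<Omega> \<Longrightarrow> v \<in> V \<Omega> \<Longrightarrow> normV \<Omega> u + normV \<Omega> v \<le> R \<Longrightarrow>
    norm (compL2 f u - compL2 f v) \<le> L * normV \<Omega> (u - v)"
  by (simp add: compL2_Lip_def)

lemma ex_compL2_Lip:
  assumes f: "f_hypotheses \<Omega> lam \<mu>0 \<delta>0 f" and "open \<Omega>" "R > 0"
  shows "\<exists>L. compL2_Lip \<Omega> f R L"
proof -
  have "\<exists>L>0. \<forall>u\<in>V \<Omega>. \<forall>v\<in>V \<Omega>. normV \<Omega> u + normV \<Omega> v \<le> R \<longrightarrow>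
      sq_int (\<lambda>x. f (ofL2 u x) - f (ofL2 v x)) \<and>
      norm (toL2 (\<lambda>x. f (ofL2 u x) - f (ofL2 v x))) \<le> L * normV \<Omega> (u - v)"
    using f \<open>R > 0\<close> unfolding f_hypotheses_def by blast
  then show ?thesis
    using sq_int_compL2[OF f assms(2)] by (auto simp: compL2_Lip_def compL2_def toL2_diff)
qed

section \<open>The primitive of the nonlinearity and its potential\<close>

lemma primitive_has_real_derivative:
  assumes "continuous_on UNIV f"
  shows "(primitive f has_real_derivative f s) (at s)"
proof -
  \<comment> \<open>This interval contains 0, the base point of the primitive, and has
    \<open>s\<close> in its interior, so the one-sided derivative is a full one.\<close>
  let ?a = "- \<bar>s\<bar> - 1" and ?b = "\<bar>s\<bar> + 1"
  have "((\<lambda>u. LBINT y=ereal 0..u. f y) has_vector_derivative f s) (at s within {?a..?b})"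
    using continuous_on_subset[OF assms] by (intro interval_integral_FTC2) auto
  then have "(primitive f has_vector_derivative f s) (at s within {?a..?b})"
    unfolding primitive_def zero_ereal_def .
  moreover have "at s within {?a..?b} = at s"
    by (rule at_within_Icc_at) auto
  ultimately show ?thesis
    by (simp add: has_real_derivative_iff_has_vector_derivative)
qed

lemma primitive_measurable:
  "continuous_on UNIV f \<Longrightarrow> primitive f \<in> borel_measurable borel"
  using primitive_has_real_derivative
  by (intro borel_measurable_continuous_onI DERIV_continuous_on[of UNIV _ f])
    (auto intro: has_field_derivative_at_within)

lemma primitive_zero: "primitive f 0 = 0"
  unfolding primitive_def zero_ereal_def by (rule interval_integral_endpoints_same)

text \<open>Taylor's formula with integral remainder. It is stated in \<open>ennreal\<close>, so
  that integration over space and exchange of the integrals need no integrability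
  beforehand.\<close>

lemma primitive_remainder:
  assumes f: "continuous_on UNIV f"
  shows "ennreal \<bar>primitive f (a + b) - primitive f a - f a * b\<bar>
    \<le> (\<integral>\<^sup>+\<sigma>. indicator {0..1} \<sigma> * ennreal (\<bar>f (a + \<sigma> * b) - f a\<bar> * \<bar>b\<bar>) \<partial>lborel)"
proof -
  have cont: "continuous_on S (\<lambda>\<sigma>. f (a + \<sigma> * b))" for S
    by (rule continuous_on_compose2[OF f]) (auto intro!: continuous_intros)
  have "((\<lambda>\<sigma>. (f (a + \<sigma> * b) - f a) * b) has_integral
      (primitive f (a + 1 * b) - f a * b * 1 - (primitive f (a + 0 * b) - f a * b * 0))) {0..1}"
  proof (rule fundamental_theorem_of_calculus)
    fix \<sigma> :: real assume "\<sigma> \<in> {0..1}"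
    have "((\<lambda>\<sigma>. a + \<sigma> * b) has_real_derivative b) (at \<sigma> within {0..1})"
      by (auto intro!: derivative_eq_intros)
    from DERIV_chain2[OF primitive_has_real_derivative[OF f] this]
    have "((\<lambda>\<sigma>. primitive f (a + \<sigma> * b)) has_real_derivative f (a + \<sigma> * b) * b) (at \<sigma> within {0..1})" .
    moreover have "((\<lambda>\<sigma>. f a * b * \<sigma>) has_real_derivative f a * b) (at \<sigma> within {0..1})"
      by (auto intro!: derivative_eq_intros)
    ultimately show "((\<lambda>\<sigma>. primitive f (a + \<sigma> * b) - f a * b * \<sigma>) has_vector_derivative
        (f (a + \<sigma> * b) - f a) * b) (at \<sigma> within {0..1})"
      unfolding has_real_derivative_iff_has_vector_derivative[symmetric] left_diff_distrib
      by (rule DERIV_diff)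
  qed simp
  then have I: "((\<lambda>\<sigma>. (f (a + \<sigma> * b) - f a) * b) has_integral
      (primitive f (a + b) - primitive f a - f a * b)) {0..1}"
    by (simp add: algebra_simps)
  have int: "(\<lambda>\<sigma>. \<bar>f (a + \<sigma> * b) - f a\<bar> * \<bar>b\<bar>) integrable_on {0..1}"
    by (intro integrable_continuous_real continuous_intros cont)
  have "norm (integral {0..1} (\<lambda>\<sigma>. (f (a + \<sigma> * b) - f a) * b)) \<le> integral {0..1} (\<lambda>\<sigma>. \<bar>f (a + \<sigma> * b) - f a\<bar> * \<bar>b\<bar>)"
    by (rule integral_norm_bound_integral[OF has_integral_integrable[OF I] int]) (simp add: abs_mult)
  then have "\<bar>primitive f (a + b) - primitive f a - f a * b\<bar> \<le> integral {0..1} (\<lambda>\<sigma>. \<bar>f (a + \<sigma> * b) - f a\<bar> * \<bar>b\<bar>)"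
    unfolding integral_unique[OF I] real_norm_def .
  then have "ennreal \<bar>primitive f (a + b) - primitive f a - f a * b\<bar>
      \<le> ennreal (integral {0..1} (\<lambda>\<sigma>. \<bar>f (a + \<sigma> * b) - f a\<bar> * \<bar>b\<bar>))"
    by (rule ennreal_leI)
  also have "\<dots> = (\<integral>\<^sup>+\<sigma>. ennreal (\<bar>f (a + \<sigma> * b) - f a\<bar> * \<bar>b\<bar>) * indicator {0..1} \<sigma> \<partial>lborel)"
    using nn_integral_has_integral_lebesgue'[OF _ integrable_integral[OF int]] by simp
  finally show ?thesis by (simp add: mult.commute)
qed

lemma nn_integral_abs_mult_le:
  assumes "sq_int p" "sq_int q"
  shows "(\<integral>\<^sup>+x. ennreal (\<bar>p x\<bar> * \<bar>q x\<bar>) \<partial>lborel) \<le> ennreal (norm (toL2 p) * norm (toL2 q))"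
proof -
  have abs: "sq_int (\<lambda>x. \<bar>g x\<bar>)" "norm (toL2 (\<lambda>x. \<bar>g x\<bar>)) = norm (toL2 g)" if "sq_int g" for g :: "'a \<Rightarrow> real"
  proof -
    show 1: "sq_int (\<lambda>x. \<bar>g x\<bar>)"
      using that by (intro sq_int_bound[OF that]) (auto simp: sq_int_def)
    have "(norm (toL2 (\<lambda>x. \<bar>g x\<bar>)))\<^sup>2 = (norm (toL2 g))\<^sup>2"
      unfolding norm_toL2[OF 1] norm_toL2[OF that] by simp
    then show "norm (toL2 (\<lambda>x. \<bar>g x\<bar>)) = norm (toL2 g)" by simp
  qed
  have "(\<integral>\<^sup>+x. ennreal (\<bar>p x\<bar> * \<bar>q x\<bar>) \<partial>lborel) = ennreal (LINT x|lborel. \<bar>p x\<bar> * \<bar>q x\<bar>)"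
    using sq_int_mult[OF abs(1) abs(1), OF assms] by (intro nn_integral_eq_integral) auto
  also have "(LINT x|lborel. \<bar>p x\<bar> * \<bar>q x\<bar>) = toL2 (\<lambda>x. \<bar>p x\<bar>) \<bullet> toL2 (\<lambda>x. \<bar>q x\<bar>)"
    using abs(1) assms by (simp add: inner_toL2)
  also have "\<dots> \<le> norm (toL2 p) * norm (toL2 q)"
    using norm_cauchy_schwarz[of "toL2 (\<lambda>x. \<bar>p x\<bar>)" "toL2 (\<lambda>x. \<bar>q x\<bar>)"] abs(2) assms by simp
  finally show ?thesis using ennreal_leI by blast
qed

definition potential :: "(real \<Rightarrow> real) \<Rightarrow> 'a::euclidean_space L2 \<Rightarrow> real" where
  "potential f u = (LINT x|lborel. primitive f (ofL2 u x))"

text \<open>For each \<sigma> in [0, 1], Cauchy-Schwarz and the Lipschitz bound compare f at u +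
  \<sigma> z and at u; the norms of these two add up to at most
  \<open>2 * normV \<Omega> u + normV \<Omega> z\<close>, hence the condition on \<open>R\<close>.
  The result is linear in both \<open>normV \<Omega> z\<close> and \<open>norm z\<close>, which
  matters for the derivative in time.\<close>

lemma potential_remainder_nn:
  assumes f: "f_hypotheses \<Omega> lam \<mu>0 \<delta>0 f" and o: "open \<Omega>" and uz: "u \<in> V \<Omega>" "z \<in> V \<Omega>"
    and L: "compL2_Lip \<Omega> f R L"
    and R: "2 * normV \<Omega> u + normV \<Omega> z \<le> R"
  shows "(\<integral>\<^sup>+x. ennreal \<bar>primitive f (ofL2 u x + ofL2 z x) - primitive f (ofL2 u x) - f (ofL2 u x) * ofL2 z x\<bar> \<partial>lborel)
    \<le> ennreal (L * normV \<Omega> z * norm z)"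
proof -
  note cont = f_hypotheses_continuous[OF f]
  have [measurable]: "f \<in> borel_measurable borel" by (rule cont)
  define Q where "Q x \<sigma> = indicator {0..1::real} \<sigma> *
    ennreal (\<bar>f (ofL2 u x + \<sigma> * ofL2 z x) - f (ofL2 u x)\<bar> * \<bar>ofL2 z x\<bar>)" for x \<sigma>
  have "(\<integral>\<^sup>+x. ennreal \<bar>primitive f (ofL2 u x + ofL2 z x) - primitive f (ofL2 u x) - f (ofL2 u x) * ofL2 z x\<bar> \<partial>lborel)
      \<le> (\<integral>\<^sup>+x. \<integral>\<^sup>+\<sigma>. Q x \<sigma> \<partial>lborel \<partial>lborel)"
    unfolding Q_def by (intro nn_integral_mono primitive_remainder cont)
  also have "\<dots> = (\<integral>\<^sup>+\<sigma>. \<integral>\<^sup>+x. Q x \<sigma> \<partial>lborel \<partial>lborel)"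
  proof (rule lborel_pair.Fubini'[symmetric])
    show "case_prod Q \<in> borel_measurable (lborel \<Otimes>\<^sub>M lborel)"
      unfolding Q_def by measurable
  qed
  also have "\<dots> \<le> (\<integral>\<^sup>+\<sigma>. ennreal (L * normV \<Omega> z * norm z) * indicator {0..1::real} \<sigma> \<partial>lborel)"
  proof (rule nn_integral_mono)
    fix \<sigma> :: real
    show "(\<integral>\<^sup>+x. Q x \<sigma> \<partial>lborel) \<le> ennreal (L * normV \<Omega> z * norm z) * indicator {0..1} \<sigma>"
    proof (cases "\<sigma> \<in> {0..1}")
      case True
      have sz: "\<sigma> *\<^sub>R z \<in> V \<Omega>" and usz: "u + \<sigma> *\<^sub>R z \<in> V \<Omega>"
        using uz subspace_V[OF o] by (auto intro: subspace_add subspace_scale)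
      have nsz: "normV \<Omega> (\<sigma> *\<^sub>R z) \<le> normV \<Omega> z"
        using True normV_nonneg[of \<Omega> z] by (simp add: normV_scale[OF o uz(2)] mult_left_le_one_le)
      have ae: "AE x in lborel. ofL2 (u + \<sigma> *\<^sub>R z) x = ofL2 u x + \<sigma> * ofL2 z x"
        using ofL2_add[of u "\<sigma> *\<^sub>R z"] ofL2_scale[of \<sigma> z] by eventually_elim simp
      have sq: "sq_int (\<lambda>x. f (ofL2 (u + \<sigma> *\<^sub>R z) x) - f (ofL2 u x))"
        by (intro sq_int_diff sq_int_compL2[OF f o] usz uz)
      have "(\<integral>\<^sup>+x. Q x \<sigma> \<partial>lborel)
          = (\<integral>\<^sup>+x. ennreal (\<bar>f (ofL2 (u + \<sigma> *\<^sub>R z) x) - f (ofL2 u x)\<bar> * \<bar>ofL2 z x\<bar>) \<partial>lborel)"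
        using ae True by (intro nn_integral_cong_AE) (auto simp: Q_def elim!: eventually_mono)
      also have "\<dots> \<le> ennreal (norm (toL2 (\<lambda>x. f (ofL2 (u + \<sigma> *\<^sub>R z) x) - f (ofL2 u x))) * norm (toL2 (ofL2 z)))"
        by (rule nn_integral_abs_mult_le[OF sq]) simp
      also have "\<dots> = ennreal (norm (compL2 f (u + \<sigma> *\<^sub>R z) - compL2 f u) * norm z)"
        using sq_int_compL2[OF f o] usz uz by (simp add: compL2_def toL2_diff)
      also have "\<dots> \<le> ennreal (L * normV \<Omega> z * norm z)"
      proof (intro ennreal_leI mult_right_mono)
        have "norm (compL2 f (u + \<sigma> *\<^sub>R z) - compL2 f u) \<le> L * normV \<Omega> (u + \<sigma> *\<^sub>R z - u)"
          using normV_triangle[OF o uz(1) sz] nsz R by (intro compL2_LipD[OF L] usz uz) linarith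
        also have "\<dots> \<le> L * normV \<Omega> z"
          using nsz compL2_Lip_pos[OF L] by (intro mult_left_mono) auto
        finally show "norm (compL2 f (u + \<sigma> *\<^sub>R z) - compL2 f u) \<le> L * normV \<Omega> z" .
      qed simp
      finally show ?thesis using True by simp
    qed (simp add: Q_def)
  qed
  also have "\<dots> = ennreal (L * normV \<Omega> z * norm z)"
    by (simp add: nn_integral_cmult_indicator)
  finally show ?thesis .
qed

text \<open>The remainder estimate at the base point 0, where the primitive and \<open>f\<close>
  vanish, already bounds the integral of |F(u)|; integrability of F(u) is thus a consequence of the
  Lipschitz condition.\<close>

lemma potential_bound:
  assumes f: "f_hypotheses \<Omega> lam \<mu>0 \<delta>0 f" and o: "open \<Omega>" and u: "u \<in> V \<Omega>"
    and L: "compL2_Lip \<Omega> f R L"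
    and R: "normV \<Omega> u \<le> R"
  shows "integrable lborel (\<lambda>x. primitive f (ofL2 u x))" "\<bar>potential f u\<bar> \<le> L * normV \<Omega> u * norm u"
proof -
  note cont = f_hypotheses_continuous[OF f]
  have [measurable]: "primitive f \<in> borel_measurable borel" by (rule primitive_measurable[OF cont(1)])
  have "(\<integral>\<^sup>+x. ennreal \<bar>primitive f (ofL2 0 x + ofL2 u x) - primitive f (ofL2 0 x) - f (ofL2 0 x) * ofL2 u x\<bar> \<partial>lborel)
      \<le> ennreal (L * normV \<Omega> u * norm u)"
  proof (rule potential_remainder_nn[OF f o subspace_0[OF subspace_V[OF o]] u L])
    show "2 * normV \<Omega> 0 + normV \<Omega> u \<le> R" using R normV_zero[OF o] by linarith
  qed
  also have "(\<integral>\<^sup>+x. ennreal \<bar>primitive f (ofL2 0 x + ofL2 u x) - primitive f (ofL2 0 x) - f (ofL2 0 x) * ofL2 u x\<bar> \<partial>lborel)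
      = (\<integral>\<^sup>+x. ennreal \<bar>primitive f (ofL2 u x)\<bar> \<partial>lborel)"
    using ofL2_zero
    by (intro nn_integral_cong_AE) (auto simp: primitive_zero cont(3) elim!: eventually_mono)
  finally have bound: "(\<integral>\<^sup>+x. ennreal \<bar>primitive f (ofL2 u x)\<bar> \<partial>lborel) \<le> ennreal (L * normV \<Omega> u * norm u)" .
  show int: "integrable lborel (\<lambda>x. primitive f (ofL2 u x))"
    unfolding integrable_iff_bounded real_norm_def
    using bound by (auto intro: le_less_trans)
  have "ennreal \<bar>potential f u\<bar> \<le> ennreal (L * normV \<Omega> u * norm u)"
    unfolding potential_def
    using integral_norm_bound_ennreal[OF int] bound by (simp add: order_trans)
  then show "\<bar>potential f u\<bar> \<le> L * normV \<Omega> u * norm u"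
    using compL2_Lip_pos[OF L] normV_nonneg[of \<Omega> u] by (simp add: ennreal_le_iff)
qed

lemma potential_remainder:
  assumes f: "f_hypotheses \<Omega> lam \<mu>0 \<delta>0 f" and o: "open \<Omega>" and uz: "u \<in> V \<Omega>" "z \<in> V \<Omega>"
    and L: "compL2_Lip \<Omega> f R L"
    and R: "2 * normV \<Omega> u + normV \<Omega> z \<le> R"
  shows "\<bar>potential f (u + z) - potential f u - compL2 f u \<bullet> z\<bar> \<le> L * normV \<Omega> z * norm z"
proof -
  have uzV: "u + z \<in> V \<Omega>" using uz subspace_V[OF o] by (auto intro: subspace_add)
  have int: "integrable lborel (\<lambda>x. primitive f (ofL2 (u + z) x))" "integrable lborel (\<lambda>x. primitive f (ofL2 u x))"
    using normV_triangle[OF o uz] normV_nonneg[of \<Omega> u] normV_nonneg[of \<Omega> z] R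
    by (auto intro!: potential_bound(1)[OF f o _ L] uzV uz)
  have sq: "sq_int (\<lambda>x. f (ofL2 u x))" by (rule sq_int_compL2[OF f o uz(1)])
  have int': "integrable lborel (\<lambda>x. f (ofL2 u x) * ofL2 z x)"
    by (rule sq_int_mult[OF sq]) simp
  have "compL2 f u \<bullet> z = toL2 (\<lambda>x. f (ofL2 u x)) \<bullet> toL2 (ofL2 z)" by (simp add: compL2_def)
  also have "\<dots> = (LINT x|lborel. f (ofL2 u x) * ofL2 z x)" by (rule inner_toL2[OF sq]) simp
  finally have inner: "compL2 f u \<bullet> z = (LINT x|lborel. f (ofL2 u x) * ofL2 z x)" .
  have eq: "potential f (u + z) - potential f u - compL2 f u \<bullet> z
      = (LINT x|lborel. primitive f (ofL2 (u + z) x) - primitive f (ofL2 u x) - f (ofL2 u x) * ofL2 z x)"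
    using int int' by (simp add: potential_def inner)
  have "ennreal \<bar>potential f (u + z) - potential f u - compL2 f u \<bullet> z\<bar>
      \<le> (\<integral>\<^sup>+x. ennreal \<bar>primitive f (ofL2 (u + z) x) - primitive f (ofL2 u x) - f (ofL2 u x) * ofL2 z x\<bar> \<partial>lborel)"
    unfolding eq using int int'
    by (intro integral_norm_bound_ennreal[where 'b=real, unfolded real_norm_def]) simp
  also have "\<dots> = (\<integral>\<^sup>+x. ennreal \<bar>primitive f (ofL2 u x + ofL2 z x) - primitive f (ofL2 u x) - f (ofL2 u x) * ofL2 z x\<bar> \<partial>lborel)"
    using ofL2_add[of u z] by (intro nn_integral_cong_AE) (auto elim!: eventually_mono)
  also have "\<dots> \<le> ennreal (L * normV \<Omega> z * norm z)"
    by (rule potential_remainder_nn[OF f o uz L R])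
  finally show ?thesis
    using compL2_Lip_pos[OF L] normV_nonneg[of \<Omega> z] by (simp add: ennreal_le_iff)
qed

text \<open>The constant in the lower bound for F is charged only on \<Omega>, of finite measure:
  outside, u = 0 and F(0) = 0. The additive constant is therefore the same for all
  \<open>u\<close>.\<close>

lemma potential_lower_bound:
  assumes f: "f_hypotheses \<Omega> lam \<mu>0 \<delta>0 f" and o: "open \<Omega>" "bounded \<Omega>"
  obtains C where "C \<ge> 0" "\<And>u. u \<in> V \<Omega> \<Longrightarrow> - C - lam / 4 * (norm u)\<^sup>2 \<le> potential f u"
proof -
  obtain Cf where Cf: "Cf > 0" "\<And>s. primitive f s \<ge> - Cf - lam / 4 * s\<^sup>2"
    using f unfolding f_hypotheses_def by auto
  have fin: "emeasure lborel \<Omega> < \<infinity>" by (rule emeasure_bounded_finite[OF o(2)])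
  have int_ind: "integrable lborel (indicator \<Omega> :: 'a \<Rightarrow> real)"
    using fin o(1) by (simp add: integrable_indicator_iff)
  have "- (Cf * measure lborel \<Omega>) - lam / 4 * (norm u)\<^sup>2 \<le> potential f u" if u: "u \<in> V \<Omega>" for u
  proof -
    have "normV \<Omega> u + 1 > 0" using normV_nonneg[of \<Omega> u] by linarith
    from ex_compL2_Lip[OF f o(1) this] obtain L where "compL2_Lip \<Omega> f (normV \<Omega> u + 1) L" ..
    then have int: "integrable lborel (\<lambda>x. primitive f (ofL2 u x))"
      by (intro potential_bound(1)[OF f o(1) u]) auto
    have int2: "integrable lborel (\<lambda>x. (ofL2 u x)\<^sup>2)"
      using sq_int_ofL2[of u] by (simp add: sq_int_def)
    have "(LINT x|lborel. - Cf * indicator \<Omega> x - lam / 4 * (ofL2 u x)\<^sup>2) \<le> (LINT x|lborel. primitive f (ofL2 u x))"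
    proof (rule integral_mono_AE)
      have "AE x in lborel. x \<notin> \<Omega> \<longrightarrow> ofL2 u x = 0"
        using u V_subset_H by (auto simp: H_def)
      then show "AE x in lborel. - Cf * indicator \<Omega> x - lam / 4 * (ofL2 u x)\<^sup>2 \<le> primitive f (ofL2 u x)"
      proof eventually_elim
        case (elim x)
        then show ?case using Cf(2)[of "ofL2 u x"] by (cases "x \<in> \<Omega>") (auto simp: primitive_zero)
      qed
    qed (use int_ind int int2 in auto)
    also have "(LINT x|lborel. - Cf * indicator \<Omega> x - lam / 4 * (ofL2 u x)\<^sup>2)
        = - (Cf * measure lborel \<Omega>) - lam / 4 * (norm u)\<^sup>2"
      using int_ind int2 by (simp add: norm_L2_eq)
    finally show ?thesis by (simp add: potential_def)
  qed
  then show ?thesis using that[of "Cf * measure lborel \<Omega>"] Cf(1) by simp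
qed

text \<open>Here \<open>u\<close> is continuous into V but differentiable only into H. That is
  enough: in the remainder L |u s - u t|_V |u s - u t|, divided by |s - t|, the first distance tends
  to 0 while the quotient of the second stays bounded.\<close>

lemma potential_has_real_derivative:
  assumes f: "f_hypotheses \<Omega> lam \<mu>0 \<delta>0 f" and o: "open \<Omega>" and u: "\<And>t. t \<in> I \<Longrightarrow> u t \<in> V \<Omega>"
    and t: "t \<in> I" and cont: "((\<lambda>s. normV \<Omega> (u s - u t)) \<longlongrightarrow> 0) (at t within I)"
    and der: "(u has_vector_derivative u') (at t within I)"
  shows "((\<lambda>t. potential f (u t)) has_real_derivative compL2 f (u t) \<bullet> u') (at t within I)"
proof -
  \<comment> \<open>Covers the base point \<open>u t\<close> together with increments of V-norm
    below 1.\<close>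
  define R where "R = 2 * normV \<Omega> (u t) + 1"
  have "R > 0" using normV_nonneg[of \<Omega> "u t"] by (simp add: R_def)
  obtain L where L: "compL2_Lip \<Omega> f R L"
    using ex_compL2_Lip[OF f o \<open>R > 0\<close>] ..
  define q where "q s = (1 / (s - t)) *\<^sub>R (u s - u t)" for s
  have q: "(q \<longlongrightarrow> u') (at t within I)"
    unfolding q_def by (rule has_vector_derivative_quotient_tendsto[OF der])
  have "eventually (\<lambda>s. normV \<Omega> (u s - u t) < 1) (at t within I)"
    using order_tendstoD(2)[OF cont, of 1] by simp
  moreover have "eventually (\<lambda>s. s \<in> I \<and> s \<noteq> t) (at t within I)"
    by (simp add: eventually_at_filter)
  ultimately have ev: "eventually (\<lambda>s. norm ((potential f (u s) - potential f (u t)) / (s - t) - compL2 f (u t) \<bullet> q s)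
      \<le> L * normV \<Omega> (u s - u t) * norm (q s)) (at t within I)"
  proof eventually_elim
    case (elim s)
    have z: "u s - u t \<in> V \<Omega>" using elim u t subspace_diff[OF subspace_V[OF o]] by blast
    have rem: "\<bar>potential f (u s) - potential f (u t) - compL2 f (u t) \<bullet> (u s - u t)\<bar>
        \<le> L * normV \<Omega> (u s - u t) * norm (u s - u t)"
      using potential_remainder[OF f o u[OF t] z L] elim by (simp add: R_def)
    have "(potential f (u s) - potential f (u t)) / (s - t) - compL2 f (u t) \<bullet> q s
        = (potential f (u s) - potential f (u t) - compL2 f (u t) \<bullet> (u s - u t)) / (s - t)"
      by (simp only: q_def inner_scaleR_right) (simp add: diff_divide_distrib)
    then have "norm ((potential f (u s) - potential f (u t)) / (s - t) - compL2 f (u t) \<bullet> q s)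
        = \<bar>potential f (u s) - potential f (u t) - compL2 f (u t) \<bullet> (u s - u t)\<bar> / \<bar>s - t\<bar>"
      by (simp only: real_norm_def abs_divide)
    also have "\<dots> \<le> (L * normV \<Omega> (u s - u t) * norm (u s - u t)) / \<bar>s - t\<bar>"
      by (intro divide_right_mono rem) simp
    also have "\<dots> = L * normV \<Omega> (u s - u t) * norm (q s)"
      by (simp only: q_def norm_scaleR) (simp add: abs_divide)
    finally show ?case .
  qed
  have "((\<lambda>s. L * normV \<Omega> (u s - u t) * norm (q s)) \<longlongrightarrow> L * 0 * norm u') (at t within I)"
    by (intro tendsto_intros cont q)
  then have lim: "((\<lambda>s. L * normV \<Omega> (u s - u t) * norm (q s)) \<longlongrightarrow> 0) (at t within I)"
    by simp
  have "((\<lambda>s. (potential f (u s) - potential f (u t)) / (s - t) - compL2 f (u t) \<bullet> q s) \<longlongrightarrow> 0) (at t within I)"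
    by (rule Lim_null_comparison[OF ev lim])
  moreover have "((\<lambda>s. compL2 f (u t) \<bullet> q s) \<longlongrightarrow> compL2 f (u t) \<bullet> u') (at t within I)"
    by (intro tendsto_intros q)
  ultimately have "((\<lambda>s. ((potential f (u s) - potential f (u t)) / (s - t) - compL2 f (u t) \<bullet> q s) + compL2 f (u t) \<bullet> q s)
      \<longlongrightarrow> 0 + compL2 f (u t) \<bullet> u') (at t within I)"
    by (rule tendsto_add)
  then show ?thesis
    by (simp add: has_field_derivative_iff)
qed

section \<open>Measurability in time\<close>

text \<open>\<open>X\<close> and \<open>N\<close> need not come from a topology on the type, so
  continuity of \<open>p\<close> is required along \<open>N\<close>-convergent sequences. A function
  of a simple function is simple, and measurability passes to the almost everywhere limit.\<close>

lemma strongly_measurable_functional: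
  fixes p :: "'b::minus \<Rightarrow> real"
  assumes u: "strongly_measurable X N I u" and I: "I \<in> sets lebesgue"
    and p: "\<And>x y. (\<And>n. x n \<in> X) \<Longrightarrow> y \<in> X \<Longrightarrow> (\<lambda>n. N (x n - y)) \<longlonglongrightarrow> 0 \<Longrightarrow> (\<lambda>n. p (x n)) \<longlonglongrightarrow> p y"
  shows "(\<lambda>t. indicator I t * p (u t)) \<in> borel_measurable lebesgue"
proof -
  obtain s :: "nat \<Rightarrow> real \<Rightarrow> 'b" where s: "\<And>n. finite (range (s n))" "\<And>n. range (s n) \<subseteq> X"
    "\<And>n x. s n -` {x} \<in> sets lebesgue"
    "AE t in lebesgue. t \<in> I \<longrightarrow> u t \<in> X \<and> (\<lambda>n. N (s n t - u t)) \<longlonglongrightarrow> 0"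
    using u unfolding strongly_measurable_def by blast
  have ps: "(\<lambda>t. p (s n t)) \<in> borel_measurable lebesgue" for n
  proof (rule measurableI)
    fix A :: "real set"
    have "(\<lambda>t. p (s n t)) -` A \<inter> space lebesgue = (\<Union>x\<in>{x\<in>range (s n). p x \<in> A}. s n -` {x})"
      by auto
    also have "\<dots> \<in> sets lebesgue"
      using s(1)[of n] s(3) by (intro sets.finite_UN) auto
    finally show "(\<lambda>t. p (s n t)) -` A \<inter> space lebesgue \<in> sets lebesgue" .
  qed simp
  have meas: "(\<lambda>t. indicator I t * p (s n t)) \<in> borel_measurable lebesgue" for n
    using ps I by (intro borel_measurable_times borel_measurable_indicator) auto
  have "(\<lambda>t. lim (\<lambda>n. indicator I t * p (s n t))) \<in> borel_measurable lebesgue"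
    by (rule borel_measurable_lim_metric[OF meas])
  moreover have "AE t in lebesgue. lim (\<lambda>n. indicator I t * p (s n t)) = indicator I t * p (u t)"
    using s(4)
  proof eventually_elim
    case (elim t)
    show ?case
    proof (rule limI, cases "t \<in> I")
      case True
      have "(\<lambda>n. p (s n t)) \<longlonglongrightarrow> p (u t)"
        using elim True s(2) by (intro p) auto
      then show "(\<lambda>n. indicator I t * p (s n t)) \<longlonglongrightarrow> indicator I t * p (u t)"
        by (intro tendsto_intros)
    qed simp
  qed
  ultimately show ?thesis by (rule borel_measurable_AE)
qed

text \<open>On a bounded interval |x| <= x^2 + 1 suffices. Nothing is assumed at the end points, so
  the argument runs on the open interval and adds them as a null set.\<close>

lemma square_integrable_absolutely_integrable:
  fixes g :: "real \<Rightarrow> real"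
  assumes g: "(\<lambda>t. indicator {a<..<b} t * g t) \<in> borel_measurable lebesgue"
    and fin: "(\<integral>\<^sup>+t\<in>{a<..<b}. ennreal ((g t)\<^sup>2) \<partial>lebesgue) < \<infinity>"
  shows "g absolutely_integrable_on {a..b}" "(\<lambda>t. (g t)\<^sup>2) absolutely_integrable_on {a..b}"
proof -
  let ?I = "{a<..<b}"
  have sq: "integrable lebesgue (\<lambda>t. (indicator ?I t * g t)\<^sup>2)"
  proof (rule integrableI_nonneg)
    show "(\<lambda>t. (indicator ?I t * g t)\<^sup>2) \<in> borel_measurable lebesgue"
      using g by (rule borel_measurable_power)
    have "(\<integral>\<^sup>+t. ennreal ((indicator ?I t * g t)\<^sup>2) \<partial>lebesgue) = (\<integral>\<^sup>+t\<in>?I. ennreal ((g t)\<^sup>2) \<partial>lebesgue)"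
      by (rule nn_integral_cong) (auto simp: indicator_def)
    then show "(\<integral>\<^sup>+t. ennreal ((indicator ?I t * g t)\<^sup>2) \<partial>lebesgue) < \<infinity>"
      using fin by simp
  qed simp
  moreover have eq: "(indicator ?I t * g t)\<^sup>2 = indicator ?I t *\<^sub>R (g t)\<^sup>2" for t
    by (simp add: indicator_def)
  ultimately have "(\<lambda>t. (g t)\<^sup>2) absolutely_integrable_on ?I"
    by (simp add: set_integrable_def)
  then show "(\<lambda>t. (g t)\<^sup>2) absolutely_integrable_on {a..b}"
    by (simp add: absolutely_integrable_on_Icc_iff_Ioo)
  have ind: "integrable lebesgue (indicator ?I :: real \<Rightarrow> real)"
    using emeasure_bounded_finite[OF bounded_subset[OF bounded_closed_interval, of ?I a b]]
    by (auto simp: integrable_indicator_iff subset_iff)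
  have "integrable lebesgue (\<lambda>t. indicator ?I t * g t)"
  proof (rule Bochner_Integration.integrable_bound)
    show "integrable lebesgue (\<lambda>t. (indicator ?I t * g t)\<^sup>2 + indicator ?I t)"
      by (intro Bochner_Integration.integrable_add sq ind)
    have "\<bar>x\<bar> \<le> x\<^sup>2 + 1" for x :: real
    proof -
      have "0 \<le> (\<bar>x\<bar> - 1)\<^sup>2 + \<bar>x\<bar>" by simp
      then show ?thesis by (simp add: power2_diff)
    qed
    then show "AE t in lebesgue. norm (indicator ?I t * g t) \<le> norm ((indicator ?I t * g t)\<^sup>2 + indicator ?I t)"
      by (auto simp: indicator_def)
  qed (rule g)
  then have "g absolutely_integrable_on ?I"
    by (simp add: set_integrable_def)
  then show "g absolutely_integrable_on {a..b}"
    by (simp add: absolutely_integrable_on_Icc_iff_Ioo)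
qed

section \<open>Pairings with the dual of \<open>V\<close> and integrability in time\<close>

lemma Vdual_pairing:
  assumes o: "open \<Omega>" and l: "l \<in> Vdual \<Omega>" and \<phi>: "\<phi> \<in> V \<Omega>"
  shows "\<bar>l \<phi>\<bar> \<le> normVdual \<Omega> l * normV \<Omega> \<phi>"
proof -
  obtain B where B: "\<And>\<phi>. \<phi> \<in> V \<Omega> \<Longrightarrow> \<bar>l \<phi>\<bar> \<le> B * normV \<Omega> \<phi>"
    and scale: "\<And>c \<phi>. \<phi> \<in> V \<Omega> \<Longrightarrow> l (c *\<^sub>R \<phi>) = c * l \<phi>"
    using l unfolding Vdual_def by blast
  show ?thesis
  proof (cases "normV \<Omega> \<phi> = 0")
    case True
    then show ?thesis using B[OF \<phi>] by simp
  next
    case False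
    then have pos: "normV \<Omega> \<phi> > 0" using normV_nonneg[of \<Omega> \<phi>] by simp
    define \<psi> where "\<psi> = (1 / normV \<Omega> \<phi>) *\<^sub>R \<phi>"
    have \<psi>: "\<psi> \<in> V \<Omega>" "normV \<Omega> \<psi> = 1"
      using \<phi> pos subspace_V[OF o] by (auto simp: \<psi>_def normV_scale[OF o] intro: subspace_scale)
    have "bdd_above ((\<lambda>\<phi>. \<bar>l \<phi>\<bar>) ` {\<phi>\<in>V \<Omega>. normV \<Omega> \<phi> \<le> 1})"
    proof (rule bdd_aboveI2)
      fix \<eta> assume \<eta>: "\<eta> \<in> {\<phi>\<in>V \<Omega>. normV \<Omega> \<phi> \<le> 1}"
      have "\<bar>l \<eta>\<bar> \<le> B * normV \<Omega> \<eta>" using B \<eta> by blast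
      also have "\<dots> \<le> \<bar>B\<bar> * 1" using \<eta> normV_nonneg[of \<Omega> \<eta>] by (intro mult_mono) auto
      finally show "\<bar>l \<eta>\<bar> \<le> \<bar>B\<bar>" by simp
    qed
    then have "\<bar>l \<psi>\<bar> \<le> normVdual \<Omega> l"
      unfolding normVdual_def using \<psi> by (intro cSUP_upper) auto
    then have "\<bar>(1 / normV \<Omega> \<phi>) * l \<phi>\<bar> \<le> normVdual \<Omega> l"
      by (simp add: \<psi>_def scale[OF \<phi>])
    then show ?thesis using pos by (simp add: abs_mult field_simps)
  qed
qed

lemma Vdual_diff:
  assumes "l \<in> Vdual \<Omega>" "k \<in> Vdual \<Omega>"
  shows "l - k \<in> Vdual \<Omega>"
proof -
  obtain B C where "\<forall>\<phi>\<in>V \<Omega>. \<bar>l \<phi>\<bar> \<le> B * normV \<Omega> \<phi>" "\<forall>\<phi>\<in>V \<Omega>. \<bar>k \<phi>\<bar> \<le> C * normV \<Omega> \<phi>"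
    using assms unfolding Vdual_def by auto
  then have "\<forall>\<phi>\<in>V \<Omega>. \<bar>(l - k) \<phi>\<bar> \<le> (B + C) * normV \<Omega> \<phi>"
    by (auto simp: distrib_right intro!: order_trans[OF abs_triangle_ineq4] add_mono)
  then show ?thesis using assms unfolding Vdual_def by (auto simp: right_diff_distrib)
qed

lemma L2_into_Vdual_integrable:
  assumes o: "open \<Omega>" and u: "L2_into (Vdual \<Omega>) (normVdual \<Omega>) {a<..<b} u" and \<phi>: "\<phi> \<in> V \<Omega>"
  shows "(\<lambda>t. u t \<phi>) absolutely_integrable_on {a..b}"
proof -
  have sm: "strongly_measurable (Vdual \<Omega>) (normVdual \<Omega>) {a<..<b} u"
    and fin: "(\<integral>\<^sup>+t\<in>{a<..<b}. ennreal ((normVdual \<Omega> (u t))\<^sup>2) \<partial>lebesgue) < \<infinity>"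
    using u by (auto simp: L2_into_def)
  \<comment> \<open>Dividing by \<open>c\<close> makes the pairing at most the dual norm in absolute
    value; the added 1 keeps \<open>c\<close> positive also for \<phi> = 0.\<close>
  define c where "c = normV \<Omega> \<phi> + 1"
  have c: "c > 0" "normV \<Omega> \<phi> \<le> c" using normV_nonneg[of \<Omega> \<phi>] by (auto simp: c_def)
  have meas: "(\<lambda>t. indicator {a<..<b} t * (u t \<phi> / c)) \<in> borel_measurable lebesgue"
  proof (rule strongly_measurable_functional[OF sm, of "\<lambda>l. l \<phi> / c"])
    fix x :: "nat \<Rightarrow> 'a L2 \<Rightarrow> real" and y
    assume *: "\<And>n. x n \<in> Vdual \<Omega>" "y \<in> Vdual \<Omega>" "(\<lambda>n. normVdual \<Omega> (x n - y)) \<longlonglongrightarrow> 0"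
    have "(\<lambda>n. x n \<phi> - y \<phi>) \<longlonglongrightarrow> 0"
    proof (rule Lim_null_comparison)
      show "(\<lambda>n. normVdual \<Omega> (x n - y) * normV \<Omega> \<phi>) \<longlonglongrightarrow> 0"
        using tendsto_mult_left_zero[OF *(3)] .
      show "\<forall>\<^sub>F n in sequentially. norm (x n \<phi> - y \<phi>) \<le> normVdual \<Omega> (x n - y) * normV \<Omega> \<phi>"
        using Vdual_pairing[OF o Vdual_diff[OF *(1,2)] \<phi>] by simp
    qed
    then show "(\<lambda>n. x n \<phi> / c) \<longlonglongrightarrow> y \<phi> / c"
      using c(1) by (intro tendsto_intros) (auto simp: LIM_zero_iff)
  qed simp
  have "(\<integral>\<^sup>+t\<in>{a<..<b}. ennreal ((u t \<phi> / c)\<^sup>2) \<partial>lebesgue)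
      \<le> (\<integral>\<^sup>+t\<in>{a<..<b}. ennreal ((normVdual \<Omega> (u t))\<^sup>2) \<partial>lebesgue)"
  proof (rule nn_integral_mono_AE)
    have "AE t in lebesgue. t \<in> {a<..<b} \<longrightarrow> u t \<in> Vdual \<Omega>"
      using sm unfolding strongly_measurable_def by (auto elim!: eventually_mono)
    then show "AE t in lebesgue. ennreal ((u t \<phi> / c)\<^sup>2) * indicator {a<..<b} t
        \<le> ennreal ((normVdual \<Omega> (u t))\<^sup>2) * indicator {a<..<b} t"
    proof eventually_elim
      case (elim t)
      show ?case
      proof (cases "t \<in> {a<..<b}")
        case True
        have le: "\<bar>u t \<phi>\<bar> \<le> normVdual \<Omega> (u t) * normV \<Omega> \<phi>"
          using Vdual_pairing[OF o _ \<phi>] elim True by blast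
        have "\<bar>u t \<phi> / c\<bar> \<le> \<bar>normVdual \<Omega> (u t)\<bar>"
        proof -
          have "\<bar>u t \<phi>\<bar> \<le> \<bar>normVdual \<Omega> (u t)\<bar> * c"
            by (rule order_trans[OF le]) (use c normV_nonneg[of \<Omega> \<phi>] in \<open>intro mult_mono, auto\<close>)
          then show ?thesis using c(1) by (simp add: abs_divide field_simps)
        qed
        then have "(u t \<phi> / c)\<^sup>2 \<le> (normVdual \<Omega> (u t))\<^sup>2"
          by (simp only: abs_le_square_iff)
        then show ?thesis using True by (simp add: ennreal_leI)
      qed simp
    qed
  qed
  then have "(\<integral>\<^sup>+t\<in>{a<..<b}. ennreal ((u t \<phi> / c)\<^sup>2) \<partial>lebesgue) < \<infinity>"
    using fin by (rule le_less_trans)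
  then have "(\<lambda>t. u t \<phi> / c) absolutely_integrable_on {a..b}"
    by (rule square_integrable_absolutely_integrable(1)[OF meas])
  then have "(\<lambda>t. c * (u t \<phi> / c)) absolutely_integrable_on {a..b}"
    by (rule set_integrable_mult_right)
  then show ?thesis using c(1) by simp
qed

lemma L2_into_norm_sq_integrable:
  fixes h :: "real \<Rightarrow> 'a::euclidean_space L2"
  assumes "L2_into X norm {a..b} h"
  shows "(\<lambda>t. (norm (h t))\<^sup>2) absolutely_integrable_on {a..b}"
proof -
  have sm: "strongly_measurable X norm {a..b} h"
    and fin: "(\<integral>\<^sup>+t\<in>{a..b}. ennreal ((norm (h t))\<^sup>2) \<partial>lebesgue) < \<infinity>"
    using assms by (auto simp: L2_into_def)
  have m0: "(\<lambda>t. indicator {a..b} t * norm (h t)) \<in> borel_measurable lebesgue"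
  proof (rule strongly_measurable_functional[OF sm, of norm])
    fix x :: "nat \<Rightarrow> 'a L2" and y assume "(\<lambda>n. norm (x n - y)) \<longlonglongrightarrow> 0"
    then have "x \<longlonglongrightarrow> y" by (simp add: tendsto_norm_zero_iff LIM_zero_iff)
    then show "(\<lambda>n. norm (x n)) \<longlonglongrightarrow> norm y" by (rule tendsto_norm)
  qed simp
  have "(\<lambda>t. indicator {a<..<b} t * (indicator {a..b} t * norm (h t))) \<in> borel_measurable lebesgue"
    by (rule borel_measurable_times[OF borel_measurable_indicator m0]) simp
  moreover have "(\<lambda>t. indicator {a<..<b} t * (indicator {a..b} t * norm (h t))) = (\<lambda>t. indicator {a<..<b} t * norm (h t))"
    by (auto simp: fun_eq_iff indicator_def)
  moreover have "(\<integral>\<^sup>+t\<in>{a<..<b}. ennreal ((norm (h t))\<^sup>2) \<partial>lebesgue) \<le> (\<integral>\<^sup>+t\<in>{a..b}. ennreal ((norm (h t))\<^sup>2) \<partial>lebesgue)"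
    by (intro nn_integral_mono) (auto simp: indicator_def)
  ultimately show ?thesis
    using fin by (intro square_integrable_absolutely_integrable(2)) auto
qed

section \<open>Weak solutions\<close>

lemma integral_le_AE:
  fixes p q :: "real \<Rightarrow> real"
  assumes p: "p absolutely_integrable_on {a..b}" and q: "q absolutely_integrable_on {a..b}"
    and le: "AE t in lebesgue. t \<in> {a<..<b} \<longrightarrow> p t \<le> q t"
  shows "integral {a..b} p \<le> integral {a..b} q"
proof -
  have "AE t in lebesgue. t \<noteq> c" for c :: real
    using AE_completion[OF AE_lborel_singleton[of c]] .
  from this[of a] this[of b] le have "AE t in lebesgue. t \<in> {a..b} \<longrightarrow> p t \<le> q t"
    by eventually_elim auto
  then have "(LINT t:{a..b}|lebesgue. p t) \<le> (LINT t:{a..b}|lebesgue. q t)"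
    by (intro set_integral_mono_AE p q)
  then show ?thesis
    by (simp add: set_lebesgue_integral_eq_integral[OF p] set_lebesgue_integral_eq_integral[OF q])
qed

text \<open>\<open>Z\<close> is the maximum of \<open>X\<close> weighted with \<open>exp (- 2 C (s - \<tau>))\<close>. Since the resulting bound
  grows in \<open>s\<close>, a bound at time \<open>s\<close> is one for the whole history, and the delayed values of \<open>X\<close> need no separate
  treatment.\<close>

lemma weighted_Gronwall:
  fixes X :: "real \<Rightarrow> real"
  assumes X: "continuous_on {\<tau> - r..T} X" and "0 \<le> r" "\<tau> \<le> T" "0 \<le> C" "0 \<le> D"
    and init: "\<And>t. t \<in> {\<tau> - r..\<tau>} \<Longrightarrow> X t \<le> D"
    and step: "\<And>Z t. (\<And>s. s \<in> {\<tau> - r..T} \<Longrightarrow> X s \<le> Z * exp (2 * C * (s - \<tau>))) \<Longrightarrow> t \<in> {\<tau>..T} \<Longrightarrow>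
      X t \<le> D + Z / 2 * exp (2 * C * (t - \<tau>))"
    and t: "t \<in> {\<tau> - r..T}"
  shows "X t \<le> 2 * D * exp (2 * C * r) * exp (2 * C * (t - \<tau>))"
proof -
  define Y where "Y s = X s * exp (- (2 * C * (s - \<tau>)))" for s
  have XY: "X s = Y s * exp (2 * C * (s - \<tau>))" for s
    by (simp add: Y_def mult.assoc flip: exp_add)
  have "continuous_on {\<tau> - r..T} Y"
    unfolding Y_def by (intro continuous_intros X)
  then obtain s0 where s0: "s0 \<in> {\<tau> - r..T}" "\<And>s. s \<in> {\<tau> - r..T} \<Longrightarrow> Y s \<le> Y s0"
    using continuous_attains_sup[of "{\<tau> - r..T}" Y] assms(2,3) by auto
  have bound: "X s \<le> Y s0 * exp (2 * C * (s - \<tau>))" if "s \<in> {\<tau> - r..T}" for s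
    unfolding XY[of s] using s0(2)[OF that] by (intro mult_right_mono) auto
  have one: "1 \<le> exp (2 * C * r)" using assms(2,4) by simp
  have "Y s0 \<le> 2 * D * exp (2 * C * r)"
  \<comment> \<open>On the initial interval the weight can enlarge \<open>X\<close>, by at most exp
    (2 C r); this is the origin of that factor in the bound.\<close>
  proof (cases "s0 \<le> \<tau>")
    case True
    have "Y s0 \<le> D * exp (- (2 * C * (s0 - \<tau>)))"
      unfolding Y_def using init[of s0] True s0(1) by (intro mult_right_mono) auto
    also have "\<dots> \<le> D * exp (2 * C * r)"
    proof (intro mult_left_mono)
      have "2 * C * (\<tau> - s0) \<le> 2 * C * r"
        using s0(1) assms(4) by (intro mult_left_mono) auto
      then show "exp (- (2 * C * (s0 - \<tau>))) \<le> exp (2 * C * r)" by (simp add: algebra_simps)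
    qed (use assms in simp)
    also have "\<dots> \<le> 2 * D * exp (2 * C * r)" using assms(5) by simp
    finally show ?thesis .
  next
    case False
    \<comment> \<open>At the maximum the inequality is self-referential: half of \<open>X s0\<close>
      reappears on the right and is absorbed.\<close>
    then have "X s0 \<le> D + Y s0 / 2 * exp (2 * C * (s0 - \<tau>))"
      using step[OF bound, of s0] s0(1) by simp
    then have "Y s0 / 2 * exp (2 * C * (s0 - \<tau>)) \<le> D"
      unfolding XY[of s0] by simp
    moreover have "1 \<le> exp (2 * C * (s0 - \<tau>))" using False assms(4) by simp
    ultimately have "Y s0 / 2 \<le> D"
      using assms(5) by (smt (verit) mult_le_cancel_left1)
    also have "D \<le> D * exp (2 * C * r)"
      using one assms(5) by (simp add: mult_le_cancel_left1)
    finally show ?thesis by simp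
  qed
  then have "Y s0 * exp (2 * C * (t - \<tau>)) \<le> 2 * D * exp (2 * C * r) * exp (2 * C * (t - \<tau>))"
    by (rule mult_right_mono) simp
  then show ?thesis using bound[OF t] by linarith
qed

lemma cont_into_HD:
  assumes "cont_into (H \<Omega>) norm I u"
  shows "continuous_on I u" "\<And>t. t \<in> I \<Longrightarrow> u t \<in> H \<Omega>"
proof -
  have "((\<lambda>s. norm (u s - u t)) \<longlongrightarrow> 0) (at t within I)" if "t \<in> I" for t
    using assms that by (simp add: cont_into_def)
  then show "continuous_on I u"
    unfolding continuous_on_def by (auto simp: tendsto_norm_zero_iff LIM_zero_iff)
  show "\<And>t. t \<in> I \<Longrightarrow> u t \<in> H \<Omega>"
    using assms by (simp add: cont_into_def)
qed

lemma sup_norm_le: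
  assumes "0 \<le> r" "\<And>\<theta>. \<theta> \<in> {-r..0} \<Longrightarrow> N (\<xi> \<theta>) \<le> B"
  shows "sup_norm r N \<xi> \<le> B"
  unfolding sup_norm_def using assms by (intro cSUP_least) auto

lemma le_sup_norm:
  assumes "continuous_on {-r..0} (\<lambda>\<theta>. N (\<xi> \<theta>))" "\<theta> \<in> {-r..0}"
  shows "N (\<xi> \<theta>) \<le> sup_norm r N \<xi>"
  unfolding sup_norm_def
  using assms(2) compact_imp_bounded[OF compact_continuous_image[OF assms(1)]]
  by (intro cSUP_upper bounded_imp_bdd_above) auto

text \<open>The Poincare constant \<open>K\<close> and the Lipschitz constant \<open>LG\<close> of
  the delay term are parameters, so that the bounds below are explicit in the data and can be chosen
  before the solutions.\<close>

locale delayed_plate =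
  fixes \<Omega> :: "'a::euclidean_space set" and lam \<mu>0 \<delta>0 r K LG :: real and f :: "real \<Rightarrow> real"
    and G :: "real \<Rightarrow> (real \<Rightarrow> 'a L2) \<Rightarrow> 'a L2" and h :: "real \<Rightarrow> 'a L2"
  assumes open_\<Omega>: "open \<Omega>" and bounded_\<Omega>: "bounded \<Omega>" and lam: "lam > 0" and r: "r > 0"
    and f: "f_hypotheses \<Omega> lam \<mu>0 \<delta>0 f"
    and K: "K > 0" "\<And>u. u \<in> V \<Omega> \<Longrightarrow> norm u \<le> K * normV \<Omega> u"
    and LG: "LG > 0" "\<And>t \<xi> \<eta>. \<xi> \<in> C_H \<Omega> r \<Longrightarrow> \<eta> \<in> C_H \<Omega> r \<Longrightarrow>
      norm (G t \<xi> - G t \<eta>) \<le> LG * sup_norm r norm (\<lambda>\<theta>. \<xi> \<theta> - \<eta> \<theta>)"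
    and G_zero: "\<And>t. G t (\<lambda>_. 0) = 0"
    and h: "L2loc_into (H \<Omega>) norm h"
begin

lemmas subspace_V = subspace_V[OF open_\<Omega>]

lemma cont_into_VD:
  assumes "cont_into (V \<Omega>) (normV \<Omega>) I u"
  shows "\<And>t. t \<in> I \<Longrightarrow> u t \<in> V \<Omega>" "continuous_on I u" "continuous_on I (\<lambda>t. laplacian \<Omega> (u t))"
    "cont_into (H \<Omega>) norm I u" "continuous_on I (\<lambda>t. compL2 f (u t))"
proof -
  show u: "u t \<in> V \<Omega>" if "t \<in> I" for t
    using assms that by (simp add: cont_into_def)
  have lim: "((\<lambda>s. normV \<Omega> (u s - u t)) \<longlongrightarrow> 0) (at t within I)" if "t \<in> I" for t
    using assms that by (simp add: cont_into_def)
  have ev: "eventually (\<lambda>s. s \<in> I) (at t within I)" for t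
    by (simp add: eventually_at_filter)
  have diff: "u s - u t \<in> V \<Omega>" if "s \<in> I" "t \<in> I" for s t
    using u that subspace_diff[OF subspace_V] by blast
  have norm_lim: "((\<lambda>s. norm (u s - u t)) \<longlongrightarrow> 0) (at t within I)" if "t \<in> I" for t
  proof (rule Lim_null_comparison)
    show "((\<lambda>s. K * normV \<Omega> (u s - u t)) \<longlongrightarrow> 0) (at t within I)"
      by (rule tendsto_mult_right_zero[OF lim[OF that]])
    show "\<forall>\<^sub>F s in at t within I. norm (norm (u s - u t)) \<le> K * normV \<Omega> (u s - u t)"
      using ev by eventually_elim (simp add: K(2) diff that)
  qed
  then show c: "cont_into (H \<Omega>) norm I u"
    using u V_subset_H by (auto simp: cont_into_def)
  show "continuous_on I u" by (rule cont_into_HD(1)[OF c])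
  show "continuous_on I (\<lambda>t. laplacian \<Omega> (u t))"
    unfolding continuous_on_def
  proof
    fix t assume t: "t \<in> I"
    have "\<forall>\<^sub>F s in at t within I. norm (laplacian \<Omega> (u s) - laplacian \<Omega> (u t)) \<le> normV \<Omega> (u s - u t)"
      using ev by eventually_elim (simp add: normV_def laplacian_diff[OF open_\<Omega>] u t)
    from Lim_null_comparison[OF this lim[OF t]]
    show "((\<lambda>t. laplacian \<Omega> (u t)) \<longlongrightarrow> laplacian \<Omega> (u t)) (at t within I)"
      by (simp add: LIM_zero_iff)
  qed
  show "continuous_on I (\<lambda>t. compL2 f (u t))"
    unfolding continuous_on_def
  proof
    fix t assume t: "t \<in> I"
    \<comment> \<open>For s near t the norms of \<open>u s\<close> and \<open>u t\<close> add up to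
      at most this radius, so a single Lipschitz constant works near t.\<close>
    have "2 * normV \<Omega> (u t) + 1 > 0" using normV_nonneg[of \<Omega> "u t"] by linarith
    from ex_compL2_Lip[OF f open_\<Omega> this] obtain L where L: "compL2_Lip \<Omega> f (2 * normV \<Omega> (u t) + 1) L" ..
    have small: "\<forall>\<^sub>F s in at t within I. normV \<Omega> (u s - u t) < 1"
      using order_tendstoD(2)[OF lim[OF t], of 1] by simp
    have "\<forall>\<^sub>F s in at t within I. norm (compL2 f (u s) - compL2 f (u t)) \<le> L * normV \<Omega> (u s - u t)"
      using ev small
    proof eventually_elim
      case (elim s)
      have "normV \<Omega> (u s) \<le> normV \<Omega> (u t) + normV \<Omega> (u s - u t)"
        using normV_triangle[OF open_\<Omega> u[OF t] diff[OF elim(1) t]] by simp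
      then show ?case using elim by (intro compL2_LipD[OF L] u t) auto
    qed
    from Lim_null_comparison[OF this tendsto_mult_right_zero[OF lim[OF t]]]
    show "((\<lambda>t. compL2 f (u t)) \<longlongrightarrow> compL2 f (u t)) (at t within I)"
      by (simp add: LIM_zero_iff)
  qed
qed

lemma hist_in_C_H:
  assumes "cont_into (H \<Omega>) norm {\<tau> - r..T} u" "t \<in> {\<tau>..T}"
  shows "hist u t \<in> C_H \<Omega> r"
proof -
  note u = cont_into_HD[OF assms(1)]
  have "continuous_on {-r..0} (hist u t)"
    unfolding hist_def
    by (rule continuous_on_compose2[OF u(1)]) (use assms(2) in \<open>auto intro!: continuous_intros\<close>)
  then have "((\<lambda>s. norm (hist u t s - hist u t \<theta>)) \<longlongrightarrow> 0) (at \<theta> within {-r..0})" if "\<theta> \<in> {-r..0}" for \<theta>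
    using that by (auto simp: continuous_on_def tendsto_norm_zero_iff LIM_zero_iff)
  moreover have "hist u t \<theta> \<in> H \<Omega>" if "\<theta> \<in> {-r..0}" for \<theta>
    unfolding hist_def using that assms(2) by (intro u(2)) auto
  ultimately show ?thesis by (simp add: C_H_def cont_into_def)
qed

text \<open>Because \<open>b\<close> is monotone, its value at t bounds the whole history up to t.
  The delay term is thereby estimated at each single time, as if there were no delay.\<close>

lemma delay_bound:
  assumes u: "cont_into (V \<Omega>) (normV \<Omega>) {\<tau> - r..T} u" and v: "cont_into (V \<Omega>) (normV \<Omega>) {\<tau> - r..T} v"
    and b: "\<And>s. s \<in> {\<tau> - r..T} \<Longrightarrow> normV \<Omega> (u s - v s) \<le> b s" "mono b"
    and t: "t \<in> {\<tau>..T}"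
  shows "norm (G t (hist u t) - G t (hist v t)) \<le> LG * K * b t"
proof -
  have "norm (G t (hist u t) - G t (hist v t)) \<le> LG * sup_norm r norm (\<lambda>\<theta>. hist u t \<theta> - hist v t \<theta>)"
    by (intro LG hist_in_C_H[OF _ t] cont_into_VD(4) u v)
  also have "\<dots> \<le> LG * (K * b t)"
  proof (intro mult_left_mono sup_norm_le)
    fix \<theta> assume \<theta>: "\<theta> \<in> {-r..0}"
    then have t\<theta>: "t + \<theta> \<in> {\<tau> - r..T}" using t by auto
    then have "u (t + \<theta>) - v (t + \<theta>) \<in> V \<Omega>"
      using cont_into_VD(1)[OF u] cont_into_VD(1)[OF v] subspace_diff[OF subspace_V] by blast
    then have "norm (u (t + \<theta>) - v (t + \<theta>)) \<le> K * normV \<Omega> (u (t + \<theta>) - v (t + \<theta>))"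
      by (rule K)
    also have "\<dots> \<le> K * b t"
      using b(1)[OF t\<theta>] monoD[OF b(2), of "t + \<theta>" t] \<theta> K(1) by (intro mult_left_mono) auto
    finally show "norm (hist u t \<theta> - hist v t \<theta>) \<le> K * b t" by (simp add: hist_def)
  qed (use LG r in auto)
  finally show ?thesis by simp
qed

section \<open>Time regularity of weak solutions and the equation integrated in time\<close>

lemma weak_solution_continuous:
  assumes "weak_solution \<Omega> lam r f G h \<tau> T \<phi>0 \<phi>1 u ut"
  shows "cont_into (V \<Omega>) (normV \<Omega>) {\<tau> - r..T} u" "cont_into (H \<Omega>) norm {\<tau> - r..T} ut"
  using assms by (simp_all add: weak_solution_def)

lemma cont_into_subset: "cont_into X N I u \<Longrightarrow> J \<subseteq> I \<Longrightarrow> cont_into X N J u"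
  unfolding cont_into_def by (meson subsetD tendsto_within_subset)

lemma weak_solution_has_vector_derivative:
  assumes ws: "weak_solution \<Omega> lam r f G h \<tau> T \<phi>0 \<phi>1 u ut" and "\<tau> < T" and t: "t \<in> {\<tau>..T}"
  shows "(u has_vector_derivative ut t) (at t within {\<tau>..T})"
proof -
  have sub: "{\<tau>..T} \<subseteq> {\<tau> - r..T}" using r by auto
  note u = cont_into_VD[OF cont_into_subset[OF weak_solution_continuous(1)[OF ws] sub]]
    and ut = cont_into_HD[OF cont_into_subset[OF weak_solution_continuous(2)[OF ws] sub]]
  show ?thesis
  proof (rule weak_derivative_has_vector_derivative[OF \<open>\<tau> < T\<close> subspace_H _ ut(2) u(2) ut(1) _ t])
    show "u t \<in> H \<Omega>" if "t \<in> {\<tau>..T}" for t using u(1)[OF that] V_subset_H by blast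
    show "distr_deriv \<tau> T (\<lambda>t. u t \<bullet> \<phi>) (\<lambda>t. ut t \<bullet> \<phi>)" if "\<phi> \<in> H \<Omega>" for \<phi>
      using ws that by (simp add: weak_solution_def)
  qed
qed

text \<open>\<open>q\<close> is the sum of all terms on the left of the equation: the dual pairing
  is integrable by \<open>L2_into_Vdual_integrable\<close>, the others are continuous once Green's
  identity has moved the gradient term onto the Laplacian of \<phi>. Only almost everywhere is it
  the pairing of the forcing with \<phi>, which thus inherits integrability.\<close>

lemma weak_solution_integrated_equation:
  assumes ws: "weak_solution \<Omega> lam r f G h \<tau> T \<phi>0 \<phi>1 u ut" and \<tau>T: "\<tau> < T" and \<phi>: "\<phi> \<in> V \<Omega>"
  obtains q where "q absolutely_integrable_on {\<tau>..T}"
    "AE t in lebesgue. t \<in> {\<tau><..<T} \<longrightarrow> q t = (G t (hist u t) + h t) \<bullet> \<phi>"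
    "\<And>s t. \<tau> \<le> s \<Longrightarrow> s \<le> t \<Longrightarrow> t \<le> T \<Longrightarrow> (ut t - ut s) \<bullet> \<phi> - (u t - u s) \<bullet> laplacian \<Omega> \<phi> +
      integral {s..t} (\<lambda>\<sigma>. laplacian \<Omega> (u \<sigma>) \<bullet> laplacian \<Omega> \<phi> + (lam *\<^sub>R u \<sigma> + compL2 f (u \<sigma>)) \<bullet> \<phi>)
      = integral {s..t} q"
proof -
  have sub: "{\<tau>..T} \<subseteq> {\<tau> - r..T}" using r by auto
  note u = cont_into_VD[OF cont_into_subset[OF weak_solution_continuous(1)[OF ws] sub]]
    and ut = cont_into_HD[OF cont_into_subset[OF weak_solution_continuous(2)[OF ws] sub]]
  obtain utt where utt: "L2_into (Vdual \<Omega>) (normVdual \<Omega>) {\<tau><..<T} utt"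
      "\<And>\<phi>. \<phi> \<in> V \<Omega> \<Longrightarrow> distr_deriv \<tau> T (\<lambda>t. ut t \<bullet> \<phi>) (\<lambda>t. utt t \<phi>)"
      "\<And>\<phi>. \<phi> \<in> V \<Omega> \<Longrightarrow> AE t in lebesgue. t \<in> {\<tau><..<T} \<longrightarrow>
           utt t \<phi> + grad_inner \<Omega> (ut t) \<phi> + laplacian \<Omega> (u t) \<bullet> laplacian \<Omega> \<phi>
             + lam * (u t \<bullet> \<phi>) + compL2 f (u t) \<bullet> \<phi>
           = G t (hist u t) \<bullet> \<phi> + h t \<bullet> \<phi>"
    using ws unfolding weak_solution_def by blast
  define g1 where "g1 \<sigma> = laplacian \<Omega> (u \<sigma>) \<bullet> laplacian \<Omega> \<phi> + (lam *\<^sub>R u \<sigma> + compL2 f (u \<sigma>)) \<bullet> \<phi>" for \<sigma>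
  have g1: "continuous_on {\<tau>..T} g1"
    unfolding g1_def by (intro continuous_intros u)
  have g2: "continuous_on {\<tau>..T} (\<lambda>\<sigma>. ut \<sigma> \<bullet> laplacian \<Omega> \<phi>)"
    by (intro continuous_intros ut)
  define q where "q \<sigma> = utt \<sigma> \<phi> - ut \<sigma> \<bullet> laplacian \<Omega> \<phi> + g1 \<sigma>" for \<sigma>
  have utt_int: "(\<lambda>t. utt t \<phi>) absolutely_integrable_on {\<tau>..T}"
    by (rule L2_into_Vdual_integrable[OF open_\<Omega> utt(1) \<phi>])
  have "q absolutely_integrable_on {\<tau>..T}"
    unfolding q_def
    by (intro set_integral_add set_integral_diff utt_int absolutely_integrable_continuous_real g1 g2)
  moreover have "AE t in lebesgue. t \<in> {\<tau><..<T} \<longrightarrow> q t = (G t (hist u t) + h t) \<bullet> \<phi>"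
  proof -
    have "strongly_measurable (H10 \<Omega>) (normH1 \<Omega>) {\<tau><..<T} ut"
      using ws by (simp add: weak_solution_def L2_into_def)
    then have "AE t in lebesgue. t \<in> {\<tau><..<T} \<longrightarrow> ut t \<in> H10 \<Omega>"
      unfolding strongly_measurable_def by (auto elim!: eventually_mono)
    with utt(3)[OF \<phi>] show ?thesis
    proof eventually_elim
      case (elim t)
      then show ?case
        using Green_identity[OF open_\<Omega> \<phi>, of "ut t"] by (auto simp: q_def g1_def inner_add_left)
    qed
  qed
  moreover have "(ut t - ut s) \<bullet> \<phi> - (u t - u s) \<bullet> laplacian \<Omega> \<phi> + integral {s..t} g1 = integral {s..t} q"
    if st: "\<tau> \<le> s" "s \<le> t" "t \<le> T" for s t
  proof -
    have "((\<lambda>\<sigma>. utt \<sigma> \<phi>) has_integral (ut t \<bullet> \<phi> - ut s \<bullet> \<phi>)) {s..t}"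
      by (rule distr_deriv_has_integral[OF utt(2)[OF \<phi>] \<tau>T _ utt_int st])
        (intro continuous_intros ut)
    \<comment> \<open>Since \<open>ut\<close> is the derivative of \<open>u\<close>, the viscous
      term integrates exactly to an increment of \<open>u\<close>; no second time derivative is
      involved.\<close>
    moreover have "((\<lambda>\<sigma>. ut \<sigma> \<bullet> laplacian \<Omega> \<phi>) has_integral (u t \<bullet> laplacian \<Omega> \<phi> - u s \<bullet> laplacian \<Omega> \<phi>)) {s..t}"
    proof (rule fundamental_theorem_of_calculus[OF st(2)])
      fix x assume "x \<in> {s..t}"
      then have "(u has_vector_derivative ut x) (at x within {s..t})"
        using st by (intro has_vector_derivative_within_subset[OF weak_solution_has_vector_derivative[OF ws \<tau>T]]) auto
      then show "((\<lambda>x. u x \<bullet> laplacian \<Omega> \<phi>) has_vector_derivative ut x \<bullet> laplacian \<Omega> \<phi>) (at x within {s..t})"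
        by (rule bounded_linear.has_vector_derivative[OF bounded_linear_inner_left])
    qed
    moreover have "(g1 has_integral integral {s..t} g1) {s..t}"
      using st by (intro integrable_integral integrable_continuous_real continuous_on_subset[OF g1]) auto
    ultimately have "(q has_integral (ut t \<bullet> \<phi> - ut s \<bullet> \<phi> - (u t \<bullet> laplacian \<Omega> \<phi> - u s \<bullet> laplacian \<Omega> \<phi>)
        + integral {s..t} g1)) {s..t}"
      unfolding q_def by (intro has_integral_add has_integral_diff)
    then show ?thesis by (simp add: integral_unique inner_diff_left)
  qed
  ultimately show ?thesis using that unfolding g1_def by blast
qed

lemma laplacian_inner_nonpos: "\<phi> \<in> V \<Omega> \<Longrightarrow> \<phi> \<bullet> laplacian \<Omega> \<phi> \<le> 0"
proof -
  assume \<phi>: "\<phi> \<in> V \<Omega>"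
  have "0 \<le> grad_inner \<Omega> \<phi> \<phi>" by (simp add: grad_inner_def sum_nonneg)
  moreover have "\<phi> \<in> H10 \<Omega>" using \<phi> V_subset_H10 by blast
  ultimately show ?thesis using Green_identity[OF open_\<Omega> \<phi>, of \<phi>] by simp
qed

end

section \<open>The energy estimate in the presence of delay\<close>

lemma exp_has_integral:
  assumes "C > 0" "a \<le> (b :: real)"
  shows "((\<lambda>s. exp (2 * C * (s - \<tau>))) has_integral
    (exp (2 * C * (b - \<tau>)) / (2 * C) - exp (2 * C * (a - \<tau>)) / (2 * C))) {a..b}"
proof (rule fundamental_theorem_of_calculus[OF assms(2)])
  fix x
  show "((\<lambda>s. exp (2 * C * (s - \<tau>)) / (2 * C)) has_vector_derivative exp (2 * C * (x - \<tau>))) (at x within {a..b})"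
    unfolding has_real_derivative_iff_has_vector_derivative[symmetric]
    using assms(1) by (auto intro!: derivative_eq_intros simp: field_simps)
qed

lemma sq_le_exp_sq:
  assumes "x\<^sup>2 \<le> Z * exp (2 * C * s)" "0 \<le> Z"
  shows "x \<le> sqrt Z * exp (C * s)"
proof (rule power2_le_imp_le)
  have "(sqrt Z * exp (C * s))\<^sup>2 = Z * exp (2 * C * s)"
    using assms(2) by (simp add: power_mult_distrib exp_double[symmetric] mult.assoc)
  then show "x\<^sup>2 \<le> (sqrt Z * exp (C * s))\<^sup>2" using assms(1) by simp
qed (use assms(2) in simp)

lemma Young_half: "x * y \<le> 1/2 * y\<^sup>2 + 1/2 * (x::real)\<^sup>2"
proof -
  have "0 \<le> (x - y)\<^sup>2" by simp
  then show ?thesis by (simp add: power2_diff)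
qed

context delayed_plate
begin

text \<open>The common core of both estimates. \<open>k\<close> collects lower-order terms kept on
  the left, \<Psi> is the primitive in time of their pairing with \<open>w'\<close>, and
  \<open>g\<close> is forcing independent of \<open>w\<close>. \<open>ineq\<close> is required for
  every monotone continuous majorant \<open>b\<close> because a delayed term can be estimated only
  against a bound on the whole past; it is used with the exponential majorant of the Gronwall
  lemma.\<close>

lemma energy_Gronwall:
  fixes w w' k :: "real \<Rightarrow> 'a L2" and g \<Psi> :: "real \<Rightarrow> real"
  assumes \<tau>T: "\<tau> < T" and w: "\<And>s. s \<in> {\<tau> - r..T} \<Longrightarrow> w s \<in> V \<Omega>"
    and cont: "continuous_on {\<tau> - r..T} w'" "continuous_on {\<tau> - r..T} (\<lambda>s. laplacian \<Omega> (w s))"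
      "continuous_on {\<tau> - r..T} k"
    and der: "\<And>s. s \<in> {\<tau>..T} \<Longrightarrow> (w has_vector_derivative w' s) (at s within {\<tau>..T})"
    and \<Psi>: "\<And>s. s \<in> {\<tau>..T} \<Longrightarrow> (\<Psi> has_real_derivative k s \<bullet> w' s) (at s within {\<tau>..T})"
    and g: "\<And>x y. g integrable_on {x..y}" "\<And>s. 0 \<le> g s"
    and ineq: "\<And>b \<phi> x y. mono b \<Longrightarrow> continuous_on UNIV b \<Longrightarrow>
      (\<And>s. s \<in> {\<tau> - r..T} \<Longrightarrow> normV \<Omega> (w s) \<le> b s) \<Longrightarrow>
      \<phi> \<in> V \<Omega> \<Longrightarrow> \<tau> \<le> x \<Longrightarrow> x \<le> y \<Longrightarrow> y \<le> T \<Longrightarrow>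
      (w' y - w' x) \<bullet> \<phi> - (w y - w x) \<bullet> laplacian \<Omega> \<phi> +
        integral {x..y} (\<lambda>\<sigma>. laplacian \<Omega> (w \<sigma>) \<bullet> laplacian \<Omega> \<phi> + k \<sigma> \<bullet> \<phi>)
      \<le> integral {x..y} (\<lambda>\<sigma>. 1/2 * (norm \<phi>)\<^sup>2 + (c\<^sup>2 * (b \<sigma>)\<^sup>2 + g \<sigma>))"
    and init: "\<And>s. s \<in> {\<tau> - r..\<tau>} \<Longrightarrow> (norm (w' s))\<^sup>2 + (normV \<Omega> (w s))\<^sup>2 \<le> D"
    and D: "\<And>t. t \<in> {\<tau>..T} \<Longrightarrow> (norm (w' \<tau>))\<^sup>2 + (normV \<Omega> (w \<tau>))\<^sup>2
      + 2 * \<Psi> \<tau> - 2 * \<Psi> t + 2 * integral {\<tau>..T} g \<le> D"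
    and t: "t \<in> {\<tau> - r..T}"
  shows "(norm (w' t))\<^sup>2 + (normV \<Omega> (w t))\<^sup>2
    \<le> 2 * D * exp (2 * (1 + 2 * c\<^sup>2) * r) * exp (2 * (1 + 2 * c\<^sup>2) * (t - \<tau>))"
proof -
  \<comment> \<open>The 1 accounts for the integral of |w'|^2 and 2 c^2 for the delayed forcing;
    integrating the weight divides by 2 C and leaves exactly the factor 1/2 that
    \<open>weighted_Gronwall\<close> asks for.\<close>
  define C where "C = 1 + 2 * c\<^sup>2"
  have C: "C > 0" by (simp add: C_def add_pos_nonneg)
  define X where "X s = (norm (w' s))\<^sup>2 + (normV \<Omega> (w s))\<^sup>2" for s
  have X0: "0 \<le> X s" for s by (simp add: X_def)
  have D0: "0 \<le> D" by (rule order_trans[OF X0[of \<tau>]]) (use init[of \<tau>] r in \<open>simp add: X_def\<close>)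
  have "X t \<le> 2 * D * exp (2 * C * r) * exp (2 * C * (t - \<tau>))"
  proof (rule weighted_Gronwall[OF _ _ _ _ D0 _ _ t])
    show "continuous_on {\<tau> - r..T} X"
      unfolding X_def normV_def by (intro continuous_intros cont)
    show "X s \<le> D" if "s \<in> {\<tau> - r..\<tau>}" for s using init[OF that] by (simp add: X_def)
    fix Z t assume Z: "\<And>s. s \<in> {\<tau> - r..T} \<Longrightarrow> X s \<le> Z * exp (2 * C * (s - \<tau>))" and t: "t \<in> {\<tau>..T}"
    have Z0: "0 \<le> Z"
    proof -
      have "0 \<le> Z * exp (2 * C * (t - \<tau>))" using Z[of t] X0[of t] t r by fastforce
      then show ?thesis by (simp add: zero_le_mult_iff)
    qed
    \<comment> \<open>The square root of the assumed bound on the energy; it increases in time,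
      hence is an admissible majorant of \<open>normV \<Omega> (w s)\<close>.\<close>
    define b where "b s = sqrt Z * exp (C * (s - \<tau>))" for s
    have b_sq: "(b s)\<^sup>2 = Z * exp (2 * C * (s - \<tau>))" for s
      using Z0 by (simp add: b_def power_mult_distrib exp_double[symmetric] mult.assoc)
    have b_mono: "mono b"
      unfolding b_def using Z0 C by (intro monoI mult_left_mono) auto
    have normV_le: "normV \<Omega> (w s) \<le> b s" and norm_le: "(norm (w' s))\<^sup>2 \<le> Z * exp (2 * C * (s - \<tau>))"
      if "s \<in> {\<tau> - r..T}" for s
    proof -
      have nn: "0 \<le> (norm (w' s))\<^sup>2" "0 \<le> (normV \<Omega> (w s))\<^sup>2" by simp_all
      show "normV \<Omega> (w s) \<le> b s"
        unfolding b_def by (rule sq_le_exp_sq[OF _ Z0]) (use Z[OF that, unfolded X_def] nn in linarith)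
      show "(norm (w' s))\<^sup>2 \<le> Z * exp (2 * C * (s - \<tau>))"
        using Z[OF that, unfolded X_def] nn by linarith
    qed
    \<comment> \<open>Twice a primitive of c^2 b^2 + g, so that the right-hand side of
      \<open>ineq\<close> takes the form required by
      \<open>integrated_plate_equation\<close>.\<close>
    define \<eta> where "\<eta> s = 2 * (c\<^sup>2 * Z * (exp (2 * C * (s - \<tau>)) / (2 * C)) + integral {\<tau>..s} g)" for s
    have \<eta>_int: "((\<lambda>s. c\<^sup>2 * (b s)\<^sup>2 + g s) has_integral (\<eta> y - \<eta> x) / 2) {x..y}"
      if "\<tau> \<le> x" "x \<le> y" for x y
    proof -
      let ?E = "\<lambda>s. exp (2 * C * (s - \<tau>)) / (2 * C)" and ?N = "\<lambda>s. integral {\<tau>..s} g"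
      have "((\<lambda>s. c\<^sup>2 * Z * exp (2 * C * (s - \<tau>)) + g s) has_integral
          c\<^sup>2 * Z * (?E y - ?E x) + integral {x..y} g) {x..y}"
        by (intro has_integral_add has_integral_mult_right exp_has_integral C that integrable_integral g(1))
      moreover have "integral {x..y} g = ?N y - ?N x"
        using Henstock_Kurzweil_Integration.integral_combine[OF that g(1)] by linarith
      moreover have "c\<^sup>2 * Z * (?E y - ?E x) + (?N y - ?N x) = (\<eta> y - \<eta> x) / 2"
      proof -
        have "k * (a - b) + (p - q) = (2 * (k * a + p) - 2 * (k * b + q)) / 2" for k a b p q :: real
          by (simp add: field_simps)
        then show ?thesis unfolding \<eta>_def .
      qed
      ultimately show ?thesis by (simp only: b_sq mult.assoc)
    qed
    have "(norm (w' t))\<^sup>2 + (norm (laplacian \<Omega> (w t)))\<^sup>2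
        - ((norm (w' \<tau>))\<^sup>2 + (norm (laplacian \<Omega> (w \<tau>)))\<^sup>2)
      \<le> integral {\<tau>..t} (\<lambda>s. (norm (w' s))\<^sup>2 - 2 * (k s \<bullet> w' s)) + (\<eta> t - \<eta> \<tau>)"
    proof (rule integrated_plate_equation.energy_inequality[where S="V \<Omega>" and L="laplacian \<Omega>"], unfold_locales)
      have sub: "{\<tau>..t} \<subseteq> {\<tau> - r..T}" using t r by auto
      show "\<tau> \<le> t" using t by simp
      show "subspace (V \<Omega>)" by (rule subspace_V)
      show "w s \<in> V \<Omega>" if "s \<in> {\<tau>..t}" for s using w that sub by blast
      show "laplacian \<Omega> (\<phi> - \<psi>) = laplacian \<Omega> \<phi> - laplacian \<Omega> \<psi>" if "\<phi> \<in> V \<Omega>" "\<psi> \<in> V \<Omega>" for \<phi> \<psi>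
        by (rule laplacian_diff[OF open_\<Omega> that])
      show "laplacian \<Omega> (a *\<^sub>R \<phi>) = a *\<^sub>R laplacian \<Omega> \<phi>" if "\<phi> \<in> V \<Omega>" for \<phi> a
        by (rule laplacian_scale[OF open_\<Omega> that])
      show "\<phi> \<bullet> laplacian \<Omega> \<phi> \<le> 0" if "\<phi> \<in> V \<Omega>" for \<phi>
        by (rule laplacian_inner_nonpos[OF that])
      show "(w has_vector_derivative w' s) (at s within {\<tau>..t})" if "s \<in> {\<tau>..t}" for s
        using t that by (intro has_vector_derivative_within_subset[OF der]) auto
      show "continuous_on {\<tau>..t} w'" "continuous_on {\<tau>..t} (\<lambda>s. laplacian \<Omega> (w s))" "continuous_on {\<tau>..t} k"
        by (rule continuous_on_subset[OF cont(1) sub] continuous_on_subset[OF cont(2) sub]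
            continuous_on_subset[OF cont(3) sub])+
      show "continuous_on {\<tau>..t} \<eta>"
        unfolding \<eta>_def using C
        by (intro continuous_intros indefinite_integral_continuous_1 g(1)) simp
      fix \<phi> x y assume \<phi>: "\<phi> \<in> V \<Omega>" and xy: "\<tau> \<le> x" "x \<le> y" "y \<le> t"
      have "((\<lambda>\<sigma>. 1/2 * (norm \<phi>)\<^sup>2) has_integral (y - x) *\<^sub>R (1/2 * (norm \<phi>)\<^sup>2)) {x..y}"
        using has_integral_const_real[of "1/2 * (norm \<phi>)\<^sup>2" x y] xy(2) by simp
      from has_integral_add[OF this \<eta>_int[OF xy(1,2)]]
      have "integral {x..y} (\<lambda>\<sigma>. 1/2 * (norm \<phi>)\<^sup>2 + (c\<^sup>2 * (b \<sigma>)\<^sup>2 + g \<sigma>))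
          = (y - x) / 2 * (norm \<phi>)\<^sup>2 + (\<eta> y - \<eta> x) / 2" by (simp add: integral_unique)
      moreover have "continuous_on UNIV b" unfolding b_def by (intro continuous_intros)
      ultimately show "(w' y - w' x) \<bullet> \<phi> - (w y - w x) \<bullet> laplacian \<Omega> \<phi> +
          integral {x..y} (\<lambda>\<sigma>. laplacian \<Omega> (w \<sigma>) \<bullet> laplacian \<Omega> \<phi> + k \<sigma> \<bullet> \<phi>)
        \<le> (y - x) / 2 * (norm \<phi>)\<^sup>2 + (\<eta> y - \<eta> x) / 2"
        using ineq[OF b_mono _ normV_le \<phi> xy(1,2)] xy(3) t by simp
    qed
    then have e1: "X t \<le> X \<tau> + integral {\<tau>..t} (\<lambda>s. (norm (w' s))\<^sup>2 - 2 * (k s \<bullet> w' s)) + (\<eta> t - \<eta> \<tau>)"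
      by (simp add: X_def normV_def)
    have w'_int: "(\<lambda>s. (norm (w' s))\<^sup>2) integrable_on {\<tau>..t}"
      using t r by (intro integrable_continuous_real continuous_intros continuous_on_subset[OF cont(1)]) auto
    have k_int: "((\<lambda>s. k s \<bullet> w' s) has_integral (\<Psi> t - \<Psi> \<tau>)) {\<tau>..t}"
    proof (rule fundamental_theorem_of_calculus)
      show "(\<Psi> has_vector_derivative k s \<bullet> w' s) (at s within {\<tau>..t})" if "s \<in> {\<tau>..t}" for s
        unfolding has_real_derivative_iff_has_vector_derivative[symmetric]
        using t that by (intro DERIV_subset[OF \<Psi>]) auto
    qed (use t in simp)
    \<comment> \<open>The terms in \<open>k\<close> contribute only the increment of \<Psi>; no size
      bound on \<open>k\<close> is needed.\<close>
    have e2: "integral {\<tau>..t} (\<lambda>s. (norm (w' s))\<^sup>2 - 2 * (k s \<bullet> w' s))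
        = integral {\<tau>..t} (\<lambda>s. (norm (w' s))\<^sup>2) - 2 * (\<Psi> t - \<Psi> \<tau>)"
      by (intro integral_unique has_integral_diff has_integral_mult_right k_int integrable_integral w'_int)
    have e3: "integral {\<tau>..t} (\<lambda>s. (norm (w' s))\<^sup>2)
        \<le> Z * (exp (2 * C * (t - \<tau>)) / (2 * C) - exp (2 * C * (\<tau> - \<tau>)) / (2 * C))"
    proof (rule has_integral_le[OF integrable_integral[OF w'_int]])
      show "((\<lambda>s. Z * exp (2 * C * (s - \<tau>))) has_integral
          Z * (exp (2 * C * (t - \<tau>)) / (2 * C) - exp (2 * C * (\<tau> - \<tau>)) / (2 * C))) {\<tau>..t}"
        using t by (intro has_integral_mult_right exp_has_integral C) auto
      show "(norm (w' s))\<^sup>2 \<le> Z * exp (2 * C * (s - \<tau>))" if "s \<in> {\<tau>..t}" for s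
        using norm_le[of s] that t r by auto
    qed
    have e4: "Z * (exp (2 * C * (t - \<tau>)) / (2 * C) - exp (2 * C * (\<tau> - \<tau>)) / (2 * C)) + (\<eta> t - \<eta> \<tau>)
        \<le> Z / 2 * exp (2 * C * (t - \<tau>)) + 2 * integral {\<tau>..T} g"
    proof -
      have "Z * (exp (2 * C * (t - \<tau>)) / (2 * C) - exp (2 * C * (\<tau> - \<tau>)) / (2 * C)) + (\<eta> t - \<eta> \<tau>)
          = Z * (1 + 2 * c\<^sup>2) * (exp (2 * C * (t - \<tau>)) - 1) / (2 * C) + 2 * integral {\<tau>..t} g"
        by (simp add: \<eta>_def algebra_simps add_divide_distrib diff_divide_distrib)
      also have "Z * (1 + 2 * c\<^sup>2) * (exp (2 * C * (t - \<tau>)) - 1) / (2 * C) = Z / 2 * (exp (2 * C * (t - \<tau>)) - 1)"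
        unfolding C_def[symmetric] using C by simp
      also have "\<dots> \<le> Z / 2 * exp (2 * C * (t - \<tau>))" using Z0 by (intro mult_left_mono) auto
      also have "integral {\<tau>..t} g \<le> integral {\<tau>..T} g"
        using t by (intro integral_subset_le g(1)) (auto intro: g(2))
      finally show ?thesis by simp
    qed
    \<comment> \<open>The chain of the four estimates and the bound on \<open>D\<close>, isolated as
      a linear fact about abstract reals.\<close>
    have "x \<le> d + z"
      if "x \<le> x0 + i + e" "i = j - 2 * (p - q)" "j \<le> v" "v + e \<le> z + 2 * G" "x0 + 2 * q - 2 * p + 2 * G \<le> d"
      for x x0 i e j p q v z d G :: real
      using that by argo
    from this[OF e1 e2 e3 e4 D[OF t, folded X_def]] show "X t \<le> D + Z / 2 * exp (2 * C * (t - \<tau>))" .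
  qed (use r \<tau>T C in auto)
  then show ?thesis by (simp add: X_def C_def)
qed

text \<open>All zeroth-order terms count as forcing, so \<open>k\<close> and \<Psi> are 0, and
  \<open>h\<close> cancels. Each remaining term is Lipschitz in \<open>normV\<close>: the delay with
  \<open>LG * K\<close>, the linear term with \<open>lam * K\<close>, the nonlinearity with
  \<open>L\<close> since both solutions stay within the radius; \<open>c\<close> is the sum.\<close>

lemma difference_bound:
  assumes ws1: "weak_solution \<Omega> lam r f G h \<tau> T \<phi>01 \<phi>11 u ut"
    and ws2: "weak_solution \<Omega> lam r f G h \<tau> T \<phi>02 \<phi>12 v vt" and \<tau>T: "\<tau> < T"
    and L: "compL2_Lip \<Omega> f R L"
    and R: "\<And>s. s \<in> {\<tau>..T} \<Longrightarrow> normV \<Omega> (u s) + normV \<Omega> (v s) \<le> R"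
    and D: "\<And>s. s \<in> {\<tau> - r..\<tau>} \<Longrightarrow> (norm (ut s - vt s))\<^sup>2 + (normV \<Omega> (u s - v s))\<^sup>2 \<le> D"
    and c: "c = LG * K + (lam * K + L)" and t: "t \<in> {\<tau> - r..T}"
  shows "(norm (ut t - vt t))\<^sup>2 + (normV \<Omega> (u t - v t))\<^sup>2
    \<le> 2 * D * exp (2 * (1 + 2 * c\<^sup>2) * r) * exp (2 * (1 + 2 * c\<^sup>2) * (t - \<tau>))"
proof -
  note cu = weak_solution_continuous[OF ws1] and cv = weak_solution_continuous[OF ws2]
  note u = cont_into_VD[OF cu(1)] and v = cont_into_VD[OF cv(1)]
    and ut = cont_into_HD[OF cu(2)] and vt = cont_into_HD[OF cv(2)]
  have w: "u s - v s \<in> V \<Omega>" if "s \<in> {\<tau> - r..T}" for s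
    using u(1) v(1) that subspace_diff[OF subspace_V] by blast
  have lap: "laplacian \<Omega> (u s - v s) = laplacian \<Omega> (u s) - laplacian \<Omega> (v s)" if "s \<in> {\<tau> - r..T}" for s
    using u(1) v(1) that laplacian_diff[OF open_\<Omega>] by blast
  have lap_cont: "continuous_on {\<tau> - r..T} (\<lambda>s. laplacian \<Omega> (u s - v s))"
    by (rule continuous_on_eq[OF continuous_on_diff[OF u(3) v(3)]]) (simp add: lap)
  show ?thesis
  proof (rule energy_Gronwall[where w="\<lambda>s. u s - v s" and w'="\<lambda>s. ut s - vt s" and k="\<lambda>s. 0" and \<Psi>="\<lambda>s. 0"
        and g="\<lambda>s. 0", OF \<tau>T w _ lap_cont _ _ _ _ _ _ D _ t])
    show "continuous_on {\<tau> - r..T} (\<lambda>s. ut s - vt s)" by (intro continuous_intros ut vt)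
    show "((\<lambda>s. u s - v s) has_vector_derivative ut s - vt s) (at s within {\<tau>..T})" if "s \<in> {\<tau>..T}" for s
      using weak_solution_has_vector_derivative[OF ws1 \<tau>T that] weak_solution_has_vector_derivative[OF ws2 \<tau>T that]
      by (rule has_vector_derivative_diff)
    show "(norm (ut \<tau> - vt \<tau>))\<^sup>2 + (normV \<Omega> (u \<tau> - v \<tau>))\<^sup>2 + 2 * 0 - 2 * 0 + 2 * integral {\<tau>..T} (\<lambda>s. 0) \<le> D"
      using D[of \<tau>] r by simp
    fix b :: "real \<Rightarrow> real" and \<phi> x y assume b_mono: "mono b" and b_cont: "continuous_on UNIV b"
      and normV_le: "\<And>s. s \<in> {\<tau> - r..T} \<Longrightarrow> normV \<Omega> (u s - v s) \<le> b s"
      and \<phi>: "\<phi> \<in> V \<Omega>" and xy: "\<tau> \<le> x" "x \<le> y" and yT: "y \<le> T"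
    have xy_sub: "{x..y} \<subseteq> {\<tau>..T}" "{x..y} \<subseteq> {\<tau> - r..T}" using xy yT r by auto
    from weak_solution_integrated_equation[OF ws1 \<tau>T \<phi>]
    obtain p where p: "p absolutely_integrable_on {\<tau>..T}"
      "AE t in lebesgue. t \<in> {\<tau><..<T} \<longrightarrow> p t = (G t (hist u t) + h t) \<bullet> \<phi>"
      "\<And>s t. \<tau> \<le> s \<Longrightarrow> s \<le> t \<Longrightarrow> t \<le> T \<Longrightarrow> (ut t - ut s) \<bullet> \<phi> - (u t - u s) \<bullet> laplacian \<Omega> \<phi> +
        integral {s..t} (\<lambda>\<sigma>. laplacian \<Omega> (u \<sigma>) \<bullet> laplacian \<Omega> \<phi> + (lam *\<^sub>R u \<sigma> + compL2 f (u \<sigma>)) \<bullet> \<phi>)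
        = integral {s..t} p" by blast
    from weak_solution_integrated_equation[OF ws2 \<tau>T \<phi>]
    obtain q where q: "q absolutely_integrable_on {\<tau>..T}"
      "AE t in lebesgue. t \<in> {\<tau><..<T} \<longrightarrow> q t = (G t (hist v t) + h t) \<bullet> \<phi>"
      "\<And>s t. \<tau> \<le> s \<Longrightarrow> s \<le> t \<Longrightarrow> t \<le> T \<Longrightarrow> (vt t - vt s) \<bullet> \<phi> - (v t - v s) \<bullet> laplacian \<Omega> \<phi> +
        integral {s..t} (\<lambda>\<sigma>. laplacian \<Omega> (v \<sigma>) \<bullet> laplacian \<Omega> \<phi> + (lam *\<^sub>R v \<sigma> + compL2 f (v \<sigma>)) \<bullet> \<phi>)
        = integral {s..t} q" by blast
    note conts = continuous_on_subset[OF u(2) xy_sub(2)] continuous_on_subset[OF u(3) xy_sub(2)]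
      continuous_on_subset[OF u(5) xy_sub(2)] continuous_on_subset[OF v(2) xy_sub(2)]
      continuous_on_subset[OF v(3) xy_sub(2)] continuous_on_subset[OF v(5) xy_sub(2)]
    have pq: "p absolutely_integrable_on {x..y}" "q absolutely_integrable_on {x..y}"
      using absolutely_integrable_on_subinterval[OF p(1) xy_sub(1)]
        absolutely_integrable_on_subinterval[OF q(1) xy_sub(1)] by auto
    \<comment> \<open>The linear and nonlinear differences, which the two integrated equations carry
      on the left and which are moved to the right here.\<close>
    define d where "d \<sigma> = (lam *\<^sub>R (u \<sigma> - v \<sigma>) + (compL2 f (u \<sigma>) - compL2 f (v \<sigma>))) \<bullet> \<phi>" for \<sigma>
    have d_int: "d absolutely_integrable_on {x..y}"
      unfolding d_def by (intro absolutely_integrable_continuous_real continuous_intros conts)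
    have "integral {x..y} (\<lambda>\<sigma>. laplacian \<Omega> (u \<sigma> - v \<sigma>) \<bullet> laplacian \<Omega> \<phi> + 0 \<bullet> \<phi>)
        = integral {x..y} (\<lambda>\<sigma>. (laplacian \<Omega> (u \<sigma>) \<bullet> laplacian \<Omega> \<phi> + (lam *\<^sub>R u \<sigma> + compL2 f (u \<sigma>)) \<bullet> \<phi>)
            - (laplacian \<Omega> (v \<sigma>) \<bullet> laplacian \<Omega> \<phi> + (lam *\<^sub>R v \<sigma> + compL2 f (v \<sigma>)) \<bullet> \<phi>) - d \<sigma>)"
    proof (rule integral_cong)
      fix \<sigma> assume "\<sigma> \<in> {x..y}"
      then have lap\<sigma>: "laplacian \<Omega> (u \<sigma> - v \<sigma>) = laplacian \<Omega> (u \<sigma>) - laplacian \<Omega> (v \<sigma>)"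
        using lap xy_sub(2) by blast
      show "laplacian \<Omega> (u \<sigma> - v \<sigma>) \<bullet> laplacian \<Omega> \<phi> + 0 \<bullet> \<phi>
        = (laplacian \<Omega> (u \<sigma>) \<bullet> laplacian \<Omega> \<phi> + (lam *\<^sub>R u \<sigma> + compL2 f (u \<sigma>)) \<bullet> \<phi>)
            - (laplacian \<Omega> (v \<sigma>) \<bullet> laplacian \<Omega> \<phi> + (lam *\<^sub>R v \<sigma> + compL2 f (v \<sigma>)) \<bullet> \<phi>) - d \<sigma>"
        unfolding lap\<sigma> by (simp add: d_def inner_add_left inner_diff_left algebra_simps)
    qed
    also have "\<dots> = integral {x..y} (\<lambda>\<sigma>. laplacian \<Omega> (u \<sigma>) \<bullet> laplacian \<Omega> \<phi> + (lam *\<^sub>R u \<sigma> + compL2 f (u \<sigma>)) \<bullet> \<phi>)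
        - integral {x..y} (\<lambda>\<sigma>. laplacian \<Omega> (v \<sigma>) \<bullet> laplacian \<Omega> \<phi> + (lam *\<^sub>R v \<sigma> + compL2 f (v \<sigma>)) \<bullet> \<phi>)
        - integral {x..y} d"
      by (intro integral_unique has_integral_diff integrable_integral integrable_continuous_real continuous_intros conts
          set_lebesgue_integral_eq_integral(1)[OF d_int])
    finally have "(ut y - vt y - (ut x - vt x)) \<bullet> \<phi> - (u y - v y - (u x - v x)) \<bullet> laplacian \<Omega> \<phi> +
        integral {x..y} (\<lambda>\<sigma>. laplacian \<Omega> (u \<sigma> - v \<sigma>) \<bullet> laplacian \<Omega> \<phi> + 0 \<bullet> \<phi>)
        = integral {x..y} p - integral {x..y} q - integral {x..y} d"
      using p(3)[OF xy(1,2) yT] q(3)[OF xy(1,2) yT] by (simp only: inner_diff_left)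
    also have "\<dots> = integral {x..y} (\<lambda>\<sigma>. p \<sigma> - q \<sigma> - d \<sigma>)"
      by (intro integral_unique[symmetric] has_integral_diff integrable_integral
          set_lebesgue_integral_eq_integral(1) pq d_int)
    also have "\<dots> \<le> integral {x..y} (\<lambda>\<sigma>. 1/2 * (norm \<phi>)\<^sup>2 + (c\<^sup>2 * (b \<sigma>)\<^sup>2 + 0))"
    proof (rule integral_le_AE)
      show "(\<lambda>\<sigma>. p \<sigma> - q \<sigma> - d \<sigma>) absolutely_integrable_on {x..y}"
        by (intro set_integral_diff pq d_int)
      show "(\<lambda>\<sigma>. 1/2 * (norm \<phi>)\<^sup>2 + (c\<^sup>2 * (b \<sigma>)\<^sup>2 + 0)) absolutely_integrable_on {x..y}"
        by (intro absolutely_integrable_continuous_real continuous_intros continuous_on_subset[OF b_cont]) auto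
      show "AE \<sigma> in lebesgue. \<sigma> \<in> {x<..<y} \<longrightarrow> p \<sigma> - q \<sigma> - d \<sigma> \<le> 1/2 * (norm \<phi>)\<^sup>2 + (c\<^sup>2 * (b \<sigma>)\<^sup>2 + 0)"
        using p(2) q(2)
      proof eventually_elim
        case (elim \<sigma>)
        show ?case
        proof
          assume \<sigma>: "\<sigma> \<in> {x<..<y}"
          then have \<sigma>': "\<sigma> \<in> {\<tau><..<T}" "\<sigma> \<in> {\<tau>..T}" "\<sigma> \<in> {\<tau> - r..T}" using xy yT r by auto
          have "p \<sigma> - q \<sigma> - d \<sigma> = (G \<sigma> (hist u \<sigma>) - G \<sigma> (hist v \<sigma>)
              - (lam *\<^sub>R (u \<sigma> - v \<sigma>) + (compL2 f (u \<sigma>) - compL2 f (v \<sigma>)))) \<bullet> \<phi>"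
            using elim \<sigma>'(1) by (simp add: d_def inner_diff_left inner_add_left)
          also have "\<dots> \<le> norm (G \<sigma> (hist u \<sigma>) - G \<sigma> (hist v \<sigma>)
              - (lam *\<^sub>R (u \<sigma> - v \<sigma>) + (compL2 f (u \<sigma>) - compL2 f (v \<sigma>)))) * norm \<phi>"
            by (rule norm_cauchy_schwarz)
          also have "\<dots> \<le> (c * b \<sigma>) * norm \<phi>"
          proof (rule mult_right_mono)
            have "norm (g - (l + k)) \<le> norm g + (norm l + norm k)" for g l k :: "'a L2"
              using norm_triangle_ineq4[of g "l + k"] norm_triangle_ineq[of l k] by linarith
            then have "norm (G \<sigma> (hist u \<sigma>) - G \<sigma> (hist v \<sigma>)
              - (lam *\<^sub>R (u \<sigma> - v \<sigma>) + (compL2 f (u \<sigma>) - compL2 f (v \<sigma>))))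
              \<le> norm (G \<sigma> (hist u \<sigma>) - G \<sigma> (hist v \<sigma>)) + (norm (lam *\<^sub>R (u \<sigma> - v \<sigma>)) +
                norm (compL2 f (u \<sigma>) - compL2 f (v \<sigma>)))" .
            moreover have "norm (G \<sigma> (hist u \<sigma>) - G \<sigma> (hist v \<sigma>)) \<le> LG * K * b \<sigma>"
              by (rule delay_bound[OF cu(1) cv(1) normV_le b_mono \<sigma>'(2)])
            moreover have "norm (lam *\<^sub>R (u \<sigma> - v \<sigma>)) \<le> lam * (K * b \<sigma>)"
            proof -
              have "norm (u \<sigma> - v \<sigma>) \<le> K * normV \<Omega> (u \<sigma> - v \<sigma>)" by (rule K(2)[OF w[OF \<sigma>'(3)]])
              also have "\<dots> \<le> K * b \<sigma>" using normV_le[OF \<sigma>'(3)] K(1) by (intro mult_left_mono) auto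
              finally show ?thesis using lam by simp
            qed
            moreover have "norm (compL2 f (u \<sigma>) - compL2 f (v \<sigma>)) \<le> L * b \<sigma>"
            proof -
              have "norm (compL2 f (u \<sigma>) - compL2 f (v \<sigma>)) \<le> L * normV \<Omega> (u \<sigma> - v \<sigma>)"
                by (intro compL2_LipD[OF L] u(1) v(1) \<sigma>'(3) R \<sigma>'(2))
              also have "\<dots> \<le> L * b \<sigma>" using normV_le[OF \<sigma>'(3)] compL2_Lip_pos[OF L] by (intro mult_left_mono) auto
              finally show ?thesis .
            qed
            moreover have "LG * K * b \<sigma> + (lam * (K * b \<sigma>) + L * b \<sigma>) = c * b \<sigma>"
              by (simp add: c algebra_simps)
            ultimately show "norm (G \<sigma> (hist u \<sigma>) - G \<sigma> (hist v \<sigma>)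
              - (lam *\<^sub>R (u \<sigma> - v \<sigma>) + (compL2 f (u \<sigma>) - compL2 f (v \<sigma>)))) \<le> c * b \<sigma>"
              by linarith
          qed simp
          \<comment> \<open>The half of the square is enlarged to the full square, the form shared
            with the a priori bound, where splitting off \<open>h\<close> costs a factor 2.\<close>
          also have "\<dots> \<le> 1/2 * (norm \<phi>)\<^sup>2 + 1/2 * (c * b \<sigma>)\<^sup>2" by (rule Young_half)
          finally show "p \<sigma> - q \<sigma> - d \<sigma> \<le> 1/2 * (norm \<phi>)\<^sup>2 + (c\<^sup>2 * (b \<sigma>)\<^sup>2 + 0)"
            using zero_le_power2[of "c * b \<sigma>"] unfolding power_mult_distrib by linarith
        qed
      qed
    qed
    finally show "(ut y - vt y - (ut x - vt x)) \<bullet> \<phi> - (u y - v y - (u x - v x)) \<bullet> laplacian \<Omega> \<phi> +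
        integral {x..y} (\<lambda>\<sigma>. laplacian \<Omega> (u \<sigma> - v \<sigma>) \<bullet> laplacian \<Omega> \<phi> + 0 \<bullet> \<phi>)
      \<le> integral {x..y} (\<lambda>\<sigma>. 1/2 * (norm \<phi>)\<^sup>2 + (c\<^sup>2 * (b \<sigma>)\<^sup>2 + 0))" .
  qed auto
qed

text \<open>The summands of \<open>D\<close>: \<open>2 * M\<^sup>2\<close> for the initial energy,
  the bracket for twice the initial value of \<Psi>, \<open>2 * CF\<close> for minus twice its later
  values, \<open>2 * B\<close> for the forcing \<open>h\<close>. The Lipschitz constant enters only
  through the potential of the initial state, so the radius \<open>M\<close> of the initial
  histories suffices and no bound on the solution is presupposed.\<close>

lemma a_priori_bound:
  assumes ws: "weak_solution \<Omega> lam r f G h \<tau> T \<phi>0 \<phi>1 u ut" and \<tau>T: "\<tau> < T"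
    and L: "compL2_Lip \<Omega> f M L"
    and CF: "0 \<le> CF" "\<And>u. u \<in> V \<Omega> \<Longrightarrow> - CF - lam / 4 * (norm u)\<^sup>2 \<le> potential f u"
    and M: "0 < M" "\<And>s. s \<in> {\<tau> - r..\<tau>} \<Longrightarrow> normV \<Omega> (u s) \<le> M" "\<And>s. s \<in> {\<tau> - r..\<tau>} \<Longrightarrow> norm (ut s) \<le> M"
    and B: "B = integral {\<tau>..T} (\<lambda>s. (norm (h s))\<^sup>2)"
    and D: "D = 2 * M\<^sup>2 + (lam * (K * M)\<^sup>2 + 2 * (L * M * (K * M))) + 2 * CF + 2 * B"
    and c: "c = LG * K" and t: "t \<in> {\<tau> - r..T}"
  shows "(norm (ut t))\<^sup>2 + (normV \<Omega> (u t))\<^sup>2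
    \<le> 2 * D * exp (2 * (1 + 2 * c\<^sup>2) * r) * exp (2 * (1 + 2 * c\<^sup>2) * (t - \<tau>))"
proof -
  note cu = weak_solution_continuous[OF ws]
  note u = cont_into_VD[OF cu(1)] and ut = cont_into_HD[OF cu(2)]
  have der: "(u has_vector_derivative ut s) (at s within {\<tau>..T})" if "s \<in> {\<tau>..T}" for s
    by (rule weak_solution_has_vector_derivative[OF ws \<tau>T that])
  have h_int: "(\<lambda>s. (norm (h s))\<^sup>2) absolutely_integrable_on {x..y}" for x y
    using h by (intro L2_into_norm_sq_integrable[where X="H \<Omega>"]) (simp add: L2loc_into_def)
  have h_int': "(\<lambda>s. (norm (h s))\<^sup>2) integrable_on {x..y}" for x y
    by (rule set_lebesgue_integral_eq_integral(1)[OF h_int])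
  have B0: "0 \<le> B" unfolding B by (rule integral_nonneg[OF h_int']) simp
  have D0: "2 * M\<^sup>2 \<le> D"
  proof -
    have "0 \<le> lam * (K * M)\<^sup>2" "0 \<le> L * M * (K * M)"
      using lam compL2_Lip_pos[OF L] K(1) M(1) by simp_all
    then show ?thesis using CF(1) B0 unfolding D by linarith
  qed
  define k where "k s = lam *\<^sub>R u s + compL2 f (u s)" for s
  have k: "continuous_on {\<tau> - r..T} k"
    unfolding k_def by (intro continuous_intros u)
  \<comment> \<open>Keeping the linear term together with the potential is essential: its share
    lam/2 of |u|^2 outweighs the loss lam/4 in the lower bound of the potential, so \<Psi> >=
    -CF.\<close>
  define \<Psi> where "\<Psi> s = lam / 2 * (norm (u s))\<^sup>2 + potential f (u s)" for s
  have \<Psi>_der: "(\<Psi> has_real_derivative k s \<bullet> ut s) (at s within {\<tau>..T})" if s: "s \<in> {\<tau>..T}" for s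
  proof -
    have sub: "{\<tau>..T} \<subseteq> {\<tau> - r..T}" using r by auto
    have "((\<lambda>x. normV \<Omega> (u x - u s)) \<longlongrightarrow> 0) (at s within {\<tau>..T})"
      using cont_into_subset[OF cu(1) sub] s by (simp add: cont_into_def)
    then have "((\<lambda>s. potential f (u s)) has_real_derivative compL2 f (u s) \<bullet> ut s) (at s within {\<tau>..T})"
      using u(1) sub by (intro potential_has_real_derivative[OF f open_\<Omega> _ s _ der[OF s]]) auto
    moreover have "((\<lambda>s. u s \<bullet> u s) has_real_derivative 2 * (u s \<bullet> ut s)) (at s within {\<tau>..T})"
      using bounded_bilinear.has_vector_derivative[OF bounded_bilinear_inner der[OF s] der[OF s]]
      by (simp add: has_real_derivative_iff_has_vector_derivative inner_commute)
    ultimately show ?thesis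
      unfolding \<Psi>_def[abs_def] power2_norm_eq_inner k_def inner_add_left inner_scaleR_left
      by (auto intro!: derivative_eq_intros)
  qed
  define X where "X s = (norm (ut s))\<^sup>2 + (normV \<Omega> (u s))\<^sup>2" for s
  have X_init: "X s \<le> 2 * M\<^sup>2" if "s \<in> {\<tau> - r..\<tau>}" for s
  proof -
    have "(norm (ut s))\<^sup>2 \<le> M\<^sup>2" "(normV \<Omega> (u s))\<^sup>2 \<le> M\<^sup>2"
      using M(2,3)[OF that] normV_nonneg[of \<Omega> "u s"] by (intro power_mono; simp)+
    then show ?thesis by (simp add: X_def)
  qed
  show ?thesis
  proof (rule energy_Gronwall[where k=k and \<Psi>=\<Psi> and g="\<lambda>s. (norm (h s))\<^sup>2", OF \<tau>T u(1) ut(1) u(3) k der \<Psi>_der h_int' zero_le_power2 _ _ _ t])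
    show "(norm (ut s))\<^sup>2 + (normV \<Omega> (u s))\<^sup>2 \<le> D" if "s \<in> {\<tau> - r..\<tau>}" for s
      using X_init[OF that] D0 by (simp add: X_def)
    show "(norm (ut \<tau>))\<^sup>2 + (normV \<Omega> (u \<tau>))\<^sup>2 + 2 * \<Psi> \<tau> - 2 * \<Psi> t
        + 2 * integral {\<tau>..T} (\<lambda>s. (norm (h s))\<^sup>2) \<le> D" if t: "t \<in> {\<tau>..T}" for t
    proof -
      have t': "t \<in> {\<tau> - r..T}" "\<tau> \<in> {\<tau> - r..T}" "\<tau> \<in> {\<tau> - r..\<tau>}" using t r \<tau>T by auto
      have e5: "- 2 * \<Psi> t \<le> 2 * CF"
      proof -
        have "0 \<le> lam / 4 * (norm (u t))\<^sup>2" using lam by simp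
        then show ?thesis using CF(2)[OF u(1)[OF t'(1)]] by (simp add: \<Psi>_def)
      qed
      have e6: "2 * \<Psi> \<tau> \<le> lam * (K * M)\<^sup>2 + 2 * (L * M * (K * M))"
      proof -
        have nV: "normV \<Omega> (u \<tau>) \<le> M" by (rule M(2)[OF t'(3)])
        have "norm (u \<tau>) \<le> K * normV \<Omega> (u \<tau>)" by (rule K(2)[OF u(1)[OF t'(2)]])
        also have "\<dots> \<le> K * M" using nV K(1) by (intro mult_left_mono) auto
        finally have n: "norm (u \<tau>) \<le> K * M" .
        have "potential f (u \<tau>) \<le> L * normV \<Omega> (u \<tau>) * norm (u \<tau>)"
          using potential_bound(2)[OF f open_\<Omega> u(1)[OF t'(2)] L nV] by linarith
        also have "\<dots> \<le> L * M * (K * M)"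
          using nV n compL2_Lip_pos[OF L] M(1) normV_nonneg[of \<Omega> "u \<tau>"] by (intro mult_mono) auto
        finally have "potential f (u \<tau>) \<le> L * M * (K * M)" .
        moreover have "lam * (norm (u \<tau>))\<^sup>2 \<le> lam * (K * M)\<^sup>2"
          using n lam by (intro mult_left_mono power_mono) auto
        ultimately show ?thesis by (simp add: \<Psi>_def)
      qed
      show ?thesis using X_init[OF t'(3)] e5 e6 unfolding D B X_def by linarith
    qed
    fix b :: "real \<Rightarrow> real" and \<phi> x y assume b_mono: "mono b" and b_cont: "continuous_on UNIV b"
      and normV_le: "\<And>s. s \<in> {\<tau> - r..T} \<Longrightarrow> normV \<Omega> (u s) \<le> b s"
      and \<phi>: "\<phi> \<in> V \<Omega>" and xy: "\<tau> \<le> x" "x \<le> y" and yT: "y \<le> T"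
    have xy_sub: "{x..y} \<subseteq> {\<tau>..T}" using xy yT by auto
    from weak_solution_integrated_equation[OF ws \<tau>T \<phi>]
    obtain q where q: "q absolutely_integrable_on {\<tau>..T}"
      "AE t in lebesgue. t \<in> {\<tau><..<T} \<longrightarrow> q t = (G t (hist u t) + h t) \<bullet> \<phi>"
      "\<And>s t. \<tau> \<le> s \<Longrightarrow> s \<le> t \<Longrightarrow> t \<le> T \<Longrightarrow> (ut t - ut s) \<bullet> \<phi> - (u t - u s) \<bullet> laplacian \<Omega> \<phi> +
        integral {s..t} (\<lambda>\<sigma>. laplacian \<Omega> (u \<sigma>) \<bullet> laplacian \<Omega> \<phi> + (lam *\<^sub>R u \<sigma> + compL2 f (u \<sigma>)) \<bullet> \<phi>)
        = integral {s..t} q" by blast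
    have "(ut y - ut x) \<bullet> \<phi> - (u y - u x) \<bullet> laplacian \<Omega> \<phi> +
        integral {x..y} (\<lambda>\<sigma>. laplacian \<Omega> (u \<sigma>) \<bullet> laplacian \<Omega> \<phi> + k \<sigma> \<bullet> \<phi>) = integral {x..y} q"
      unfolding k_def by (rule q(3)[OF xy(1,2) yT])
    also have "\<dots> \<le> integral {x..y} (\<lambda>\<sigma>. 1/2 * (norm \<phi>)\<^sup>2 + (c\<^sup>2 * (b \<sigma>)\<^sup>2 + (norm (h \<sigma>))\<^sup>2))"
    proof (rule integral_le_AE)
      show "q absolutely_integrable_on {x..y}"
        by (rule absolutely_integrable_on_subinterval[OF q(1) xy_sub])
      show "(\<lambda>\<sigma>. 1/2 * (norm \<phi>)\<^sup>2 + (c\<^sup>2 * (b \<sigma>)\<^sup>2 + (norm (h \<sigma>))\<^sup>2)) absolutely_integrable_on {x..y}"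
        by (intro set_integral_add h_int absolutely_integrable_continuous_real continuous_intros
            continuous_on_subset[OF b_cont]) auto
      show "AE \<sigma> in lebesgue. \<sigma> \<in> {x<..<y} \<longrightarrow> q \<sigma> \<le> 1/2 * (norm \<phi>)\<^sup>2 + (c\<^sup>2 * (b \<sigma>)\<^sup>2 + (norm (h \<sigma>))\<^sup>2)"
        using q(2)
      proof eventually_elim
        case (elim \<sigma>)
        show ?case
        proof
          assume \<sigma>: "\<sigma> \<in> {x<..<y}"
          then have \<sigma>': "\<sigma> \<in> {\<tau><..<T}" "\<sigma> \<in> {\<tau>..T}" using xy yT r by auto
          \<comment> \<open>Compared with the zero function, at whose history \<open>G\<close>
            vanishes, the Lipschitz bound becomes a growth bound.\<close>
          have zero: "cont_into (V \<Omega>) (normV \<Omega>) {\<tau> - r..T} (\<lambda>_. 0)"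
            using subspace_0[OF subspace_V] normV_zero[OF open_\<Omega>] by (simp add: cont_into_def)
          have "norm (G \<sigma> (hist u \<sigma>) - G \<sigma> (hist (\<lambda>_. 0) \<sigma>)) \<le> LG * K * b \<sigma>"
            by (rule delay_bound[OF cu(1) zero _ b_mono \<sigma>'(2)]) (simp add: normV_le)
          then have G_le: "norm (G \<sigma> (hist u \<sigma>)) \<le> c * b \<sigma>"
            by (simp add: hist_def G_zero c)
          have "q \<sigma> = (G \<sigma> (hist u \<sigma>) + h \<sigma>) \<bullet> \<phi>" using elim \<sigma>'(1) by simp
          also have "\<dots> \<le> norm (G \<sigma> (hist u \<sigma>) + h \<sigma>) * norm \<phi>" by (rule norm_cauchy_schwarz)
          also have "\<dots> \<le> (c * b \<sigma> + norm (h \<sigma>)) * norm \<phi>"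
            using norm_triangle_ineq[of "G \<sigma> (hist u \<sigma>)" "h \<sigma>"] G_le by (intro mult_right_mono) auto
          also have "\<dots> \<le> 1/2 * (norm \<phi>)\<^sup>2 + 1/2 * (c * b \<sigma> + norm (h \<sigma>))\<^sup>2" by (rule Young_half)
          \<comment> \<open>The mixed product is absorbed by Young's inequality, which separates the
            delay from the integrable term in \<open>h\<close>.\<close>
          also have "1/2 * (c * b \<sigma> + norm (h \<sigma>))\<^sup>2 \<le> (c * b \<sigma>)\<^sup>2 + (norm (h \<sigma>))\<^sup>2"
            using Young_half[of "c * b \<sigma>" "norm (h \<sigma>)"] by (simp add: power2_sum)
          finally show "q \<sigma> \<le> 1/2 * (norm \<phi>)\<^sup>2 + (c\<^sup>2 * (b \<sigma>)\<^sup>2 + (norm (h \<sigma>))\<^sup>2)"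
            by (simp add: power_mult_distrib)
        qed
      qed
    qed
    finally show "(ut y - ut x) \<bullet> \<phi> - (u y - u x) \<bullet> laplacian \<Omega> \<phi> +
        integral {x..y} (\<lambda>\<sigma>. laplacian \<Omega> (u \<sigma>) \<bullet> laplacian \<Omega> \<phi> + k \<sigma> \<bullet> \<phi>)
      \<le> integral {x..y} (\<lambda>\<sigma>. 1/2 * (norm \<phi>)\<^sup>2 + (c\<^sup>2 * (b \<sigma>)\<^sup>2 + (norm (h \<sigma>))\<^sup>2))" .
  qed
qed

section \<open>Initial histories and uniqueness\<close>

lemma history_le_sup_norm:
  assumes "(\<phi>01, \<phi>11) \<in> compatible_histories \<Omega> r" "(\<phi>02, \<phi>12) \<in> compatible_histories \<Omega> r"
    and \<theta>: "\<theta> \<in> {-r..0}"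
  shows "normV \<Omega> (\<phi>01 \<theta> - \<phi>02 \<theta>) \<le> sup_norm r (normV \<Omega>) (\<lambda>\<theta>. \<phi>01 \<theta> - \<phi>02 \<theta>)"
    "norm (\<phi>11 \<theta> - \<phi>12 \<theta>) \<le> sup_norm r norm (\<lambda>\<theta>. \<phi>11 \<theta> - \<phi>12 \<theta>)"
    "normV \<Omega> (\<phi>01 \<theta>) \<le> sup_norm r (normV \<Omega>) \<phi>01" "norm (\<phi>11 \<theta>) \<le> sup_norm r norm \<phi>11"
proof -
  have c: "cont_into (V \<Omega>) (normV \<Omega>) {-r..0} \<phi>01" "cont_into (V \<Omega>) (normV \<Omega>) {-r..0} \<phi>02"
    "cont_into (H \<Omega>) norm {-r..0} \<phi>11" "cont_into (H \<Omega>) norm {-r..0} \<phi>12"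
    using assms by (auto simp: compatible_histories_def C_V_def C_H_def)
  note c1 = cont_into_VD[OF c(1)] and c2 = cont_into_VD[OF c(2)]
    and c3 = cont_into_HD[OF c(3)] and c4 = cont_into_HD[OF c(4)]
  have "continuous_on {-r..0} (\<lambda>\<theta>. normV \<Omega> (\<phi>01 \<theta> - \<phi>02 \<theta>))"
  proof (rule continuous_on_eq)
    show "continuous_on {-r..0} (\<lambda>\<theta>. norm (laplacian \<Omega> (\<phi>01 \<theta>) - laplacian \<Omega> (\<phi>02 \<theta>)))"
      by (intro continuous_intros c1 c2)
    show "norm (laplacian \<Omega> (\<phi>01 x) - laplacian \<Omega> (\<phi>02 x)) = normV \<Omega> (\<phi>01 x - \<phi>02 x)" if "x \<in> {-r..0}" for x
      using laplacian_diff[OF open_\<Omega> c1(1)[OF that] c2(1)[OF that]] by (simp add: normV_def)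
  qed
  from le_sup_norm[where N="normV \<Omega>" and \<xi>="\<lambda>\<theta>. \<phi>01 \<theta> - \<phi>02 \<theta>", OF this \<theta>]
  show "normV \<Omega> (\<phi>01 \<theta> - \<phi>02 \<theta>) \<le> sup_norm r (normV \<Omega>) (\<lambda>\<theta>. \<phi>01 \<theta> - \<phi>02 \<theta>)" .
  show "norm (\<phi>11 \<theta> - \<phi>12 \<theta>) \<le> sup_norm r norm (\<lambda>\<theta>. \<phi>11 \<theta> - \<phi>12 \<theta>)"
    by (rule le_sup_norm[where \<xi>="\<lambda>\<theta>. \<phi>11 \<theta> - \<phi>12 \<theta>", OF _ \<theta>]) (intro continuous_intros c3 c4)
  show "normV \<Omega> (\<phi>01 \<theta>) \<le> sup_norm r (normV \<Omega>) \<phi>01"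
    by (rule le_sup_norm[where \<xi>=\<phi>01, OF _ \<theta>]) (unfold normV_def, intro continuous_intros c1)
  show "norm (\<phi>11 \<theta>) \<le> sup_norm r norm \<phi>11"
    by (rule le_sup_norm[where \<xi>=\<phi>11, OF _ \<theta>]) (intro continuous_intros c3)
qed

lemma weak_solution_initial:
  assumes "weak_solution \<Omega> lam r f G h \<tau> T \<phi>0 \<phi>1 u ut" "s \<in> {\<tau> - r..\<tau>}"
  shows "u s = \<phi>0 (s - \<tau>)" "ut s = \<phi>1 (s - \<tau>)"
  using assms by (auto simp: weak_solution_def)

text \<open>A radius for both solutions exists by continuity on a compact time interval. It may
  depend on the solutions, since the initial difference 0 is multiplied by the resulting constant.
  \<open>normV\<close> controls \<open>norm\<close> through \<open>K\<close>, which turns a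
  vanishing energy into equality.\<close>

lemma weak_solutions_unique:
  assumes ws1: "weak_solution \<Omega> lam r f G h \<tau> T \<phi>0 \<phi>1 u ut"
    and ws2: "weak_solution \<Omega> lam r f G h \<tau> T \<phi>0 \<phi>1 v vt" and \<tau>T: "\<tau> < T"
    and t: "t \<in> {\<tau> - r..T}"
  shows "u t = v t \<and> ut t = vt t"
proof -
  note u = cont_into_VD[OF weak_solution_continuous(1)[OF ws1]]
    and v = cont_into_VD[OF weak_solution_continuous(1)[OF ws2]]
  have "continuous_on {\<tau> - r..T} (\<lambda>s. normV \<Omega> (u s) + normV \<Omega> (v s))"
    unfolding normV_def by (intro continuous_intros u v)
  from compact_imp_bounded[OF compact_continuous_image[OF this compact_Icc]]
  obtain R where R: "R > 0" "\<And>s. s \<in> {\<tau> - r..T} \<Longrightarrow> normV \<Omega> (u s) + normV \<Omega> (v s) \<le> R"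
    unfolding bounded_pos by (force simp: normV_nonneg)
  obtain L where L: "compL2_Lip \<Omega> f R L"
    using ex_compL2_Lip[OF f open_\<Omega> R(1)] ..
  have "(norm (ut t - vt t))\<^sup>2 + (normV \<Omega> (u t - v t))\<^sup>2 \<le> 2 * 0 * exp (2 * (1 + 2 * (LG * K + (lam * K + L))\<^sup>2) * r)
      * exp (2 * (1 + 2 * (LG * K + (lam * K + L))\<^sup>2) * (t - \<tau>))"
  proof (rule difference_bound[OF ws1 ws2 \<tau>T L _ _ refl t])
    show "normV \<Omega> (u s) + normV \<Omega> (v s) \<le> R" if "s \<in> {\<tau>..T}" for s using R(2)[of s] that r by auto
    show "(norm (ut s - vt s))\<^sup>2 + (normV \<Omega> (u s - v s))\<^sup>2 \<le> 0" if "s \<in> {\<tau> - r..\<tau>}" for s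
      using weak_solution_initial[OF ws1 that] weak_solution_initial[OF ws2 that] normV_zero[OF open_\<Omega>] by simp
  qed
  then have le: "(norm (ut t - vt t))\<^sup>2 + (normV \<Omega> (u t - v t))\<^sup>2 \<le> 0" by simp
  have nn: "0 \<le> (norm (ut t - vt t))\<^sup>2" "0 \<le> (normV \<Omega> (u t - v t))\<^sup>2" by simp_all
  from le nn have "(norm (ut t - vt t))\<^sup>2 = 0" "(normV \<Omega> (u t - v t))\<^sup>2 = 0" by linarith+
  then have eq: "ut t = vt t" "normV \<Omega> (u t - v t) = 0" by simp_all
  have "u t - v t \<in> V \<Omega>" using u(1)[OF t] v(1)[OF t] subspace_diff[OF subspace_V] by blast
  then have "norm (u t - v t) \<le> 0" using K(2) eq(2) by fastforce
  then show ?thesis using eq(1) by simp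
qed

end

theorem theorem3p3:
  fixes \<Omega> :: "'a::euclidean_space set" and lam \<mu>0 :: real
  assumes "smooth_bounded_domain \<Omega>" and "lam > 0" and "\<mu>0 > 0"
  shows "\<exists>\<delta>max>0. \<forall>\<delta>0 r \<tau> f G h.
    0 < \<delta>0 \<longrightarrow> \<delta>0 < \<delta>max \<longrightarrow> 0 < r \<longrightarrow>
    f_hypotheses \<Omega> lam \<mu>0 \<delta>0 f \<longrightarrow> G_hypotheses \<Omega> r G \<longrightarrow> L2loc_into (H \<Omega>) norm h \<longrightarrow>
      (\<forall>T>\<tau>. \<forall>(\<phi>0, \<phi>1)\<in>compatible_histories \<Omega> r. \<forall>u ut v vt.
         weak_solution \<Omega> lam r f G h \<tau> T \<phi>0 \<phi>1 u ut \<longrightarrow>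
         weak_solution \<Omega> lam r f G h \<tau> T \<phi>0 \<phi>1 v vt \<longrightarrow>
         (\<forall>t\<in>{\<tau> - r..T}. u t = v t \<and> ut t = vt t))
      \<and>
      (\<exists>C2 :: real \<Rightarrow> real \<Rightarrow> real. \<forall>T>\<tau>.
         (\<forall>R>0. C2 T R > 0 \<and>
           (\<forall>(\<phi>01, \<phi>11)\<in>compatible_histories \<Omega> r. \<forall>(\<phi>02, \<phi>12)\<in>compatible_histories \<Omega> r.
            \<forall>u ut v vt.
              weak_solution \<Omega> lam r f G h \<tau> T \<phi>01 \<phi>11 u ut \<longrightarrow>
              weak_solution \<Omega> lam r f G h \<tau> T \<phi>02 \<phi>12 v vt \<longrightarrow>
              (\<forall>s\<in>{\<tau>..T}. normV \<Omega> (u s) + normV \<Omega> (v s) \<le> R) \<longrightarrow>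
              (\<forall>t\<in>{\<tau>..T}.
                 (sup_norm r (normV \<Omega>) (\<lambda>\<theta>. hist u t \<theta> - hist v t \<theta>))\<^sup>2
                 + (sup_norm r norm (\<lambda>\<theta>. hist ut t \<theta> - hist vt t \<theta>))\<^sup>2
                 \<le> C2 T R * ((sup_norm r (normV \<Omega>) (\<lambda>\<theta>. \<phi>01 \<theta> - \<phi>02 \<theta>))\<^sup>2
                             + (sup_norm r norm (\<lambda>\<theta>. \<phi>11 \<theta> - \<phi>12 \<theta>))\<^sup>2)))) \<and>
         (\<forall>M>0. \<exists>R>0.
           \<forall>(\<phi>01, \<phi>11)\<in>compatible_histories \<Omega> r. \<forall>(\<phi>02, \<phi>12)\<in>compatible_histories \<Omega> r.
           \<forall>u ut v vt.
              sup_norm r (normV \<Omega>) \<phi>01 \<le> M \<longrightarrow> sup_norm r norm \<phi>11 \<le> M \<longrightarrow>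
              sup_norm r (normV \<Omega>) \<phi>02 \<le> M \<longrightarrow> sup_norm r norm \<phi>12 \<le> M \<longrightarrow>
              weak_solution \<Omega> lam r f G h \<tau> T \<phi>01 \<phi>11 u ut \<longrightarrow>
              weak_solution \<Omega> lam r f G h \<tau> T \<phi>02 \<phi>12 v vt \<longrightarrow>
              (\<forall>s\<in>{\<tau>..T}. normV \<Omega> (u s) + normV \<Omega> (v s) \<le> R)))"
proof -
  have o: "open \<Omega>" "bounded \<Omega>" using assms(1) by (auto simp: smooth_bounded_domain_def)
  from Poincare_inequality[OF o]
  obtain K where K: "K > 0" "\<And>u. u \<in> V \<Omega> \<Longrightarrow> norm u \<le> K * normV \<Omega> u" by blast
  show ?thesis
  proof (rule exI[of _ 1], rule conjI[OF zero_less_one], intro allI impI, goal_cases)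
    case (1 \<delta>0 r \<tau> f G h)
    note r = 1(3) and f = 1(4) and G = 1(5) and h = 1(6)
    have "\<exists>LG>0. \<forall>t. \<forall>\<xi>\<in>C_H \<Omega> r. \<forall>\<eta>\<in>C_H \<Omega> r.
        norm (G t \<xi> - G t \<eta>) \<le> LG * sup_norm r norm (\<lambda>\<theta>. \<xi> \<theta> - \<eta> \<theta>)"
      using G unfolding G_hypotheses_def by (elim conjE)
    then obtain LG where LG: "LG > 0" "\<And>t \<xi> \<eta>. \<xi> \<in> C_H \<Omega> r \<Longrightarrow> \<eta> \<in> C_H \<Omega> r \<Longrightarrow>
        norm (G t \<xi> - G t \<eta>) \<le> LG * sup_norm r norm (\<lambda>\<theta>. \<xi> \<theta> - \<eta> \<theta>)"
      by blast
    interpret delayed_plate \<Omega> lam \<mu>0 \<delta>0 r K LG f G h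
      by unfold_locales (use o assms(2) r f K LG G h in \<open>auto simp: G_hypotheses_def\<close>)
    \<comment> \<open>A Lipschitz constant is chosen for every radius at once, so that
      \<open>C2\<close> is a function of T and R alone.\<close>
    obtain L where L: "\<And>R. R > 0 \<Longrightarrow> compL2_Lip \<Omega> f R (L R)"
      using ex_compL2_Lip[OF f o(1)] by metis
    define c where "c R = LG * K + (lam * K + L R)" for R
    \<comment> \<open>The factor of \<open>difference_bound\<close> at the final time T, which
      dominates the factors at all earlier times.\<close>
    define C where "C T R = 2 * exp (2 * (1 + 2 * (c R)\<^sup>2) * r) * exp (2 * (1 + 2 * (c R)\<^sup>2) * (T - \<tau>))" for T R
    have dependence: "(sup_norm r (normV \<Omega>) (\<lambda>\<theta>. hist u t \<theta> - hist v t \<theta>))\<^sup>2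
        + (sup_norm r norm (\<lambda>\<theta>. hist ut t \<theta> - hist vt t \<theta>))\<^sup>2
        \<le> 2 * C T R * ((sup_norm r (normV \<Omega>) (\<lambda>\<theta>. \<phi>01 \<theta> - \<phi>02 \<theta>))\<^sup>2
                    + (sup_norm r norm (\<lambda>\<theta>. \<phi>11 \<theta> - \<phi>12 \<theta>))\<^sup>2)"
      if "\<tau> < T" "R > 0" and comp: "(\<phi>01, \<phi>11) \<in> compatible_histories \<Omega> r" "(\<phi>02, \<phi>12) \<in> compatible_histories \<Omega> r"
        and ws1: "weak_solution \<Omega> lam r f G h \<tau> T \<phi>01 \<phi>11 u ut"
        and ws2: "weak_solution \<Omega> lam r f G h \<tau> T \<phi>02 \<phi>12 v vt"
        and R: "\<forall>s\<in>{\<tau>..T}. normV \<Omega> (u s) + normV \<Omega> (v s) \<le> R" and t: "t \<in> {\<tau>..T}"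
      for T R \<phi>01 \<phi>11 \<phi>02 \<phi>12 u ut v vt t
    proof -
      define D where "D = (sup_norm r (normV \<Omega>) (\<lambda>\<theta>. \<phi>01 \<theta> - \<phi>02 \<theta>))\<^sup>2
                    + (sup_norm r norm (\<lambda>\<theta>. \<phi>11 \<theta> - \<phi>12 \<theta>))\<^sup>2"
      have D0: "0 \<le> D" by (simp add: D_def)
      have init: "(norm (ut s - vt s))\<^sup>2 + (normV \<Omega> (u s - v s))\<^sup>2 \<le> D" if s: "s \<in> {\<tau> - r..\<tau>}" for s
      proof -
        have \<theta>: "s - \<tau> \<in> {-r..0}" using s by auto
        note sup = history_le_sup_norm[OF comp \<theta>]
        show ?thesis
          unfolding D_def weak_solution_initial[OF ws1 s] weak_solution_initial[OF ws2 s] add.commute[of "(norm _)\<^sup>2"]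
          by (intro add_mono power_mono sup normV_nonneg norm_ge_zero)
      qed
      have bound: "(norm (ut s - vt s))\<^sup>2 + (normV \<Omega> (u s - v s))\<^sup>2 \<le> C T R * D" if s: "s \<in> {\<tau> - r..T}" for s
      proof -
        have "(norm (ut s - vt s))\<^sup>2 + (normV \<Omega> (u s - v s))\<^sup>2
            \<le> 2 * D * exp (2 * (1 + 2 * (c R)\<^sup>2) * r) * exp (2 * (1 + 2 * (c R)\<^sup>2) * (s - \<tau>))"
          using R by (intro difference_bound[OF ws1 ws2 \<open>\<tau> < T\<close> L[OF \<open>R > 0\<close>] _ init c_def s]) auto
        also have "\<dots> \<le> 2 * D * exp (2 * (1 + 2 * (c R)\<^sup>2) * r) * exp (2 * (1 + 2 * (c R)\<^sup>2) * (T - \<tau>))"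
          using s D0 by (intro mult_left_mono) (auto intro!: mult_left_mono add_nonneg_nonneg)
        finally show ?thesis by (simp add: C_def mult_ac)
      qed
      \<comment> \<open>The pointwise bound also shows that the supremum is taken over a bounded
        set; its nonnegativity is needed to square the estimate.\<close>
      have sup: "0 \<le> sup_norm r N (\<lambda>\<theta>. p t \<theta>) \<and> (sup_norm r N (\<lambda>\<theta>. p t \<theta>))\<^sup>2 \<le> C T R * D"
        if "\<And>\<theta>. \<theta> \<in> {-r..0} \<Longrightarrow> 0 \<le> N (p t \<theta>) \<and> (N (p t \<theta>))\<^sup>2 \<le> C T R * D"
        for N and p :: "real \<Rightarrow> real \<Rightarrow> 'a L2"
      proof -
        have le: "N (p t \<theta>) \<le> sqrt (C T R * D)" if "\<theta> \<in> {-r..0}" for \<theta>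
          using \<open>\<And>\<theta>. \<theta> \<in> {-r..0} \<Longrightarrow> 0 \<le> N (p t \<theta>) \<and> (N (p t \<theta>))\<^sup>2 \<le> C T R * D\<close>[OF that] by (simp add: real_le_rsqrt)
        have "0 \<le> N (p t 0)" using that[of 0] r by simp
        also have "\<dots> \<le> sup_norm r N (\<lambda>\<theta>. p t \<theta>)"
          unfolding sup_norm_def using le r by (intro cSUP_upper bdd_aboveI2[of _ _ "sqrt (C T R * D)"]) auto
        finally have "0 \<le> sup_norm r N (\<lambda>\<theta>. p t \<theta>)" .
        moreover have "sup_norm r N (\<lambda>\<theta>. p t \<theta>) \<le> sqrt (C T R * D)"
          using le r by (intro sup_norm_le) auto
        moreover have "0 \<le> C T R * D" using D0 by (simp add: C_def)
        ultimately show ?thesis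
          using power_mono[of "sup_norm r N (\<lambda>\<theta>. p t \<theta>)" "sqrt (C T R * D)" 2] by simp
      qed
      have each: "(norm (ut (t + \<theta>) - vt (t + \<theta>)))\<^sup>2 \<le> C T R * D" "(normV \<Omega> (u (t + \<theta>) - v (t + \<theta>)))\<^sup>2 \<le> C T R * D"
        if "\<theta> \<in> {-r..0}" for \<theta>
      proof -
        have "t + \<theta> \<in> {\<tau> - r..T}" using that t by auto
        from bound[OF this] show "(norm (ut (t + \<theta>) - vt (t + \<theta>)))\<^sup>2 \<le> C T R * D"
          "(normV \<Omega> (u (t + \<theta>) - v (t + \<theta>)))\<^sup>2 \<le> C T R * D"
          by (smt (verit) zero_le_power2)+
      qed
      have "(sup_norm r (normV \<Omega>) (\<lambda>\<theta>. hist u t \<theta> - hist v t \<theta>))\<^sup>2 \<le> C T R * D"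
        using sup[of "normV \<Omega>" "\<lambda>t \<theta>. hist u t \<theta> - hist v t \<theta>"] each(2) by (simp add: hist_def normV_nonneg)
      moreover have "(sup_norm r norm (\<lambda>\<theta>. hist ut t \<theta> - hist vt t \<theta>))\<^sup>2 \<le> C T R * D"
        using sup[of norm "\<lambda>t \<theta>. hist ut t \<theta> - hist vt t \<theta>"] each(1) by (simp add: hist_def)
      \<comment> \<open>Each squared sup norm is bounded separately by \<open>C T R * D\<close>, as
        their maxima may lie at different times; this accounts for the factor 2.\<close>
      ultimately show ?thesis unfolding D_def[symmetric] by linarith
    qed
    have radius: "\<exists>R>0. \<forall>\<phi>0 \<phi>1 u ut. (\<phi>0, \<phi>1) \<in> compatible_histories \<Omega> r \<longrightarrow>
        sup_norm r (normV \<Omega>) \<phi>0 \<le> M \<longrightarrow> sup_norm r norm \<phi>1 \<le> M \<longrightarrow>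
        weak_solution \<Omega> lam r f G h \<tau> T \<phi>0 \<phi>1 u ut \<longrightarrow> (\<forall>s\<in>{\<tau>..T}. normV \<Omega> (u s) \<le> R)"
      if "\<tau> < T" "M > 0" for T M
    proof -
      from potential_lower_bound[OF f o] obtain CF where CF: "0 \<le> CF"
        "\<And>u. u \<in> V \<Omega> \<Longrightarrow> - CF - lam / 4 * (norm u)\<^sup>2 \<le> potential f u" by blast
      define B where "B = integral {\<tau>..T} (\<lambda>s. (norm (h s))\<^sup>2)"
      define D where "D = 2 * M\<^sup>2 + (lam * (K * M)\<^sup>2 + 2 * (L M * M * (K * M))) + 2 * CF + 2 * B"
      define A where "A s = 2 * D * exp (2 * (1 + 2 * (LG * K)\<^sup>2) * r) * exp (2 * (1 + 2 * (LG * K)\<^sup>2) * (s - \<tau>))" for s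
      show ?thesis
      \<comment> \<open>The absolute value makes the witness meaningful before the sign of
        \<open>A T\<close> is known, and the added 1 makes it positive.\<close>
      proof (intro exI[of _ "sqrt \<bar>A T\<bar> + 1"] conjI allI impI ballI)
        show "0 < sqrt \<bar>A T\<bar> + 1" by (intro add_nonneg_pos) auto
        fix \<phi>0 \<phi>1 u ut s
        assume comp: "(\<phi>0, \<phi>1) \<in> compatible_histories \<Omega> r" and M: "sup_norm r (normV \<Omega>) \<phi>0 \<le> M" "sup_norm r norm \<phi>1 \<le> M"
          and ws: "weak_solution \<Omega> lam r f G h \<tau> T \<phi>0 \<phi>1 u ut" and s: "s \<in> {\<tau>..T}"
        have init: "normV \<Omega> (u x) \<le> M" "norm (ut x) \<le> M" if x: "x \<in> {\<tau> - r..\<tau>}" for x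
        proof -
          have "x - \<tau> \<in> {-r..0}" using x by auto
          from history_le_sup_norm(3,4)[OF comp comp this] M
          show "normV \<Omega> (u x) \<le> M" "norm (ut x) \<le> M"
            unfolding weak_solution_initial[OF ws x] by linarith+
        qed
        have bound: "(norm (ut x))\<^sup>2 + (normV \<Omega> (u x))\<^sup>2 \<le> A x" if "x \<in> {\<tau> - r..T}" for x
          unfolding A_def
          by (rule a_priori_bound[OF ws \<open>\<tau> < T\<close> L[OF \<open>M > 0\<close>] CF \<open>M > 0\<close> init B_def D_def refl that])
        have sT: "s \<in> {\<tau> - r..T}" using s r by auto
        \<comment> \<open>The sign of \<open>D\<close> is read off from the bound itself, as it
          dominates an energy; monotonicity of \<open>A\<close> in time follows.\<close>
        have "0 \<le> A s" by (rule order_trans[OF _ bound[OF sT]]) simp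
        then have "0 \<le> 2 * D * exp (2 * (1 + 2 * (LG * K)\<^sup>2) * r)"
          unfolding A_def by (simp add: zero_le_mult_iff)
        then have "A s \<le> A T"
          unfolding A_def using s by (intro mult_left_mono) (auto intro!: mult_left_mono add_nonneg_nonneg)
        then have "(normV \<Omega> (u s))\<^sup>2 \<le> \<bar>A T\<bar>"
          using bound[OF sT] zero_le_power2[of "norm (ut s)"] by linarith
        then have "normV \<Omega> (u s) \<le> sqrt \<bar>A T\<bar>" by (rule real_le_rsqrt)
        then show "normV \<Omega> (u s) \<le> sqrt \<bar>A T\<bar> + 1" by simp
      qed
    qed
    show ?case
    proof (rule conjI, goal_cases)
      case 1
      show ?case
        by (intro allI impI ballI, clarify, rule weak_solutions_unique, assumption+)
    next
      case 2
      show ?case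
      proof (intro exI[of _ "\<lambda>T R. 2 * C T R"] allI impI conjI, goal_cases)
        case (1 T R)
        show ?case by (simp add: C_def)
      next
        case (2 T R)
        show ?case by (clarify, rule dependence[OF 2], assumption+)
      next
        case (3 T M)
        from radius[OF 3] obtain R where R: "R > 0" "\<And>\<phi>0 \<phi>1 u ut s.
          weak_solution \<Omega> lam r f G h \<tau> T \<phi>0 \<phi>1 u ut \<Longrightarrow> (\<phi>0, \<phi>1) \<in> compatible_histories \<Omega> r \<Longrightarrow>
          sup_norm r (normV \<Omega>) \<phi>0 \<le> M \<Longrightarrow> sup_norm r norm \<phi>1 \<le> M \<Longrightarrow>
          s \<in> {\<tau>..T} \<Longrightarrow> normV \<Omega> (u s) \<le> R"
          by blast
        show ?case
        \<comment> \<open>Each of the two solutions is bounded by \<open>R\<close> on its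
          own.\<close>
        proof (intro exI[of _ "R + R"] conjI)
          show "0 < R + R" using R(1) by simp
        qed (clarify, intro add_mono; rule R(2), assumption+)
      qed
    qed
  qed
qed

end
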